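(* Let $X$ be a smooth closed oriented Riemannian four-manifold with $b_2^+(X)\neq 0$, let $\mathfrak{s}$ be a $Spin^c$ structure on $X$ with a fixed background $Spin^c$ connection $B$, and let $E\to X$ be a Hermitian vector bundle of rank $n>1$. Then for a generic imaginary-valued self-dual 2-form $\eta\in\Omega^2_+(X;i\mathbb{R})$ the $U(n)$ monopole moduli space $M_{\mathfrak{s},E}(0,\eta)$ with parameter $\tau=0$ is empty.
   Context: "Generic" means: for all $\eta$ in a residual subset (one containing a countable intersection of open dense subsets) of $\Omega^2_+(X;i\mathbb{R})$ with the $C^\infty$ topology. Setting. The $Spin^c$ structure $\mathfrak{s}$ consists of Hermitian rank 2 bundles $S^\pm_{\mathfrak{s}}$ with identified determinant line bundles and a Clifford multiplication $\gamma:\Lambda^1(T^*X)\to \mathrm{Hom}_{\mathbb{C}}(S^+_{\mathfrak{s}},S^-_{\mathfrak{s}})$; extended to exterior powers it induces an isomorphism $\gamma:\Lambda^2_+(T^*X)\to\mathfrak{su}(S^+_{\mathfrak{s}})$ (and by complexification and tensoring with $\mathrm{End}(E)$, a map on bundle-valued self-dual forms). Put $W^\pm_{\mathfrak{s},E}=S^\pm_{\mathfrak{s}}\otimes E$. For a smooth unitary connection $\hat A$ on $E$ let $D_{\hat A}=\gamma\circ(\nabla_B\otimes\nabla_{\hat A}):\Gamma(X;W^+_{\mathfrak{s},E})\to\Gamma(X;W^-_{\mathfrak{s},E})$, let $F_{\hat A}$ be the curvature of $\hat A$ and $F^+_{\hat A}$ its self-dual part. Quadratic map. Let $P$ and $Q$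 be the orthogonal projections of $\mathfrak{gl}(\mathbb{C}^2\otimes\mathbb{C}^n)=\mathfrak{gl}(\mathbb{C}^2)\otimes\mathfrak{gl}(\mathbb{C}^n)$ onto $\mathfrak{sl}(\mathbb{C}^2)\otimes\mathfrak{sl}(\mathbb{C}^n)$ and $\mathfrak{sl}(\mathbb{C}^2)\otimes\mathbb{C}\,\mathrm{id}$ respectively. For $\tau\in[0,1]$ and $\Psi\in\mathbb{C}^2\otimes\mathbb{C}^n$ let $\mu_{0,\tau}(\Psi)=P(\Psi\Psi^* )+\tau\,Q(\Psi\Psi^* )$, where $\Psi\Psi^*$ is the endomorphism $\Xi\mapsto(\Psi,\Xi)\Psi$. By equivariance this gives a fibrewise quadratic bundle map $\mu_{0,\tau}:W^+_{\mathfrak{s},E}\to\mathfrak{su}(S^+_{\mathfrak{s}})\otimes_{\mathbb{R}}\mathfrak{u}(E)$, where $\mathfrak{u}(E)$ is the bundle of skew-adjoint endomorphisms of $E$. Monopole equations with parameter $\tau\in[0,1]$ and perturbation $\eta\in\Omega^2_+(X;i\mathbb{R})$, for a pair $(\Psi,\hat A)$ of a smooth section $\Psi$ of $W^+_{\mathfrak{s},E}$ and a smooth unitary connection $\hat A$ on $E$: $$D_{\hat A}\Psi=0,\qquad \gamma(F^+_{\hat A})-\mu_{0,\tau}(\Psi)=\gamma(\eta)\,\mathrm{id}_E .$$ The moduli space $M_{\mathfrak{s},E}(\tau,\eta)$ is the set of solutions $(\Psi,\hat A)$ modulo the gauge group of unitary automorphisms of $E$. *)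

theory Defs
  imports "HOL-Analysis.Analysis"
begin

section \<open>Smooth functions on open subsets of Euclidean space\<close>

definition pd :: "'m \<Rightarrow> (real^'m \<Rightarrow> 'b::real_normed_vector) \<Rightarrow> real^'m \<Rightarrow> 'b" where
  "pd k f x = frechet_derivative f (at x) (axis k 1)"

primrec Ck_on :: "nat \<Rightarrow> (real^'m) set \<Rightarrow> (real^'m \<Rightarrow> 'b::real_normed_vector) \<Rightarrow> bool" where
  "Ck_on 0 S f \<longleftrightarrow> continuous_on S f"
| "Ck_on (Suc r) S f \<longleftrightarrow> f differentiable_on S \<and> (\<forall>k. Ck_on r S (pd k f))"

text \<open>Only used for open \<open>S\<close>.\<close>

definition smooth_on :: "(real^'m) set \<Rightarrow> (real^'m \<Rightarrow> 'b::real_normed_vector) \<Rightarrow> bool" where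
  "smooth_on S f \<longleftrightarrow> (\<forall>r. Ck_on r S f)"


section \<open>Closed oriented Riemannian four-manifolds\<close>

text \<open>
  A manifold is a topological space with an atlas indexed by the type \<open>'i\<close>. Indexing by a whole
  type is no restriction: charts may be repeated, and domains may be empty. A tensor
  field, or a section of a bundle, is given by its components in each chart \<open>i\<close>, as a
  function of the point \<open>p\<close> in the chart domain. \<open>mmetric M i p $ k $ l\<close> is the component
  of the Riemannian metric on the \<open>k\<close>-th and \<open>l\<close>-th coordinate vectors of chart \<open>i\<close>.
\<close>

record ('a, 'i) riem4 =
  mtop :: "'a topology"
  mdom :: "'i \<Rightarrow> 'a set"
  mchart :: "'i \<Rightarrow> 'a \<Rightarrow> real^4"
  mmetric :: "'i \<Rightarrow> 'a \<Rightarrow> real^4^4"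

abbreviation chart_img :: "('a, 'i) riem4 \<Rightarrow> 'i \<Rightarrow> (real^4) set" where
  "chart_img M i \<equiv> mchart M i ` mdom M i"

definition in_coords :: "('a, 'i) riem4 \<Rightarrow> 'i \<Rightarrow> ('a \<Rightarrow> 'b) \<Rightarrow> real^4 \<Rightarrow> 'b" where
  "in_coords M i f = (\<lambda>x. f (inv_into (mdom M i) (mchart M i) x))"

definition smooth_in :: "('a, 'i) riem4 \<Rightarrow> 'i \<Rightarrow> 'a set \<Rightarrow> ('a \<Rightarrow> 'b::real_normed_vector) \<Rightarrow> bool" where
  "smooth_in M i W f \<longleftrightarrow> smooth_on (mchart M i ` W) (in_coords M i f)"

definition partial :: "('a, 'i) riem4 \<Rightarrow> 'i \<Rightarrow> 4 \<Rightarrow> ('a \<Rightarrow> 'b::real_normed_vector) \<Rightarrow> 'a \<Rightarrow> 'b" where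
  "partial M i k f p = pd k (in_coords M i f) (mchart M i p)"

text \<open>\<open>jac M i j p $ l $ k\<close> is the derivative of the \<open>l\<close>-th coordinate of chart \<open>j\<close>
  with respect to the \<open>k\<close>-th coordinate of chart \<open>i\<close>.\<close>

definition jac :: "('a, 'i) riem4 \<Rightarrow> 'i \<Rightarrow> 'i \<Rightarrow> 'a \<Rightarrow> real^4^4" where
  "jac M i j p = (\<chi> l k. partial M i k (mchart M j) p $ l)"

definition closed_oriented_riemannian_4manifold :: "('a, 'i) riem4 \<Rightarrow> bool" where
  "closed_oriented_riemannian_4manifold M \<longleftrightarrow>
     Hausdorff_space (mtop M) \<and> second_countable (mtop M) \<and> compact_space (mtop M) \<and>
     (\<Union>i. mdom M i) = topspace (mtop M) \<and>
     (\<forall>i. openin (mtop M) (mdom M i) \<and> open (chart_img M i) \<and>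
        homeomorphic_map (subtopology (mtop M) (mdom M i)) (top_of_set (chart_img M i)) (mchart M i)) \<and>
     (\<forall>i j. smooth_in M i (mdom M i \<inter> mdom M j) (mchart M j)) \<and>
     (\<forall>i j. \<forall>p \<in> mdom M i \<inter> mdom M j. det (jac M i j p) > 0) \<and>
     (\<forall>i. smooth_in M i (mdom M i) (mmetric M i)) \<and>
     (\<forall>i. \<forall>p \<in> mdom M i. transpose (mmetric M i p) = mmetric M i p \<and>
        (\<forall>v. v \<noteq> 0 \<longrightarrow> v \<bullet> (mmetric M i p *v v) > 0)) \<and>
     (\<forall>i j. \<forall>p \<in> mdom M i \<inter> mdom M j.
        mmetric M i p = transpose (jac M i j p) ** mmetric M j p ** jac M i j p)"

text \<open>The Christoffel symbol with upper index \<open>l\<close> and lower indices \<open>k\<close>, \<open>m\<close>.\<close>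

definition christoffel :: "('a, 'i) riem4 \<Rightarrow> 'i \<Rightarrow> 'a \<Rightarrow> 4 \<Rightarrow> 4 \<Rightarrow> 4 \<Rightarrow> real" where
  "christoffel M i p l k m = (\<Sum>r\<in>UNIV. 1/2 * matrix_inv (mmetric M i p) $ l $ r *
     (partial M i k (\<lambda>q. mmetric M i q $ r $ m) p + partial M i m (\<lambda>q. mmetric M i q $ r $ k) p
      - partial M i r (\<lambda>q. mmetric M i q $ k $ m) p))"


section \<open>Differential two-forms\<close>

text \<open>
  A two-form with values in a real vector space has in chart \<open>i\<close> the components \<open>w i p $ k $ l\<close>
  on the \<open>k\<close>-th and \<open>l\<close>-th coordinate vectors. Components are set to \<open>0\<close> outside
  the chart domain, so that equality of forms is equality of families.
\<close>

definition two_forms :: "('a, 'i) riem4 \<Rightarrow> ('i \<Rightarrow> 'a \<Rightarrow> 'b::real_normed_vector^4^4) set" where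
  "two_forms M = {w.
     (\<forall>i. smooth_in M i (mdom M i) (w i)) \<and>
     (\<forall>i. \<forall>p. p \<notin> mdom M i \<longrightarrow> w i p = 0) \<and>
     (\<forall>i. \<forall>p \<in> mdom M i. \<forall>k l. w i p $ k $ l = - (w i p $ l $ k)) \<and>
     (\<forall>i j. \<forall>p \<in> mdom M i \<inter> mdom M j. \<forall>k l. w i p $ k $ l =
        (\<Sum>r\<in>UNIV. \<Sum>s\<in>UNIV. (jac M i j p $ r $ k * jac M i j p $ s $ l) *\<^sub>R w j p $ r $ s))}"

definition eps4 :: "4 \<Rightarrow> 4 \<Rightarrow> 4 \<Rightarrow> 4 \<Rightarrow> real" where
  "eps4 k l m n = det (vector [axis k 1, axis l 1, axis m 1, axis n 1] :: real^4^4)"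

text \<open>The Hodge star on two-forms, for a metric \<open>g\<close> in positively oriented coordinates.\<close>

definition hodge2 :: "real^4^4 \<Rightarrow> 'b::real_vector^4^4 \<Rightarrow> 'b^4^4" where
  "hodge2 g w = (\<chi> k l. \<Sum>m\<in>UNIV. \<Sum>n\<in>UNIV. \<Sum>r\<in>UNIV. \<Sum>s\<in>UNIV.
     (1/2 * sqrt (det g) * eps4 m n k l * matrix_inv g $ m $ r * matrix_inv g $ n $ s) *\<^sub>R w $ r $ s)"

definition sd_part :: "real^4^4 \<Rightarrow> 'b::real_vector^4^4 \<Rightarrow> 'b^4^4" where
  "sd_part g w = (1/2) *\<^sub>R (w + hodge2 g w)"

definition imaginary_sd_forms :: "('a, 'i) riem4 \<Rightarrow> ('i \<Rightarrow> 'a \<Rightarrow> complex^4^4) set" where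
  "imaginary_sd_forms M = {w \<in> two_forms M.
     \<forall>i. \<forall>p \<in> mdom M i. hodge2 (mmetric M i p) (w i p) = w i p \<and> (\<forall>k l. Re (w i p $ k $ l) = 0)}"

definition closed_two_forms :: "('a, 'i) riem4 \<Rightarrow> ('i \<Rightarrow> 'a \<Rightarrow> real^4^4) set" where
  "closed_two_forms M = {w \<in> two_forms M. \<forall>i. \<forall>p \<in> mdom M i. \<forall>k l m.
     partial M i k (\<lambda>q. w i q $ l $ m) p + partial M i l (\<lambda>q. w i q $ m $ k) p
       + partial M i m (\<lambda>q. w i q $ k $ l) p = 0}"


section \<open>Integration and \<open>b\<^sub>2\<^sup>+\<close>\<close>

definition partition_of_unity :: "('a, 'i) riem4 \<Rightarrow> ('i \<Rightarrow> 'a \<Rightarrow> real) \<Rightarrow> bool" where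
  "partition_of_unity M rho \<longleftrightarrow>
     (\<forall>i j. smooth_in M j (mdom M j) (rho i)) \<and>
     (\<forall>i. \<forall>p \<in> topspace (mtop M). rho i p \<ge> 0) \<and>
     (\<forall>i. mtop M closure_of {p \<in> topspace (mtop M). rho i p \<noteq> 0} \<subseteq> mdom M i) \<and>
     finite {i. \<exists>p \<in> topspace (mtop M). rho i p \<noteq> 0} \<and>
     (\<forall>p \<in> topspace (mtop M). (\<Sum>i | rho i p \<noteq> 0. rho i p) = 1)"

text \<open>A four-form is given by its coefficient with respect to the coordinate volume form of
  each chart. As usual, the integral does not depend on the partition of unity.\<close>

definition integral4 :: "('a, 'i) riem4 \<Rightarrow> ('i \<Rightarrow> 'a \<Rightarrow> real) \<Rightarrow> real" where
  "integral4 M f = (let rho = (SOME rho. partition_of_unity M rho) in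
     \<Sum>i | \<exists>p \<in> topspace (mtop M). rho i p \<noteq> 0.
       integral (chart_img M i) (in_coords M i (\<lambda>p. rho i p * f i p)))"

definition wedge22 :: "real^4^4 \<Rightarrow> real^4^4 \<Rightarrow> real" where
  "wedge22 v w = (\<Sum>k\<in>UNIV. \<Sum>l\<in>UNIV. \<Sum>m\<in>UNIV. \<Sum>n\<in>UNIV.
     1/4 * eps4 k l m n * v $ k $ l * w $ m $ n)"

text \<open>
  \<open>b\<^sub>2\<^sup>+\<close> is the maximal dimension of a subspace of \<open>H\<^sup>2\<close> (de Rham) on which the intersection
  form is positive definite. A subspace of dimension \<open>k\<close> is given by closed forms
  \<open>a 0, \<dots>, a (k - 1)\<close> representing a basis; as the intersection form descends to cohomology,
  positivity on all non-trivial linear combinations already implies that the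
  classes are linearly independent.
\<close>

definition b2plus :: "('a, 'i) riem4 \<Rightarrow> enat" where
  "b2plus M = (SUP k \<in> {k :: nat. \<exists>a :: nat \<Rightarrow> 'i \<Rightarrow> 'a \<Rightarrow> real^4^4.
     (\<forall>r<k. a r \<in> closed_two_forms M) \<and>
     (\<forall>c :: nat \<Rightarrow> real. (\<exists>r<k. c r \<noteq> 0) \<longrightarrow>
        integral4 M (\<lambda>i p. wedge22 (\<Sum>r<k. c r *\<^sub>R a r i p) (\<Sum>r<k. c r *\<^sub>R a r i p)) > 0)}. enat k)"


section \<open>Hermitian bundles and unitary connections\<close>

definition cadj :: "complex^'n^'m \<Rightarrow> complex^'m^'n" where
  "cadj A = (\<chi> i j. cnj (A $ j $ i))"

text \<open>
  A Hermitian bundle is given by its \<open>U(n)\<close>-valued transition functions: \<open>h i j p\<close> sends the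
  components of a vector over \<open>p\<close> in the unitary frame over \<open>mdom M j\<close> to its components in the frame
  over \<open>mdom M i\<close>. Using the domains of the atlas as trivialising cover is no
  restriction, as the atlas is arbitrary and can be refined.
\<close>

definition hermitian_bundle ::
  "('a, 'i) riem4 \<Rightarrow> ('i \<Rightarrow> 'i \<Rightarrow> 'a \<Rightarrow> complex^'n^'n) \<Rightarrow> bool" where
  "hermitian_bundle M h \<longleftrightarrow>
     (\<forall>i j. smooth_in M i (mdom M i \<inter> mdom M j) (h i j)) \<and>
     (\<forall>i j. \<forall>p \<in> mdom M i \<inter> mdom M j. cadj (h i j p) ** h i j p = mat 1) \<and>
     (\<forall>i. \<forall>p \<in> mdom M i. h i i p = mat 1) \<and>
     (\<forall>i j k. \<forall>p \<in> mdom M i \<inter> mdom M j \<inter> mdom M k. h i j p ** h j k p = h i k p)"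

text \<open>\<open>A i p $ k\<close> is the value of the connection form on the \<open>k\<close>-th coordinate vector, in the frame
  over \<open>mdom M i\<close>; the covariant derivative is \<open>d + A\<close>.\<close>

definition unitary_connection ::
  "('a, 'i) riem4 \<Rightarrow> ('i \<Rightarrow> 'i \<Rightarrow> 'a \<Rightarrow> complex^'n^'n) \<Rightarrow> ('i \<Rightarrow> 'a \<Rightarrow> (complex^'n^'n)^4) \<Rightarrow> bool" where
  "unitary_connection M h A \<longleftrightarrow>
     (\<forall>i. smooth_in M i (mdom M i) (A i)) \<and>
     (\<forall>i. \<forall>p. p \<notin> mdom M i \<longrightarrow> A i p = 0) \<and>
     (\<forall>i. \<forall>p \<in> mdom M i. \<forall>k. cadj (A i p $ k) = - (A i p $ k)) \<and>
     (\<forall>i j. \<forall>p \<in> mdom M i \<inter> mdom M j. \<forall>k. A i p $ k =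
        (\<Sum>l\<in>UNIV. jac M i j p $ l $ k *\<^sub>R (h i j p ** A j p $ l ** cadj (h i j p)))
        - partial M i k (h i j) p ** cadj (h i j p))"

definition curvature ::
  "('a, 'i) riem4 \<Rightarrow> ('i \<Rightarrow> 'a \<Rightarrow> (complex^'n^'n)^4) \<Rightarrow> 'i \<Rightarrow> 'a \<Rightarrow> (complex^'n^'n)^4^4" where
  "curvature M A i p = (\<chi> k l.
     partial M i k (\<lambda>q. A i q $ l) p - partial M i l (\<lambda>q. A i q $ k) p
     + A i p $ k ** A i p $ l - A i p $ l ** A i p $ k)"


section \<open>\<open>Spin\<^sup>c\<close> structures\<close>

text \<open>\<open>clifford s i p $ k\<close> is Clifford multiplication by the \<open>k\<close>-th coordinate covector of chart \<open>i\<close>,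
  in the frames of \<open>S\<^sup>+\<close> and \<open>S\<^sup>-\<close> over \<open>mdom M i\<close>.\<close>

record ('a, 'i) spinc =
  splus :: "'i \<Rightarrow> 'i \<Rightarrow> 'a \<Rightarrow> complex^2^2"
  sminus :: "'i \<Rightarrow> 'i \<Rightarrow> 'a \<Rightarrow> complex^2^2"
  clifford :: "'i \<Rightarrow> 'a \<Rightarrow> (complex^2^2)^4"

definition cliff1 :: "(complex^2^2)^4 \<Rightarrow> real^4 \<Rightarrow> complex^2^2" where
  "cliff1 G v = (\<Sum>k\<in>UNIV. v $ k *\<^sub>R G $ k)"

text \<open>
  The action on \<open>S\<^sup>+\<close> of the product of the \<open>k\<close>-th and \<open>l\<close>-th coordinate covectors in the
  exterior algebra: half of the commutator of their Clifford actions on \<open>S\<^sup>+ \<oplus> S\<^sup>-\<close>, where a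
  covector \<open>v\<close> acts by \<open>\<gamma>(v)\<close> on \<open>S\<^sup>+\<close> and by \<open>- \<gamma>(v)\<^sup>*\<close> on \<open>S\<^sup>-\<close>.
\<close>

definition cliff_wedge :: "(complex^2^2)^4 \<Rightarrow> 4 \<Rightarrow> 4 \<Rightarrow> complex^2^2" where
  "cliff_wedge G k l = - (1/2) *\<^sub>R (cadj (G $ k) ** G $ l - cadj (G $ l) ** G $ k)"

definition cliff2 :: "(complex^2^2)^4 \<Rightarrow> complex^4^4 \<Rightarrow> complex^2^2" where
  "cliff2 G w = (\<Sum>k\<in>UNIV. \<Sum>l\<in>UNIV. (1/2) *\<^sub>R (mat (w $ k $ l) ** cliff_wedge G k l))"

definition su2 :: "(complex^2^2) set" where
  "su2 = {A. cadj A = - A \<and> trace A = 0}"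

text \<open>
  The determinant line bundles of \<open>S\<^sup>+\<close> and \<open>S\<^sup>-\<close> are identified by having equal transition functions;
  the condition \<open>det (\<gamma>(v)) = |v|\<^sup>2\<close> says that this identification is the one
  induced by Clifford multiplication.
\<close>

definition spinc_structure :: "('a, 'i) riem4 \<Rightarrow> ('a, 'i) spinc \<Rightarrow> bool" where
  "spinc_structure M s \<longleftrightarrow>
     hermitian_bundle M (splus s) \<and> hermitian_bundle M (sminus s) \<and>
     (\<forall>i j. \<forall>p \<in> mdom M i \<inter> mdom M j. det (splus s i j p) = det (sminus s i j p)) \<and>
     (\<forall>i. smooth_in M i (mdom M i) (clifford s i)) \<and>
     (\<forall>i j. \<forall>p \<in> mdom M i \<inter> mdom M j. \<forall>l.
        (\<Sum>k\<in>UNIV. jac M i j p $ l $ k *\<^sub>R clifford s i p $ k) =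
        sminus s i j p ** clifford s j p $ l ** cadj (splus s i j p)) \<and>
     (\<forall>i. \<forall>p \<in> mdom M i. \<forall>v. let G = cliff1 (clifford s i p) v;
          nrm = complex_of_real (v \<bullet> (matrix_inv (mmetric M i p) *v v))
        in cadj G ** G = mat nrm \<and> det G = nrm) \<and>
     (\<forall>i. \<forall>p \<in> mdom M i.
        bij_betw (\<lambda>w :: real^4^4. cliff2 (clifford s i p) (\<chi> k l. complex_of_real (w $ k $ l)))
          {w. transpose w = - w \<and> hodge2 (mmetric M i p) w = w} su2)"

text \<open>A \<open>Spin\<^sup>c\<close> connection is a pair of unitary connections on \<open>S\<^sup>+\<close> and \<open>S\<^sup>-\<close> for which Clifford
  multiplication is parallel with respect to the Levi-Civita connection.\<close>

type_synonym ('a, 'i) spinc_conn =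
  "('i \<Rightarrow> 'a \<Rightarrow> (complex^2^2)^4) \<times> ('i \<Rightarrow> 'a \<Rightarrow> (complex^2^2)^4)"

definition spinc_connection ::
  "('a, 'i) riem4 \<Rightarrow> ('a, 'i) spinc \<Rightarrow> ('a, 'i) spinc_conn \<Rightarrow> bool" where
  "spinc_connection M s B \<longleftrightarrow>
     unitary_connection M (splus s) (fst B) \<and> unitary_connection M (sminus s) (snd B) \<and>
     (\<forall>i. \<forall>p \<in> mdom M i. \<forall>k l.
        partial M i k (\<lambda>q. clifford s i q $ l) p
          + snd B i p $ k ** clifford s i p $ l - clifford s i p $ l ** fst B i p $ k
        = - (\<Sum>m\<in>UNIV. christoffel M i p l k m *\<^sub>R clifford s i p $ m))"


section \<open>The quadratic map\<close>

definition kron :: "complex^'m^'m \<Rightarrow> complex^'n^'n \<Rightarrow> complex^('m \<times> 'n)^('m \<times> 'n)" where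
  "kron A B = (\<chi> r c. A $ fst r $ fst c * B $ snd r $ snd c)"

definition orth_proj :: "'v::real_inner set \<Rightarrow> 'v \<Rightarrow> 'v" where
  "orth_proj V x = (THE y. y \<in> V \<and> (\<forall>z \<in> V. (x - y) \<bullet> z = 0))"

definition sl_sl :: "(complex^(2 \<times> 'n::finite)^(2 \<times> 'n)) set" where
  "sl_sl = span {kron A B | A B. trace A = 0 \<and> trace B = 0}"

definition sl_id :: "(complex^(2 \<times> 'n::finite)^(2 \<times> 'n)) set" where
  "sl_id = {kron A (mat 1) | A. trace A = 0}"

text \<open>Elements of \<open>\<complex>\<^sup>2 \<otimes> \<complex>\<^sup>n\<close> are written as \<open>2 \<times> n\<close> matrices.\<close>

definition psi_psi_star :: "complex^'n^2 \<Rightarrow> complex^(2 \<times> 'n)^(2 \<times> 'n)" where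
  "psi_psi_star Psi = (\<chi> r c. Psi $ fst r $ snd r * cnj (Psi $ fst c $ snd c))"

definition mu :: "real \<Rightarrow> complex^'n^2 \<Rightarrow> complex^(2 \<times> 'n)^(2 \<times> 'n)" where
  "mu \<tau> Psi = orth_proj sl_sl (psi_psi_star Psi) + \<tau> *\<^sub>R orth_proj sl_id (psi_psi_star Psi)"


section \<open>The monopole equations and the moduli space\<close>

definition twisted_spinors ::
  "('a, 'i) riem4 \<Rightarrow> ('a, 'i) spinc \<Rightarrow> ('i \<Rightarrow> 'i \<Rightarrow> 'a \<Rightarrow> complex^'n^'n) \<Rightarrow> ('i \<Rightarrow> 'a \<Rightarrow> complex^'n^2) set" where
  "twisted_spinors M s E = {Psi.
     (\<forall>i. smooth_in M i (mdom M i) (Psi i)) \<and>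
     (\<forall>i. \<forall>p. p \<notin> mdom M i \<longrightarrow> Psi i p = 0) \<and>
     (\<forall>i j. \<forall>p \<in> mdom M i \<inter> mdom M j.
        Psi i p = splus s i j p ** Psi j p ** transpose (E i j p))}"

definition dirac ::
  "('a, 'i) riem4 \<Rightarrow> ('a, 'i) spinc \<Rightarrow> ('a, 'i) spinc_conn \<Rightarrow> ('i \<Rightarrow> 'a \<Rightarrow> (complex^'n^'n)^4)
   \<Rightarrow> ('i \<Rightarrow> 'a \<Rightarrow> complex^'n^2) \<Rightarrow> 'i \<Rightarrow> 'a \<Rightarrow> complex^'n^2" where
  "dirac M s B A Psi i p = (\<Sum>k\<in>UNIV. clifford s i p $ k **
     (partial M i k (Psi i) p + fst B i p $ k ** Psi i p + Psi i p ** transpose (A i p $ k)))"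

definition cliff2_End :: "(complex^2^2)^4 \<Rightarrow> (complex^'n^'n)^4^4 \<Rightarrow> complex^(2 \<times> 'n)^(2 \<times> 'n)" where
  "cliff2_End G F = (\<Sum>k\<in>UNIV. \<Sum>l\<in>UNIV. (1/2) *\<^sub>R kron (cliff_wedge G k l) (F $ k $ l))"

definition monopoles ::
  "('a, 'i) riem4 \<Rightarrow> ('a, 'i) spinc \<Rightarrow> ('a, 'i) spinc_conn \<Rightarrow> ('i \<Rightarrow> 'i \<Rightarrow> 'a \<Rightarrow> complex^'n^'n)
   \<Rightarrow> real \<Rightarrow> ('i \<Rightarrow> 'a \<Rightarrow> complex^4^4)
   \<Rightarrow> (('i \<Rightarrow> 'a \<Rightarrow> complex^'n^2) \<times> ('i \<Rightarrow> 'a \<Rightarrow> (complex^'n^'n)^4)) set" where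
  "monopoles M s B E \<tau> \<eta> = {(Psi, A). Psi \<in> twisted_spinors M s E \<and> unitary_connection M E A \<and>
     (\<forall>i. \<forall>p \<in> mdom M i.
        dirac M s B A Psi i p = 0 \<and>
        cliff2_End (clifford s i p) (sd_part (mmetric M i p) (curvature M A i p)) - mu \<tau> (Psi i p)
          = kron (cliff2 (clifford s i p) (\<eta> i p)) (mat 1))}"

definition gauge_group ::
  "('a, 'i) riem4 \<Rightarrow> ('i \<Rightarrow> 'i \<Rightarrow> 'a \<Rightarrow> complex^'n^'n) \<Rightarrow> ('i \<Rightarrow> 'a \<Rightarrow> complex^'n^'n) set" where
  "gauge_group M E = {u.
     (\<forall>i. smooth_in M i (mdom M i) (u i)) \<and>
     (\<forall>i. \<forall>p \<in> mdom M i. cadj (u i p) ** u i p = mat 1) \<and>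
     (\<forall>i j. \<forall>p \<in> mdom M i \<inter> mdom M j. u i p = E i j p ** u j p ** cadj (E i j p))}"

definition gauge_rel ::
  "('a, 'i) riem4 \<Rightarrow> ('i \<Rightarrow> 'i \<Rightarrow> 'a \<Rightarrow> complex^'n^'n)
   \<Rightarrow> ((('i \<Rightarrow> 'a \<Rightarrow> complex^'n^2) \<times> ('i \<Rightarrow> 'a \<Rightarrow> (complex^'n^'n)^4)) \<times>
       (('i \<Rightarrow> 'a \<Rightarrow> complex^'n^2) \<times> ('i \<Rightarrow> 'a \<Rightarrow> (complex^'n^'n)^4))) set" where
  "gauge_rel M E = {((Psi, A), (Psi', A')). \<exists>u \<in> gauge_group M E. \<forall>i. \<forall>p \<in> mdom M i.
     Psi' i p = Psi i p ** transpose (u i p) \<and>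
     (\<forall>k. A' i p $ k = u i p ** A i p $ k ** cadj (u i p) - partial M i k (u i) p ** cadj (u i p))}"

definition moduli_space ::
  "('a, 'i) riem4 \<Rightarrow> ('a, 'i) spinc \<Rightarrow> ('a, 'i) spinc_conn \<Rightarrow> ('i \<Rightarrow> 'i \<Rightarrow> 'a \<Rightarrow> complex^'n^'n)
   \<Rightarrow> real \<Rightarrow> ('i \<Rightarrow> 'a \<Rightarrow> complex^4^4)
   \<Rightarrow> (('i \<Rightarrow> 'a \<Rightarrow> complex^'n^2) \<times> ('i \<Rightarrow> 'a \<Rightarrow> (complex^'n^'n)^4)) set set" where
  "moduli_space M s B E \<tau> \<eta> =
     monopoles M s B E \<tau> \<eta> // (gauge_rel M E \<inter> monopoles M s B E \<tau> \<eta> \<times> monopoles M s B E \<tau> \<eta>)"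


section \<open>Genericity\<close>

text \<open>The \<open>C\<^sup>\<infinity>\<close> topology: uniform convergence of all iterated partial derivatives of the
  components on compact subsets of the charts.\<close>

definition Cinf_topology ::
  "('a, 'i) riem4 \<Rightarrow> ('i \<Rightarrow> 'a \<Rightarrow> 'b::real_normed_vector) set \<Rightarrow> ('i \<Rightarrow> 'a \<Rightarrow> 'b) topology" where
  "Cinf_topology M \<Omega> = topology_generated_by
     {{w \<in> \<Omega>. \<forall>x \<in> K. norm (foldr pd ks (\<lambda>y. in_coords M i (w i) y - in_coords M i (w0 i) y) x) < e}
       | w0 i K ks e. w0 \<in> \<Omega> \<and> compact K \<and> K \<subseteq> chart_img M i \<and> e > (0::real)}"

definition residual_in :: "'a topology \<Rightarrow> 'a set \<Rightarrow> bool" where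
  "residual_in T S \<longleftrightarrow> S \<subseteq> topspace T \<and>
     (\<exists>\<U>. countable \<U> \<and> (\<forall>U \<in> \<U>. openin T U \<and> T closure_of U = topspace T) \<and>
       topspace T \<inter> \<Inter>\<U> \<subseteq> S)"

end

theory Submission
  imports Defs
begin

text \<open>
  For \<open>\<tau> = 0\<close> the quadratic term is trace-free in \<open>E\<close>, so tracing the curvature equation over \<open>E\<close>
  gives \<open>\<eta> = (1 / n) (tr F)\<^sup>+\<close>. Hence two perturbations that admit solutions differ by \<open>\<i> (d b)\<^sup>+\<close> for a
  global real one-form \<open>b\<close>. These differences are not dense, and no Hodge theory is needed to see it: since
  \<open>b\<^sub>2\<^sup>+ \<noteq> 0\<close> there is a closed \<open>w\<close> with \<open>q = \<integral> w \<and> w > 0\<close>, and by Stokes and the negativity of the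
  pairing on anti-self-dual forms, \<open>q = \<integral> (w - d b) \<and> (w - d b)\<close> is at most a constant times the squared
  supremum of \<open>(w - d b)\<^sup>+\<close>, for every \<open>b\<close>. So \<open>\<i> w\<^sup>+\<close> stays away from all \<open>\<i> (d b)\<^sup>+\<close>. If \<open>Z\<close> is the set
  of perturbations admitting solutions and \<open>\<eta> \<in> closure Z\<close>, then \<open>\<eta> + t \<i> w\<^sup>+ \<notin> closure Z\<close> for all
  \<open>t > 0\<close>, whence the complement of \<open>closure Z\<close> is open and dense.
\<close>

text \<open>Only differences of traces are usable: the trace of one connection lives on the
  determinant line bundle of \<open>E\<close> and is in general no global form, whereas in a
  difference the contributions of the transition functions cancel. Whether \<open>Z\<close> is
  closed is left open, so limits of \<open>Z\<close> have to be excluded as well as its points. This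
  calls for a quantitative bound and not just for the fact that \<open>w\<close> is not exact. If x
  and y in \<open>Z\<close> approximate \<open>\<eta>\<close> and
  \<open>\<eta> + t \<i> w\<^sup>+\<close>, then \<open>(y - x) / t\<close> is again of the form
  \<open>\<i> (d b)\<^sup>+\<close>, and the accuracy is chosen after \<open>t\<close>, so the
  division by \<open>t\<close> does no harm. Only uniform closeness of values enters; derivatives do
  not. The constant is a coordinate one: if d bounds the components of
  \<open>(w - d b)\<^sup>+\<close> and W > 0 bounds the sum of the coordinate integrals of the
  partition functions, then q is at most 6 d^2 W. Choosing d with 12 d^2 W = q gives the
  contradiction.\<close>

section \<open>Calculus of partial derivatives\<close>

lemma pd_eqI:
  assumes "(f has_derivative f') (at x)"
  shows "pd k f x = f' (axis k 1)"
  using frechet_derivative_at[OF assms] by (simp add: pd_def)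

lemma has_derivative_pd:
  fixes f :: "real^'m \<Rightarrow> 'b::real_normed_vector"
  assumes "f differentiable (at x)"
  shows "(f has_derivative (\<lambda>h. \<Sum>k\<in>UNIV. h $ k *\<^sub>R pd k f x)) (at x)"
proof -
  let ?F = "frechet_derivative f (at x)"
  have d: "(f has_derivative ?F) (at x)" using assms by (simp add: frechet_derivative_works)
  then have lin: "linear ?F" by (rule has_derivative_linear)
  have "?F h = (\<Sum>k\<in>UNIV. h $ k *\<^sub>R pd k f x)" for h
  proof -
    have "?F h = ?F (\<Sum>k\<in>UNIV. (h $ k) *\<^sub>R axis k 1)"
      using basis_expansion[of h] by (simp add: scalar_mult_eq_scaleR)
    also have "\<dots> = (\<Sum>k\<in>UNIV. h $ k *\<^sub>R pd k f x)"
      by (simp add: linear_sum[OF lin] linear_scale[OF lin] pd_def)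
    finally show ?thesis .
  qed
  then have "?F = (\<lambda>h. \<Sum>k\<in>UNIV. h $ k *\<^sub>R pd k f x)" by blast
  with d show ?thesis by simp
qed

lemma has_derivative_open_cong:
  assumes "open S" "x \<in> S" "\<And>y. y \<in> S \<Longrightarrow> f y = g y"
  shows "(f has_derivative D) (at x) = (g has_derivative D) (at x)"
  using has_derivative_transform_within_open[OF _ assms(1,2)] assms(3) by metis

text \<open>No differentiability is assumed: \<open>frechet_derivative\<close> is a choice among the
  derivatives at the point, and functions that agree near the point offer the same derivatives to
  choose from.\<close>

lemma pd_cong:
  assumes "open S" "x \<in> S" "\<And>y. y \<in> S \<Longrightarrow> f y = g y"
  shows "pd k f x = pd k g x"
  using has_derivative_open_cong[OF assms] by (simp add: pd_def frechet_derivative_def)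

lemma differentiable_open_cong:
  assumes "open S" "x \<in> S" "\<And>y. y \<in> S \<Longrightarrow> f y = g y"
  shows "(f differentiable (at x)) = (g differentiable (at x))"
  using has_derivative_open_cong[OF assms] by (simp add: differentiable_def)

section \<open>Functions of finite differentiability class\<close>

lemma Ck_on_Suc_open:
  assumes "open S"
  shows "Ck_on (Suc r) S f \<longleftrightarrow> (\<forall>x\<in>S. f differentiable (at x)) \<and> (\<forall>k. Ck_on r S (pd k f))"
  using differentiable_on_eq_differentiable_at[OF assms] by auto

lemma Ck_on_SucD: "Ck_on (Suc r) S f \<Longrightarrow> Ck_on r S f"
proof (induction r arbitrary: f)
  case 0 then show ?case by (simp add: differentiable_imp_continuous_on)
next
  case (Suc r) then show ?case by simp
qed

lemma Ck_on_mono: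
  assumes "open T" "T \<subseteq> S" "Ck_on r S f"
  shows "Ck_on r T f"
  using assms(3)
proof (induction r arbitrary: f)
  case 0 then show ?case using assms(2) by (auto intro: continuous_on_subset)
next
  case (Suc r) then show ?case using assms(2) by (auto intro: differentiable_on_subset)
qed

lemma Ck_on_cong:
  assumes "open S" "\<And>x. x \<in> S \<Longrightarrow> f x = g x"
  shows "Ck_on r S f = Ck_on r S g"
  using assms(2)
proof (induction r arbitrary: f g)
  case 0 then show ?case by simp
next
  case (Suc r)
  have "\<forall>x\<in>S. (f differentiable (at x)) = (g differentiable (at x))"
    using differentiable_open_cong[OF assms(1)] Suc.prems by blast
  moreover have "Ck_on r S (pd k f) = Ck_on r S (pd k g)" for k
    by (rule Suc.IH) (rule pd_cong[OF assms(1)], auto simp: Suc.prems)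
  ultimately show ?case by (auto simp: Ck_on_Suc_open[OF assms(1)] simp del: Ck_on.simps)
qed

text \<open>Serves functions given by different formulas on overlapping open sets, such as bumps and
  components extended by zero.\<close>

lemma Ck_on_local:
  assumes "open S" "\<And>x. x \<in> S \<Longrightarrow> \<exists>U. open U \<and> x \<in> U \<and> Ck_on r U f"
  shows "Ck_on r S f"
  using assms(2)
proof (induction r arbitrary: f)
  case 0
  have "continuous (at x) f" if "x \<in> S" for x
    using 0[OF that] by (auto simp: continuous_on_eq_continuous_at)
  then show ?case using assms(1) by (simp add: continuous_on_eq_continuous_at)
next
  case (Suc r)
  have "f differentiable (at x)" if "x \<in> S" for x
    using Suc.prems[OF that] by (metis Ck_on_Suc_open)
  moreover have "Ck_on r S (pd k f)" for k
  proof (rule Suc.IH)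
    fix x assume "x \<in> S"
    then show "\<exists>U. open U \<and> x \<in> U \<and> Ck_on r U (pd k f)"
      using Suc.prems by (metis Ck_on_Suc_open)
  qed
  ultimately show ?case by (simp add: Ck_on_Suc_open[OF assms(1)] del: Ck_on.simps)
qed

lemma pd_const: "pd k (\<lambda>x. c) x = 0"
  by (simp add: pd_eqI[OF has_derivative_const])

lemma Ck_on_const: "Ck_on r S (\<lambda>x::real^'m. c)"
proof (induction r arbitrary: c)
  case (Suc r)
  have "pd k (\<lambda>x. c) = (\<lambda>x. 0)" for k :: 'm using pd_const[of k c] by blast
  with Suc[of 0] show ?case by (simp add: differentiable_on_def)
qed simp

lemma pd_bounded_linear:
  assumes "bounded_linear L" "f differentiable (at x)"
  shows "pd k (\<lambda>x. L (f x)) x = L (pd k f x)"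
proof -
  have "((\<lambda>x. L (f x)) has_derivative (\<lambda>h. L (frechet_derivative f (at x) h))) (at x)"
    using bounded_linear.has_derivative[OF assms(1)] assms(2) by (simp add: frechet_derivative_works)
  from pd_eqI[OF this] show ?thesis by (simp add: pd_def)
qed

lemma pd_add:
  assumes "f differentiable (at x)" "g differentiable (at x)"
  shows "pd k (\<lambda>x. f x + g x) x = pd k f x + pd k g x"
  using pd_eqI[OF has_derivative_add] assms unfolding frechet_derivative_works pd_def by blast

lemma pd_diff:
  assumes "f differentiable (at x)" "g differentiable (at x)"
  shows "pd k (\<lambda>x. f x - g x) x = pd k f x - pd k g x"
  using pd_eqI[OF has_derivative_diff] assms unfolding frechet_derivative_works pd_def by blast

lemma pd_sum:
  assumes "\<And>i. i \<in> I \<Longrightarrow> f i differentiable (at x)"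
  shows "pd k (\<lambda>x. \<Sum>i\<in>I. f i x) x = (\<Sum>i\<in>I. pd k (f i) x)"
proof -
  have "((\<lambda>x. \<Sum>i\<in>I. f i x) has_derivative (\<lambda>h. \<Sum>i\<in>I. frechet_derivative (f i) (at x) h)) (at x)"
    using assms by (intro has_derivative_sum) (simp add: frechet_derivative_works)
  from pd_eqI[OF this] show ?thesis by (simp add: pd_def)
qed

lemma pd_bilinear:
  assumes "bounded_bilinear mul" "f differentiable (at x)" "g differentiable (at x)"
  shows "pd k (\<lambda>x. mul (f x) (g x)) x = mul (f x) (pd k g x) + mul (pd k f x) (g x)"
proof -
  have "((\<lambda>x. mul (f x) (g x)) has_derivative (\<lambda>h. mul (f x) (frechet_derivative g (at x) h)
      + mul (frechet_derivative f (at x) h) (g x))) (at x)"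
    using bounded_bilinear.FDERIV[OF assms(1)] assms(2,3) by (simp add: frechet_derivative_works)
  from pd_eqI[OF this] show ?thesis by (simp add: pd_def)
qed

lemma Ck_on_bounded_linear:
  assumes "open S" "bounded_linear L" "Ck_on r S f"
  shows "Ck_on r S (\<lambda>x. L (f x))"
  using assms(3)
proof (induction r arbitrary: f)
  case 0 then show ?case
    using bounded_linear.continuous_on[OF assms(2)] by simp
next
  case (Suc r)
  from Suc.prems have d: "f differentiable (at x)" if "x \<in> S" for x
    using that Ck_on_Suc_open[OF assms(1)] by blast
  have "Ck_on r S (\<lambda>x. L (pd k f x))" for k using Suc by simp
  moreover have "Ck_on r S (pd k (\<lambda>x. L (f x))) = Ck_on r S (\<lambda>x. L (pd k f x))" for k
    by (rule Ck_on_cong[OF assms(1)]) (simp add: pd_bounded_linear[OF assms(2) d])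
  moreover have "(\<lambda>x. L (f x)) differentiable (at x)" if "x \<in> S" for x
    using bounded_linear.has_derivative[OF assms(2)] d[OF that] unfolding differentiable_def by blast
  ultimately show ?case by (simp add: Ck_on_Suc_open[OF assms(1)] del: Ck_on.simps)
qed

lemma Ck_on_add:
  assumes "open S" "Ck_on r S f" "Ck_on r S g"
  shows "Ck_on r S (\<lambda>x. f x + g x)"
  using assms(2,3)
proof (induction r arbitrary: f g)
  case 0 then show ?case by (simp add: continuous_on_add)
next
  case (Suc r)
  have d: "f differentiable (at x)" "g differentiable (at x)" if "x \<in> S" for x
    using Suc.prems that by (simp_all add: Ck_on_Suc_open[OF assms(1)] del: Ck_on.simps)
  have "Ck_on r S (\<lambda>x. pd k f x + pd k g x)" for k using Suc by simp
  moreover have "Ck_on r S (pd k (\<lambda>x. f x + g x)) = Ck_on r S (\<lambda>x. pd k f x + pd k g x)" for k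
    by (rule Ck_on_cong[OF assms(1)]) (simp add: pd_add[OF d])
  moreover have "(\<lambda>x. f x + g x) differentiable (at x)" if "x \<in> S" for x
    using d[OF that] by (rule differentiable_add)
  ultimately show ?case by (simp add: Ck_on_Suc_open[OF assms(1)] del: Ck_on.simps)
qed

text \<open>By Leibniz' rule a derivative is a sum of two bilinear terms of lower class. The general
  \<open>mul\<close> covers products of reals, scalar multiplication and inner products at
  once.\<close>

lemma Ck_on_bilinear:
  assumes "open S" "bounded_bilinear mul" "Ck_on r S f" "Ck_on r S g"
  shows "Ck_on r S (\<lambda>x. mul (f x) (g x))"
  using assms(3,4)
proof (induction r arbitrary: f g)
  case 0 then show ?case using bounded_bilinear.continuous_on[OF assms(2)] by simp
next
  case (Suc r)
  have d: "f differentiable (at x)" "g differentiable (at x)" if "x \<in> S" for x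
    using Suc.prems that by (simp_all add: Ck_on_Suc_open[OF assms(1)] del: Ck_on.simps)
  have c: "Ck_on r S f" "Ck_on r S g" using Suc.prems Ck_on_SucD by blast+
  have "Ck_on r S (\<lambda>x. mul (f x) (pd k g x) + mul (pd k f x) (g x))" for k
    using Suc c by (intro Ck_on_add[OF assms(1)]) auto
  moreover have "Ck_on r S (pd k (\<lambda>x. mul (f x) (g x)))
      = Ck_on r S (\<lambda>x. mul (f x) (pd k g x) + mul (pd k f x) (g x))" for k
    by (rule Ck_on_cong[OF assms(1)]) (simp add: pd_bilinear[OF assms(2) d])
  moreover have "(\<lambda>x. mul (f x) (g x)) differentiable (at x)" if "x \<in> S" for x
    using bounded_bilinear.FDERIV[OF assms(2)] d[OF that] unfolding differentiable_def by blast
  ultimately show ?case by (simp add: Ck_on_Suc_open[OF assms(1)] del: Ck_on.simps)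
qed

lemma Ck_on_sum:
  assumes "open S" "\<And>i. i \<in> I \<Longrightarrow> Ck_on r S (f i)"
  shows "Ck_on r S (\<lambda>x. \<Sum>i\<in>I. f i x)"
  using assms(2)
  by (induction I rule: infinite_finite_induct) (auto intro: Ck_on_add[OF assms(1)] Ck_on_const)

text \<open>By the chain rule a derivative of the composite is a sum of products of a component of
  \<open>pd k g\<close> with \<open>pd l f\<close> after \<open>g\<close>. The induction on
  \<open>r\<close> therefore runs over all \<open>f\<close> at once, and closure under products
  finishes it.\<close>

lemma Ck_on_compose:
  fixes f :: "real^'n \<Rightarrow> 'b::real_normed_vector" and g :: "real^'m \<Rightarrow> real^'n"
  assumes "open S" "open T" "g ` S \<subseteq> T" "Ck_on r S g" "Ck_on r T f"
  shows "Ck_on r S (\<lambda>x. f (g x))"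
    and "r > 0 \<Longrightarrow> x \<in> S \<Longrightarrow> pd k (\<lambda>x. f (g x)) x = (\<Sum>l\<in>UNIV. pd k g x $ l *\<^sub>R pd l f (g x))"
proof -
  have deriv: "((\<lambda>x. f (g x)) has_derivative
      (\<lambda>h. \<Sum>l\<in>UNIV. frechet_derivative g (at x) h $ l *\<^sub>R pd l f (g x))) (at x)"
    if "Ck_on (Suc q) S g" "Ck_on (Suc q) T f" "x \<in> S" for q x and f :: "real^'n \<Rightarrow> 'b"
  proof -
    have "g differentiable (at x)" "f differentiable (at (g x))"
      using that assms(3)
      by (auto simp: Ck_on_Suc_open[OF assms(1)] Ck_on_Suc_open[OF assms(2)] simp del: Ck_on.simps)
    then show ?thesis
      using has_derivative_compose[of g _ x UNIV, OF _ has_derivative_pd]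
      by (simp add: frechet_derivative_works)
  qed
  have pdc: "pd k (\<lambda>x. f (g x)) x = (\<Sum>l\<in>UNIV. pd k g x $ l *\<^sub>R pd l f (g x))"
    if "Ck_on (Suc q) S g" "Ck_on (Suc q) T f" "x \<in> S" for q x k and f :: "real^'n \<Rightarrow> 'b"
    using pd_eqI[OF deriv[OF that]] by (simp add: pd_def)
  show "Ck_on r S (\<lambda>x. f (g x))" using assms(4,5)
  proof (induction r arbitrary: f)
    case 0 then show ?case using assms(3) by (auto intro: continuous_on_compose2)
  next
    case (Suc r)
    have "Ck_on r S g" using Suc.prems Ck_on_SucD by blast
    with Suc have 1: "Ck_on r S (\<lambda>x. pd l f (g x))" for l by simp
    have 2: "Ck_on r S (\<lambda>x. pd k g x $ l)" for k l
      using Suc.prems by (intro Ck_on_bounded_linear[OF assms(1) bounded_linear_vec_nth]) simp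
    have "Ck_on r S (\<lambda>x. \<Sum>l\<in>UNIV. pd k g x $ l *\<^sub>R pd l f (g x))" for k
      by (intro Ck_on_sum[OF assms(1)] Ck_on_bilinear[OF assms(1) bounded_bilinear_scaleR] 1 2)
    moreover have "Ck_on r S (pd k (\<lambda>x. f (g x)))
        = Ck_on r S (\<lambda>x. \<Sum>l\<in>UNIV. pd k g x $ l *\<^sub>R pd l f (g x))" for k
      by (rule Ck_on_cong[OF assms(1)]) (rule pdc[OF Suc.prems])
    moreover have "(\<lambda>x. f (g x)) differentiable (at x)" if "x \<in> S" for x
      using deriv[OF Suc.prems that] by (rule differentiableI)
    ultimately show ?case by (simp add: Ck_on_Suc_open[OF assms(1)] del: Ck_on.simps)
  qed
  show "pd k (\<lambda>x. f (g x)) x = (\<Sum>l\<in>UNIV. pd k g x $ l *\<^sub>R pd l f (g x))" if "r > 0" "x \<in> S"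
  proof -
    obtain q where "r = Suc q" using \<open>r > 0\<close> gr0_implies_Suc by blast
    then show ?thesis using pdc[of q] assms(4,5) that(2) by simp
  qed
qed

text \<open>The scalar function comes with the sequence of all its derivatives: differentiating
  \<open>h n\<close> after \<open>g\<close> gives \<open>h (Suc n)\<close> after \<open>g\<close>
  times a derivative of \<open>g\<close>, so the induction has to cover every \<open>n\<close>.
  Powers and the flat function are used in this way.\<close>

lemma Ck_on_real_family:
  fixes g :: "real^'m \<Rightarrow> real" and h :: "nat \<Rightarrow> real \<Rightarrow> real"
  assumes "open S" "g ` S \<subseteq> T" "Ck_on r S g"
    and h: "\<And>n y. y \<in> T \<Longrightarrow> (h n has_real_derivative h (Suc n) y) (at y)"
  shows "Ck_on r S (\<lambda>x. h n (g x))"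
  using assms(3)
proof (induction r arbitrary: n)
  case 0
  have "continuous_on T (h n)"
    using h by (meson DERIV_isCont continuous_at_imp_continuous_on)
  then show ?case using 0 assms(2) by (auto intro: continuous_on_compose2)
next
  case (Suc r)
  have deriv: "((\<lambda>x. h n (g x)) has_derivative
      (\<lambda>v. frechet_derivative g (at x) v * h (Suc n) (g x))) (at x)" if "x \<in> S" for x
  proof -
    have "g differentiable (at x)" using that Suc.prems Ck_on_Suc_open[OF assms(1)] by blast
    moreover have "(h n has_derivative (\<lambda>v. v * h (Suc n) (g x))) (at (g x))"
    proof -
      have "(\<lambda>v. v * h (Suc n) (g x)) = (*) (h (Suc n) (g x))" by (simp add: fun_eq_iff)
      then show ?thesis using h[of "g x" n] that assms(2)
        by (auto simp: has_field_derivative_def)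
    qed
    ultimately show ?thesis
      using has_derivative_compose[of g _ x UNIV "h n"] by (simp add: frechet_derivative_works)
  qed
  have "Ck_on r S g" using Suc.prems Ck_on_SucD by blast
  with Suc have "Ck_on r S (\<lambda>x. pd k g x * h (Suc n) (g x))" for k
    by (intro Ck_on_bilinear[OF assms(1) bounded_bilinear_mult]) simp_all
  moreover have "Ck_on r S (pd k (\<lambda>x. h n (g x))) = Ck_on r S (\<lambda>x. pd k g x * h (Suc n) (g x))" for k
    by (rule Ck_on_cong[OF assms(1)]) (simp add: pd_eqI[OF deriv], simp add: pd_def)
  moreover have "(\<lambda>x. h n (g x)) differentiable (at x)" if "x \<in> S" for x
    using deriv[OF that] by (rule differentiableI)
  ultimately show ?case by (simp add: Ck_on_Suc_open[OF assms(1)] del: Ck_on.simps)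
qed

section \<open>Smooth functions\<close>

lemma smooth_on_differentiable:
  "smooth_on S f \<Longrightarrow> open S \<Longrightarrow> x \<in> S \<Longrightarrow> f differentiable (at x)"
  unfolding smooth_on_def by (metis Ck_on_Suc_open)

lemma smooth_on_pd: "smooth_on S f \<Longrightarrow> smooth_on S (pd k f)"
  unfolding smooth_on_def by (meson Ck_on.simps(2))

lemma smooth_on_foldr_pd: "smooth_on S f \<Longrightarrow> smooth_on S (foldr pd ks f)"
  by (induction ks) (auto intro: smooth_on_pd)

lemma smooth_on_continuous: "smooth_on S f \<Longrightarrow> continuous_on S f"
  unfolding smooth_on_def by (metis Ck_on.simps(1))

lemma smooth_on_mono: "smooth_on S f \<Longrightarrow> open T \<Longrightarrow> T \<subseteq> S \<Longrightarrow> smooth_on T f"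
  unfolding smooth_on_def using Ck_on_mono by blast

lemma smooth_on_cong: "open S \<Longrightarrow> (\<And>x. x \<in> S \<Longrightarrow> f x = g x) \<Longrightarrow> smooth_on S f = smooth_on S g"
  unfolding smooth_on_def using Ck_on_cong[of S f g] by blast

lemma smooth_on_local:
  "open S \<Longrightarrow> (\<And>x. x \<in> S \<Longrightarrow> \<exists>U. open U \<and> x \<in> U \<and> smooth_on U f) \<Longrightarrow> smooth_on S f"
  unfolding smooth_on_def by (intro allI Ck_on_local) auto

lemma smooth_on_const: "smooth_on S (\<lambda>x. c)"
  unfolding smooth_on_def using Ck_on_const by blast

lemma smooth_on_bounded_linear:
  "open S \<Longrightarrow> bounded_linear L \<Longrightarrow> smooth_on S f \<Longrightarrow> smooth_on S (\<lambda>x. L (f x))"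
  unfolding smooth_on_def using Ck_on_bounded_linear by blast

lemma smooth_on_id: "open S \<Longrightarrow> smooth_on S (\<lambda>x::real^'m. x)"
proof -
  assume S: "open S"
  have "pd k (\<lambda>x. x) x = axis k 1" for k :: 'm and x
    by (simp add: pd_eqI[OF has_derivative_ident])
  then have *: "pd k (\<lambda>x. x) = (\<lambda>x. axis k 1)" for k :: 'm by blast
  have "Ck_on r S (\<lambda>x. x)" for r by (cases r) (simp_all add: * Ck_on_const)
  then show ?thesis by (simp add: smooth_on_def)
qed

lemma smooth_on_add:
  "open S \<Longrightarrow> smooth_on S f \<Longrightarrow> smooth_on S g \<Longrightarrow> smooth_on S (\<lambda>x. f x + g x)"
  unfolding smooth_on_def using Ck_on_add by blast

lemma smooth_on_minus: "open S \<Longrightarrow> smooth_on S f \<Longrightarrow> smooth_on S (\<lambda>x. - f x)"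
  using smooth_on_bounded_linear[OF _ bounded_linear_minus[OF bounded_linear_ident]] by blast

lemma smooth_on_diff:
  "open S \<Longrightarrow> smooth_on S f \<Longrightarrow> smooth_on S g \<Longrightarrow> smooth_on S (\<lambda>x. f x - g x)"
  using smooth_on_add[of S f "\<lambda>x. - g x"] smooth_on_minus by fastforce

lemma smooth_on_bilinear:
  "open S \<Longrightarrow> bounded_bilinear mul \<Longrightarrow> smooth_on S f \<Longrightarrow> smooth_on S g
    \<Longrightarrow> smooth_on S (\<lambda>x. mul (f x) (g x))"
  unfolding smooth_on_def using Ck_on_bilinear by blast

lemmas smooth_on_mult = smooth_on_bilinear[OF _ bounded_bilinear_mult]
lemmas smooth_on_vec_nth = smooth_on_bounded_linear[OF _ bounded_linear_vec_nth]

lemma smooth_on_sum: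
  "open S \<Longrightarrow> (\<And>i. i \<in> I \<Longrightarrow> smooth_on S (f i)) \<Longrightarrow> smooth_on S (\<lambda>x. \<Sum>i\<in>I. f i x)"
  unfolding smooth_on_def using Ck_on_sum[of S I _ f] by blast

lemma smooth_on_prod:
  fixes f :: "'i \<Rightarrow> real^'m \<Rightarrow> real"
  assumes "open S" "\<And>i. i \<in> I \<Longrightarrow> smooth_on S (f i)"
  shows "smooth_on S (\<lambda>x. \<Prod>i\<in>I. f i x)"
  using assms(2)
  by (induction I rule: infinite_finite_induct) (auto intro: smooth_on_mult[OF assms(1)] smooth_on_const)

lemma bounded_linear_axis: "bounded_linear (axis k :: 'b::real_normed_vector \<Rightarrow> 'b^'n)"
proof (rule bounded_linear_intro[where K = 1])
  show "norm (axis k x :: 'b^'n) \<le> norm x * 1" for x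
    by (simp add: norm_vec_def axis_def L2_set_def if_distrib[of norm] if_distrib[of "\<lambda>x. x\<^sup>2"] cong: if_cong)
qed (auto simp: vec_eq_iff axis_def)

lemma smooth_on_vec_eq:
  fixes f :: "real^'m \<Rightarrow> 'b::real_normed_vector^'n"
  assumes "open S"
  shows "smooth_on S f \<longleftrightarrow> (\<forall>k. smooth_on S (\<lambda>x. f x $ k))"
proof
  assume "\<forall>k. smooth_on S (\<lambda>x. f x $ k)"
  then have "smooth_on S (\<lambda>x. \<Sum>k\<in>UNIV. axis k (f x $ k))"
    by (intro smooth_on_sum[OF assms] smooth_on_bounded_linear[OF assms bounded_linear_axis]) simp
  moreover have "(\<lambda>x. \<Sum>k\<in>UNIV. axis k (f x $ k)) = f"
    by (auto simp: vec_eq_iff axis_def if_distrib cong: if_cong)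
  ultimately show "smooth_on S f" by simp
qed (auto intro: smooth_on_vec_nth[OF assms])

lemma smooth_on_compose:
  fixes f :: "real^'n \<Rightarrow> 'b::real_normed_vector" and g :: "real^'m \<Rightarrow> real^'n"
  assumes "open S" "open T" "g ` S \<subseteq> T" "smooth_on S g" "smooth_on T f"
  shows "smooth_on S (\<lambda>x. f (g x))"
    and "x \<in> S \<Longrightarrow> pd k (\<lambda>x. f (g x)) x = (\<Sum>l\<in>UNIV. pd k g x $ l *\<^sub>R pd l f (g x))"
  using assms(4,5) Ck_on_compose[OF assms(1-3)] unfolding smooth_on_def by blast+

lemma smooth_on_real_family:
  fixes g :: "real^'m \<Rightarrow> real" and h :: "nat \<Rightarrow> real \<Rightarrow> real"
  assumes "open S" "g ` S \<subseteq> T" "smooth_on S g"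
    and "\<And>n y. y \<in> T \<Longrightarrow> (h n has_real_derivative h (Suc n) y) (at y)"
  shows "smooth_on S (\<lambda>x. h n (g x))"
  unfolding smooth_on_def
proof
  show "Ck_on r S (\<lambda>x. h n (g x))" for r
    by (rule Ck_on_real_family[where h = h, OF assms(1,2)]) (use assms in \<open>auto simp: smooth_on_def\<close>)
qed

text \<open>The coefficient is a falling factorial, so these are the successive derivatives of the
  power with exponent \<open>c\<close>. The values \<open>1/2\<close> and \<open>-1\<close> of
  \<open>c\<close> later give square roots and inverses.\<close>

lemma powr_family:
  fixes y :: real
  assumes "y > 0"
  shows "((\<lambda>y. (\<Prod>i<n. (c - real i)) * y powr (c - real n)) has_real_derivative
    (\<Prod>i<Suc n. (c - real i)) * y powr (c - real (Suc n))) (at y)"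
  using assms by (auto intro!: derivative_eq_intros simp: algebra_simps)

lemma smooth_on_powr:
  fixes g :: "real^'m \<Rightarrow> real"
  assumes "open S" "smooth_on S g" "\<And>x. x \<in> S \<Longrightarrow> g x > 0"
  shows "smooth_on S (\<lambda>x. g x powr c)"
proof -
  define h where "h n y = (\<Prod>i<n. (c - real i)) * y powr (c - real n)" for n and y :: real
  have "smooth_on S (\<lambda>x. h 0 (g x))"
    by (rule smooth_on_real_family[where T = "{0<..}", OF assms(1) _ assms(2)])
      (use assms(3) powr_family in \<open>auto simp: h_def\<close>)
  then show ?thesis by (simp add: h_def)
qed

lemma smooth_on_sqrt:
  fixes g :: "real^'m \<Rightarrow> real"
  assumes "open S" "smooth_on S g" "\<And>x. x \<in> S \<Longrightarrow> g x > 0"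
  shows "smooth_on S (\<lambda>x. sqrt (g x))"
  using smooth_on_powr[OF assms, of "1/2"] smooth_on_cong[OF assms(1), of "\<lambda>x. sqrt (g x)" "\<lambda>x. g x powr (1/2)"]
    assms(3) by (force simp: powr_half_sqrt less_imp_le)

lemma smooth_on_inverse:
  fixes g :: "real^'m \<Rightarrow> real"
  assumes "open S" "smooth_on S g" "\<And>x. x \<in> S \<Longrightarrow> g x > 0"
  shows "smooth_on S (\<lambda>x. inverse (g x))"
  using smooth_on_powr[OF assms, of "-1"] smooth_on_cong[OF assms(1), of "\<lambda>x. inverse (g x)" "\<lambda>x. g x powr -1"]
    assms(3) by (force simp: powr_minus less_imp_le)

section \<open>Symmetry of second partial derivatives\<close>

lemma line_derivative:
  fixes f :: "real^'m \<Rightarrow> real"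
  assumes "f differentiable (at (a + s *\<^sub>R axis k 1))"
  shows "((\<lambda>s. f (a + s *\<^sub>R axis k 1)) has_real_derivative pd k f (a + s *\<^sub>R axis k 1)) (at s)"
proof -
  let ?F = "frechet_derivative f (at (a + s *\<^sub>R axis k 1))"
  have F: "(f has_derivative ?F) (at (a + s *\<^sub>R axis k 1))"
    using assms by (simp add: frechet_derivative_works)
  have "((\<lambda>s. a + s *\<^sub>R axis k 1) has_derivative (\<lambda>t. t *\<^sub>R (axis k 1 :: real^'m))) (at s)"
    by (auto intro!: derivative_eq_intros)
  from has_derivative_compose[OF this F]
  have "((\<lambda>s. f (a + s *\<^sub>R axis k 1)) has_derivative (\<lambda>t. ?F (t *\<^sub>R axis k 1))) (at s)" .
  moreover have "?F (t *\<^sub>R axis k 1) = pd k f (a + s *\<^sub>R axis k 1) * t" for t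
    using linear_scale[OF has_derivative_linear[OF F]] by (simp add: pd_def)
  ultimately show ?thesis by (simp add: has_field_derivative_def)
qed

text \<open>The mean value theorem is applied twice: in direction \<open>k\<close> to the increment
  of \<open>f\<close> in direction \<open>l\<close>, then in direction \<open>l\<close> to
  \<open>pd k f\<close>. The intermediate point lies within \<open>2 * h\<close> of
  \<open>x\<close>, since each of the two displacements has length at most \<open>h\<close>.\<close>

lemma second_difference:
  fixes f :: "real^'m \<Rightarrow> real"
  assumes "h > 0" "cball x (2 * h) \<subseteq> S" "open S" "smooth_on S f"
  shows "\<exists>y\<in>cball x (2 * h). f (x + h *\<^sub>R axis k 1 + h *\<^sub>R axis l 1) - f (x + h *\<^sub>R axis k 1)
    - f (x + h *\<^sub>R axis l 1) + f x = h * (h * pd l (pd k f) y)"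
proof -
  have mem: "x + s *\<^sub>R axis k 1 + t *\<^sub>R axis l 1 \<in> cball x (2 * h)"
    if "0 \<le> s" "s \<le> h" "0 \<le> t" "t \<le> h" for s t
  proof -
    have "norm (s *\<^sub>R axis k 1 + t *\<^sub>R axis l 1 :: real^'m) \<le> norm (s *\<^sub>R axis k 1 :: real^'m) + norm (t *\<^sub>R axis l 1 :: real^'m)"
      by (rule norm_triangle_ineq)
    also have "\<dots> \<le> 2 * h" using that by (simp add: norm_axis_1)
    finally show ?thesis by (simp add: dist_norm norm_minus_commute algebra_simps)
  qed
  have df: "f differentiable (at y)" if "y \<in> cball x (2 * h)" for y
    using smooth_on_differentiable assms that by blast
  have dpf: "pd k f differentiable (at y)" if "y \<in> cball x (2 * h)" for y
    using smooth_on_differentiable[OF smooth_on_pd] assms that by blast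
  define \<phi> where "\<phi> s = f (x + h *\<^sub>R axis l 1 + s *\<^sub>R axis k 1) - f (x + s *\<^sub>R axis k 1)" for s
  have "(\<phi> has_real_derivative pd k f (x + h *\<^sub>R axis l 1 + s *\<^sub>R axis k 1) - pd k f (x + s *\<^sub>R axis k 1)) (at s)"
    if "0 \<le> s" "s \<le> h" for s
    unfolding \<phi>_def using mem[of s h] mem[of s 0] that assms(1)
    by (intro DERIV_diff line_derivative df) (auto simp: algebra_simps)
  from MVT2[OF assms(1) this] obtain u where u: "0 < u" "u < h"
    "\<phi> h - \<phi> 0 = h * (pd k f (x + h *\<^sub>R axis l 1 + u *\<^sub>R axis k 1) - pd k f (x + u *\<^sub>R axis k 1))"
    by auto
  have "((\<lambda>t. pd k f (x + u *\<^sub>R axis k 1 + t *\<^sub>R axis l 1)) has_real_derivative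
      pd l (pd k f) (x + u *\<^sub>R axis k 1 + t *\<^sub>R axis l 1)) (at t)" if "0 \<le> t" "t \<le> h" for t
    using mem[of u t] u that by (intro line_derivative dpf) auto
  from MVT2[OF assms(1) this] obtain v where v: "0 < v" "v < h"
    "pd k f (x + u *\<^sub>R axis k 1 + h *\<^sub>R axis l 1) - pd k f (x + u *\<^sub>R axis k 1)
      = h * pd l (pd k f) (x + u *\<^sub>R axis k 1 + v *\<^sub>R axis l 1)" by auto
  have "\<phi> h - \<phi> 0 = h * (h * pd l (pd k f) (x + u *\<^sub>R axis k 1 + v *\<^sub>R axis l 1))"
    using u(3) v(3) by (simp add: add_ac)
  then show ?thesis using mem[of u v] u v
    by (intro bexI[of _ "x + u *\<^sub>R axis k 1 + v *\<^sub>R axis l 1"]) (auto simp: \<phi>_def add_ac)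
qed

text \<open>The second difference is symmetric in the two directions. Hence arbitrarily near
  \<open>x\<close> a value of one mixed derivative equals a value of the other, and continuity does
  the rest.\<close>

theorem pd_commute:
  fixes f :: "real^'m \<Rightarrow> real"
  assumes "open S" "smooth_on S f" "x \<in> S"
  shows "pd k (pd l f) x = pd l (pd k f) x"
proof (rule ccontr)
  assume ne: "pd k (pd l f) x \<noteq> pd l (pd k f) x"
  \<comment> \<open>Half the gap: values strictly within \<open>e\<close> of the two mixed
    derivatives cannot coincide.\<close>
  define e where "e = \<bar>pd k (pd l f) x - pd l (pd k f) x\<bar> / 2"
  have e: "e > 0" using ne by (simp add: e_def)
  have "isCont (pd i (pd j f)) x" for i j
    using smooth_on_continuous[OF smooth_on_pd[OF smooth_on_pd[OF assms(2)]]] assms(1,3)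
    by (simp add: continuous_on_eq_continuous_at)
  then have "\<forall>\<^sub>F y in nhds x. dist (pd i (pd j f) y) (pd i (pd j f) x) < e" for i j
    by (intro tendstoD[OF _ e]) (simp only: isCont_def tendsto_at_iff_tendsto_nhds)
  then have "\<forall>\<^sub>F y in nhds x. dist (pd k (pd l f) y) (pd k (pd l f) x) < e
      \<and> dist (pd l (pd k f) y) (pd l (pd k f) x) < e \<and> y \<in> S"
    using assms(1,3) by (intro eventually_conj) (auto simp: eventually_nhds)
  then obtain d where d: "d > 0" "\<And>y. dist y x < d \<Longrightarrow> dist (pd k (pd l f) y) (pd k (pd l f) x) < e
      \<and> dist (pd l (pd k f) y) (pd l (pd k f) x) < e \<and> y \<in> S"
    by (auto simp: eventually_nhds_metric)
  define h where "h = d / 4"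
  have h: "h > 0" using d by (simp add: h_def)
  have near: "dist y x < d" if "y \<in> cball x (2 * h)" for y
    using that d(1) by (simp add: h_def dist_commute)
  then have sub: "cball x (2 * h) \<subseteq> S" using d(2) by blast
  obtain y where y: "y \<in> cball x (2 * h)" "f (x + h *\<^sub>R axis k 1 + h *\<^sub>R axis l 1) - f (x + h *\<^sub>R axis k 1)
    - f (x + h *\<^sub>R axis l 1) + f x = h * (h * pd l (pd k f) y)"
    using second_difference[OF h sub assms(1,2)] by blast
  obtain z where z: "z \<in> cball x (2 * h)" "f (x + h *\<^sub>R axis l 1 + h *\<^sub>R axis k 1) - f (x + h *\<^sub>R axis l 1)
    - f (x + h *\<^sub>R axis k 1) + f x = h * (h * pd k (pd l f) z)"
    using second_difference[OF h sub assms(1,2)] by blast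
  have "x + h *\<^sub>R axis l 1 + h *\<^sub>R axis k 1 = x + h *\<^sub>R axis k 1 + h *\<^sub>R axis l 1" by simp
  then have "h * (h * pd l (pd k f) y) = h * (h * pd k (pd l f) z)"
    using y(2) z(2) by (simp only:)
  then have "pd l (pd k f) y = pd k (pd l f) z" using h by simp
  with d(2)[OF near[OF y(1)]] d(2)[OF near[OF z(1)]] show False
    by (auto simp: e_def dist_real_def abs_if split: if_splits)
qed

section \<open>The alternating symbol\<close>

lemma vector_4:
  "(vector [x, y, z, w] :: 'a::zero^4) $ 1 = x" "(vector [x, y, z, w] :: 'a^4) $ 2 = y"
  "(vector [x, y, z, w] :: 'a^4) $ 3 = z" "(vector [x, y, z, w] :: 'a^4) $ 4 = w"
  unfolding vector_def by simp_all

lemma det_4: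
  "det (A :: 'a::comm_ring_1^4^4) =
      A $ 1 $ 1 * A $ 2 $ 2 * A $ 3 $ 3 * A $ 4 $ 4 - A $ 1 $ 1 * A $ 2 $ 2 * A $ 3 $ 4 * A $ 4 $ 3 - A $ 1 $ 1 * A $ 2 $ 3 * A $ 3 $ 2 * A $ 4 $ 4 + A $ 1 $ 1 * A $ 2 $ 3 * A $ 3 $ 4 * A $ 4 $ 2
      + A $ 1 $ 1 * A $ 2 $ 4 * A $ 3 $ 2 * A $ 4 $ 3 - A $ 1 $ 1 * A $ 2 $ 4 * A $ 3 $ 3 * A $ 4 $ 2 - A $ 1 $ 2 * A $ 2 $ 1 * A $ 3 $ 3 * A $ 4 $ 4 + A $ 1 $ 2 * A $ 2 $ 1 * A $ 3 $ 4 * A $ 4 $ 3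
      + A $ 1 $ 2 * A $ 2 $ 3 * A $ 3 $ 1 * A $ 4 $ 4 - A $ 1 $ 2 * A $ 2 $ 3 * A $ 3 $ 4 * A $ 4 $ 1 - A $ 1 $ 2 * A $ 2 $ 4 * A $ 3 $ 1 * A $ 4 $ 3 + A $ 1 $ 2 * A $ 2 $ 4 * A $ 3 $ 3 * A $ 4 $ 1
      + A $ 1 $ 3 * A $ 2 $ 1 * A $ 3 $ 2 * A $ 4 $ 4 - A $ 1 $ 3 * A $ 2 $ 1 * A $ 3 $ 4 * A $ 4 $ 2 - A $ 1 $ 3 * A $ 2 $ 2 * A $ 3 $ 1 * A $ 4 $ 4 + A $ 1 $ 3 * A $ 2 $ 2 * A $ 3 $ 4 * A $ 4 $ 1
      + A $ 1 $ 3 * A $ 2 $ 4 * A $ 3 $ 1 * A $ 4 $ 2 - A $ 1 $ 3 * A $ 2 $ 4 * A $ 3 $ 2 * A $ 4 $ 1 - A $ 1 $ 4 * A $ 2 $ 1 * A $ 3 $ 2 * A $ 4 $ 3 + A $ 1 $ 4 * A $ 2 $ 1 * A $ 3 $ 3 * A $ 4 $ 2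
      + A $ 1 $ 4 * A $ 2 $ 2 * A $ 3 $ 1 * A $ 4 $ 3 - A $ 1 $ 4 * A $ 2 $ 2 * A $ 3 $ 3 * A $ 4 $ 1 - A $ 1 $ 4 * A $ 2 $ 3 * A $ 3 $ 1 * A $ 4 $ 2 + A $ 1 $ 4 * A $ 2 $ 3 * A $ 3 $ 2 * A $ 4 $ 1"
proof -
  have f1: "finite {2::4, 3, 4}" "1 \<notin> {2::4, 3, 4}" by auto
  have f2: "finite {3::4, 4}" "2 \<notin> {3::4, 4}" by auto
  have f3: "finite {4::4}" "3 \<notin> {4::4}" by auto
  show ?thesis
    unfolding det_def UNIV_4
    unfolding sum_over_permutations_insert[OF f1] sum_over_permutations_insert[OF f2]
      sum_over_permutations_insert[OF f3] permutes_sing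
    by (simp add: sign_swap_id permutation_swap_id permutation_compose sign_compose sign_id swap_id_eq)
qed

text \<open>Together with \<open>eps4_repeated\<close>, these values let the simplifier reduce a sum
  over four indices to its 24 non-zero terms.\<close>

lemma eps4_values:
  "eps4 1 2 3 4 = 1" "eps4 1 2 4 3 = - 1" "eps4 1 3 2 4 = - 1" "eps4 1 3 4 2 = 1"
  "eps4 1 4 2 3 = 1" "eps4 1 4 3 2 = - 1" "eps4 2 1 3 4 = - 1" "eps4 2 1 4 3 = 1"
  "eps4 2 3 1 4 = 1" "eps4 2 3 4 1 = - 1" "eps4 2 4 1 3 = - 1" "eps4 2 4 3 1 = 1"
  "eps4 3 1 2 4 = 1" "eps4 3 1 4 2 = - 1" "eps4 3 2 1 4 = - 1" "eps4 3 2 4 1 = 1"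
  "eps4 3 4 1 2 = 1" "eps4 3 4 2 1 = - 1" "eps4 4 1 2 3 = - 1" "eps4 4 1 3 2 = 1"
  "eps4 4 2 1 3 = 1" "eps4 4 2 3 1 = - 1" "eps4 4 3 1 2 = - 1" "eps4 4 3 2 1 = 1"
  by (simp_all add: eps4_def det_4 vector_4 axis_def)

lemma eps4_repeated:
  "eps4 k k m n = 0" "eps4 k l k n = 0" "eps4 k l m k = 0"
  "eps4 k l l n = 0" "eps4 k l m l = 0" "eps4 k l m m = 0"
proof -
  have z: "det A = 0" if "i \<noteq> j" "A $ i = A $ j" for i j and A :: "real^4^4"
    using det_identical_rows[of i j A] that by (simp add: row_def)
  show "eps4 k k m n = 0" unfolding eps4_def by (rule z[of 1 2]) (simp_all add: vector_4)
  show "eps4 k l k n = 0" unfolding eps4_def by (rule z[of 1 3]) (simp_all add: vector_4)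
  show "eps4 k l m k = 0" unfolding eps4_def by (rule z[of 1 4]) (simp_all add: vector_4)
  show "eps4 k l l n = 0" unfolding eps4_def by (rule z[of 2 3]) (simp_all add: vector_4)
  show "eps4 k l m l = 0" unfolding eps4_def by (rule z[of 2 4]) (simp_all add: vector_4)
  show "eps4 k l m m = 0" unfolding eps4_def by (rule z[of 3 4]) (simp_all add: vector_4)
qed

lemmas eps4_simps = eps4_values eps4_repeated

lemma sum_eps4:
  fixes u v w z :: "real^4"
  shows "(\<Sum>a\<in>UNIV. \<Sum>b\<in>UNIV. \<Sum>c\<in>UNIV. \<Sum>d\<in>UNIV. eps4 a b c d * (u $ a * v $ b * w $ c * z $ d))
    = det (vector [u, v, w, z] :: real^4^4)"
  unfolding sum_4 eps4_simps det_4 vector_4 by simp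

text \<open>Selecting the rows \<open>k\<close>, \<open>l\<close>, \<open>m\<close>,
  \<open>n\<close> of \<open>A\<close> is left multiplication by the matrix whose determinant is
  \<open>eps4 k l m n\<close> by definition, and the determinant is multiplicative.\<close>

lemma eps4_det:
  "(\<Sum>a\<in>UNIV. \<Sum>b\<in>UNIV. \<Sum>c\<in>UNIV. \<Sum>d\<in>UNIV. eps4 a b c d * (A $ k $ a * A $ l $ b * A $ m $ c * A $ n $ d))
    = det A * eps4 k l m n"
proof -
  have eq: "(vector [axis k 1, axis l 1, axis m 1, axis n 1] :: real^4^4) ** A
      = vector [A $ k, A $ l, A $ m, A $ n]"
    by (simp add: vec_eq_iff forall_4 matrix_matrix_mult_def vector_4 axis_def if_distrib[of "\<lambda>x. x * _"]
        cong: if_cong)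
  have "det (vector [A $ k, A $ l, A $ m, A $ n] :: real^4^4) = det A * eps4 k l m n"
    unfolding eps4_def eq[symmetric] det_mul by (rule mult.commute)
  then show ?thesis using sum_eps4 by simp
qed

section \<open>Two-forms on a four-dimensional vector space\<close>

lemma transpose_linear:
  fixes A B :: "real^'n^'m"
  shows "transpose (A + B) = transpose A + transpose B" "transpose (A - B) = transpose A - transpose B"
    "transpose (- A) = - transpose A" "transpose (c *\<^sub>R A) = c *\<^sub>R transpose A"
  by (simp_all add: transpose_def vec_eq_iff)

lemma matrix_mul_linear:
  fixes A B C :: "real^'n^'n"
  shows "(A + B) ** C = A ** C + B ** C" "A ** (B + C) = A ** B + A ** C"
    "(c *\<^sub>R A) ** B = c *\<^sub>R (A ** B)" "A ** (c *\<^sub>R B) = c *\<^sub>R (A ** B)"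
    "A ** (- B) = - (A ** B)" "(- A) ** B = - (A ** B)"
  by (simp_all add: vec_eq_iff matrix_matrix_mult_def sum_distrib_left sum.distrib sum_negf algebra_simps)

lemma antisym_nth:
  fixes u :: "real^4^4"
  assumes "transpose u = - u"
  shows "u $ 2 $ 1 = - u $ 1 $ 2" "u $ 3 $ 1 = - u $ 1 $ 3" "u $ 4 $ 1 = - u $ 1 $ 4"
    "u $ 3 $ 2 = - u $ 2 $ 3" "u $ 4 $ 2 = - u $ 2 $ 4" "u $ 4 $ 3 = - u $ 3 $ 4" "u $ k $ k = 0"
proof -
  have e: "u $ l $ k = - u $ k $ l" for k l
    using arg_cong[OF assms, of "\<lambda>m. m $ k $ l"] by (simp add: transpose_def)
  show "u $ 2 $ 1 = - u $ 1 $ 2" "u $ 3 $ 1 = - u $ 1 $ 3" "u $ 4 $ 1 = - u $ 1 $ 4"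
    "u $ 3 $ 2 = - u $ 2 $ 3" "u $ 4 $ 2 = - u $ 2 $ 4" "u $ 4 $ 3 = - u $ 3 $ 4"
    by (rule e)+
  show "u $ k $ k = 0" using e[of k k] by simp
qed

text \<open>Each choice of complementary index pairs occurs four times in the sum, once for every
  ordering within the two pairs; this cancels the factor \<open>1/4\<close>.\<close>

lemma wedge22_antisym:
  assumes "transpose v = - v" "transpose w = - w"
  shows "wedge22 v w = v $ 1 $ 2 * w $ 3 $ 4 - v $ 1 $ 3 * w $ 2 $ 4 + v $ 1 $ 4 * w $ 2 $ 3
    + v $ 2 $ 3 * w $ 1 $ 4 - v $ 2 $ 4 * w $ 1 $ 3 + v $ 3 $ 4 * w $ 1 $ 2"
  by (simp add: wedge22_def sum_4 eps4_simps antisym_nth[OF assms(1)] antisym_nth[OF assms(2)])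

lemma wedge22_sym:
  assumes "transpose v = - v" "transpose w = - w"
  shows "wedge22 v w = wedge22 w v"
  by (simp add: wedge22_antisym assms algebra_simps)

lemma congruence_nth:
  "(transpose A ** v ** A) $ k $ l = (\<Sum>a\<in>UNIV. \<Sum>b\<in>UNIV. A $ a $ k * A $ b $ l * (v :: real^4^4) $ a $ b)"
  by (simp add: matrix_matrix_mult_def transpose_def sum_distrib_right sum_distrib_left, subst sum.swap)
    (simp add: ac_simps)

lemma sum_quadruple_swap:
  fixes e :: "'a::finite \<Rightarrow> 'a \<Rightarrow> real"
  shows "(\<Sum>i\<in>UNIV. \<Sum>j\<in>UNIV. e i j * (\<Sum>p\<in>UNIV. f p i * v p) * (\<Sum>q\<in>UNIV. f q j * w q))
    = (\<Sum>p\<in>UNIV. \<Sum>q\<in>UNIV. v p * w q * (\<Sum>i\<in>UNIV. \<Sum>j\<in>UNIV. e i j * (f p i * f q j)))"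
proof -
  have "(\<Sum>i\<in>UNIV. \<Sum>j\<in>UNIV. e i j * (\<Sum>p\<in>UNIV. f p i * v p) * (\<Sum>q\<in>UNIV. f q j * w q))
    = (\<Sum>i\<in>UNIV. \<Sum>j\<in>UNIV. \<Sum>p\<in>UNIV. \<Sum>q\<in>UNIV. v p * w q * (e i j * (f p i * f q j)))"
    by (simp add: sum_distrib_left sum_distrib_right ac_simps)
  also have "\<dots> = (\<Sum>i\<in>UNIV. \<Sum>p\<in>UNIV. \<Sum>q\<in>UNIV. \<Sum>j\<in>UNIV. v p * w q * (e i j * (f p i * f q j)))"
    by (subst (2) sum.swap, subst (3) sum.swap) simp
  also have "\<dots> = (\<Sum>p\<in>UNIV. \<Sum>q\<in>UNIV. \<Sum>i\<in>UNIV. \<Sum>j\<in>UNIV. v p * w q * (e i j * (f p i * f q j)))"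
    by (subst (1) sum.swap, subst (2) sum.swap) simp
  finally show ?thesis by (simp add: sum_distrib_left)
qed

lemma sum_pair: "(\<Sum>k\<in>UNIV. \<Sum>l\<in>UNIV. f (k::4) (l::4)) = (\<Sum>x\<in>UNIV. f (fst x) (snd x))"
  by (simp add: sum.cartesian_product UNIV_Times_UNIV case_prod_beta)

lemma sum_pair4:
  "(\<Sum>k\<in>UNIV. \<Sum>l\<in>UNIV. \<Sum>m\<in>UNIV. \<Sum>n\<in>UNIV. f (k::4) (l::4) (m::4) (n::4))
    = (\<Sum>x\<in>UNIV. \<Sum>y\<in>UNIV. f (fst x) (snd x) (fst y) (snd y))"
  unfolding sum_pair[of "\<lambda>k l. \<Sum>m\<in>UNIV. \<Sum>n\<in>UNIV. f k l m n"] by (intro sum.cong refl sum_pair)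

text \<open>With an index pair as a single index, pulling back along \<open>A\<close> is linear with
  coefficients \<open>f\<close>, and the wedge product is a bilinear form \<open>e\<close>. That
  \<open>f\<close> scales \<open>e\<close> by \<open>det A\<close> is
  \<open>eps4_det\<close>.\<close>

lemma wedge22_congruence:
  "wedge22 (transpose A ** v ** A) (transpose A ** w ** A) = det A * wedge22 v w"
proof -
  define e where "e x y = 1/4 * eps4 (fst x) (snd x) (fst y) (snd y)" for x y
  define f where "f p i = A $ fst p $ fst i * A $ snd p $ snd i" for p i :: "4 \<times> 4"
  define V where "V p = v $ fst p $ snd p" for p
  define W where "W p = w $ fst p $ snd p" for p
  have minor: "(\<Sum>i\<in>UNIV. \<Sum>j\<in>UNIV. e i j * (f p i * f q j)) = det A * e p q" for p q
    using eps4_det[of A "fst p" "snd p" "fst q" "snd q"]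
    unfolding sum_pair4 by (simp add: e_def f_def sum_divide_distrib[symmetric] mult.assoc)
  have "wedge22 (transpose A ** v ** A) (transpose A ** w ** A)
      = (\<Sum>i\<in>UNIV. \<Sum>j\<in>UNIV. e i j * (\<Sum>p\<in>UNIV. f p i * V p) * (\<Sum>q\<in>UNIV. f q j * W q))"
    unfolding wedge22_def sum_pair4 congruence_nth
    unfolding sum_pair by (simp add: e_def f_def V_def W_def)
  also have "\<dots> = (\<Sum>p\<in>UNIV. \<Sum>q\<in>UNIV. V p * W q * (\<Sum>i\<in>UNIV. \<Sum>j\<in>UNIV. e i j * (f p i * f q j)))"
    by (rule sum_quadruple_swap)
  also have "\<dots> = (\<Sum>p\<in>UNIV. \<Sum>q\<in>UNIV. V p * W q * (det A * e p q))"
    by (simp only: minor)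
  finally show ?thesis
    unfolding wedge22_def sum_pair4 by (simp add: e_def V_def W_def sum_distrib_left ac_simps)
qed

text \<open>The metric-free part of the Hodge star. By \<open>dual2_congruence\<close> it exchanges
  covariant and contravariant components, up to a determinant.\<close>

definition dual2 :: "real^4^4 \<Rightarrow> real^4^4" where
  "dual2 X = (\<chi> k l. \<Sum>m\<in>UNIV. \<Sum>n\<in>UNIV. 1/2 * eps4 m n k l * X $ m $ n)"

lemma transpose_dual2: "transpose (dual2 X) = - dual2 X"
  unfolding vec_eq_iff forall_4 by (simp add: dual2_def transpose_def sum_4 eps4_simps)

lemma dual2_dual2:
  assumes "transpose X = - X"
  shows "dual2 (dual2 X) = X"
  unfolding vec_eq_iff forall_4 by (simp add: dual2_def sum_4 eps4_simps antisym_nth[OF assms])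

lemma wedge22_dual2: "wedge22 v w = 1/2 * (dual2 v \<bullet> w)"
  by (simp add: wedge22_def dual2_def inner_vec_def sum_4 eps4_simps algebra_simps)

lemma dual2_linear:
  "dual2 (u + v) = dual2 u + dual2 v" "dual2 (u - v) = dual2 u - dual2 v"
  "dual2 (- u) = - dual2 u" "dual2 (c *\<^sub>R u) = c *\<^sub>R dual2 u"
  by (simp_all add: dual2_def vec_eq_iff distrib_left right_diff_distrib add_divide_distrib
      diff_divide_distrib sum.distrib sum_subtractf sum_negf sum_distrib_left ac_simps)

lemma inner_congruence: "(transpose A ** X ** A) \<bullet> Y = X \<bullet> (A ** Y ** transpose A)" for X Y :: "real^4^4"
proof -
  have tr: "X \<bullet> Y = trace (transpose X ** Y)" for X Y :: "real^4^4"
    by (simp add: trace_def inner_vec_def matrix_matrix_mult_def transpose_def) (rule sum.swap)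
  have "(transpose A ** X ** A) \<bullet> Y = trace (transpose A ** (transpose X ** A ** Y))"
    by (simp add: tr matrix_transpose_mul matrix_mul_assoc)
  also have "\<dots> = trace (transpose X ** (A ** Y ** transpose A))"
    by (subst trace_mul_sym) (simp add: matrix_mul_assoc)
  finally show ?thesis by (simp add: tr)
qed

text \<open>The inner product with \<open>dual2 X\<close> is twice the wedge product with
  \<open>X\<close>, and the inner product is nondegenerate. Both sides are therefore tested against
  an arbitrary \<open>w\<close>, rewritten as the pullback along \<open>A\<close> of its pullback
  along \<open>B\<close>.\<close>

lemma dual2_congruence:
  assumes "A ** B = mat 1"
  shows "dual2 (transpose A ** X ** A) = det A *\<^sub>R (B ** dual2 X ** transpose B)"
proof -
  have BA: "B ** A = mat 1" using assms by (simp add: matrix_left_right_inverse)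
  have "dual2 (transpose A ** X ** A) \<bullet> w = (det A *\<^sub>R (B ** dual2 X ** transpose B)) \<bullet> w" for w
  proof -
    have "transpose A ** (transpose B ** w ** B) ** A = transpose (B ** A) ** w ** (B ** A)"
      by (simp add: matrix_transpose_mul matrix_mul_assoc)
    then have w: "w = transpose A ** (transpose B ** w ** B) ** A" by (simp add: BA)
    have "1/2 * (dual2 (transpose A ** X ** A) \<bullet> w) = wedge22 (transpose A ** X ** A) w"
      by (simp only: wedge22_dual2)
    also have "\<dots> = det A * wedge22 X (transpose B ** w ** B)"
      by (subst w) (rule wedge22_congruence)
    also have "\<dots> = 1/2 * ((det A *\<^sub>R (B ** dual2 X ** transpose B)) \<bullet> w)"
      using inner_congruence[of "transpose B" "dual2 X" w] by (simp add: wedge22_dual2)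
    finally show ?thesis by simp
  qed
  then show ?thesis using vector_eq_rdot by blast
qed

lemma matrix_inv_unique:
  fixes A B :: "real^'n^'n"
  assumes "A ** B = mat 1"
  shows "matrix_inv A = B"
proof -
  have BA: "B ** A = mat 1" using assms by (simp add: matrix_left_right_inverse)
  have "A ** matrix_inv A = mat 1 \<and> matrix_inv A ** A = mat 1"
    unfolding matrix_inv_def by (rule someI[of _ B]) (use assms BA in blast)
  then show ?thesis by (metis BA matrix_mul_assoc matrix_mul_lid matrix_mul_rid)
qed

lemma hodge2_real:
  "hodge2 g w = sqrt (det g) *\<^sub>R dual2 (matrix_inv g ** w ** transpose (matrix_inv g))"
proof -
  have "(\<Sum>m\<in>UNIV. \<Sum>n\<in>UNIV. \<Sum>r\<in>UNIV. \<Sum>s\<in>UNIV.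
     (1/2 * sqrt (det g) * eps4 m n k l * matrix_inv g $ m $ r * matrix_inv g $ n $ s) * w $ r $ s)
   = sqrt (det g) * (\<Sum>m\<in>UNIV. \<Sum>n\<in>UNIV. 1/2 * eps4 m n k l *
      (matrix_inv g ** w ** transpose (matrix_inv g)) $ m $ n)" for k l
    using congruence_nth[of "transpose (matrix_inv g)" w]
    by (simp add: sum_distrib_left transpose_def ac_simps)
  then show ?thesis by (simp add: hodge2_def dual2_def vec_eq_iff)
qed

section \<open>Orthonormal frames and the Hodge star\<close>

definition spd :: "real^'n^'n \<Rightarrow> bool" where
  "spd g \<longleftrightarrow> transpose g = g \<and> (\<forall>v. v \<noteq> 0 \<longrightarrow> v \<bullet> (g *v v) > 0)"

lemma inner_matrix_vector: "(u :: real^'n) \<bullet> (g *v v) = (transpose g *v u) \<bullet> v"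
  by (metis dot_lmul_matrix transpose_matrix_vector transpose_transpose)

text \<open>Gram-Schmidt by counting dimensions: fewer than \<open>CARD('n)\<close> vectors
  \<open>g *v b j\<close> leave a non-zero vector orthogonal to all of them, and Euclidean
  orthogonality to \<open>g *v b j\<close> is orthogonality to \<open>b j\<close> with respect to
  \<open>g\<close>.\<close>

lemma orthonormal_family:
  fixes g :: "real^'n^'n"
  assumes "spd g" "finite I" "card I \<le> CARD('n)"
  shows "\<exists>b :: 'i \<Rightarrow> real^'n. \<forall>i\<in>I. \<forall>j\<in>I. b i \<bullet> (g *v b j) = (if i = j then 1 else 0)"
  using assms(2,3)
proof (induction I)
  case (insert a I)
  then obtain b :: "'i \<Rightarrow> real^'n" where b: "\<forall>i\<in>I. \<forall>j\<in>I. b i \<bullet> (g *v b j) = (if i = j then 1 else 0)"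
    by auto
  have "dim ((\<lambda>j. g *v b j) ` I) \<le> card ((\<lambda>j. g *v b j) ` I)"
    by (rule dim_le_card') (simp add: insert.hyps)
  also have "\<dots> \<le> card I" by (rule card_image_le) (rule insert.hyps)
  also have "\<dots> < DIM(real^'n)" using insert by simp
  finally obtain x where x: "x \<noteq> 0" "\<And>y. y \<in> span ((\<lambda>j. g *v b j) ` I) \<Longrightarrow> orthogonal x y"
    using orthogonal_to_subspace_exists by blast
  have o: "x \<bullet> (g *v b j) = 0" if "j \<in> I" for j
    using x(2)[OF span_base] that by (auto simp: orthogonal_def)
  have sym: "u \<bullet> (g *v v) = v \<bullet> (g *v u)" for u v
    using assms(1) by (metis inner_commute inner_matrix_vector spd_def)
  have pos: "x \<bullet> (g *v x) > 0" using assms(1) x(1) by (simp add: spd_def)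
  define c where "c = 1 / sqrt (x \<bullet> (g *v x))"
  have c: "c * (c * (x \<bullet> (g *v x))) = 1"
    using pos by (simp add: c_def divide_simps)
  define b' where "b' i = (if i = a then c *\<^sub>R x else b i)" for i
  have "\<forall>i\<in>insert a I. \<forall>j\<in>insert a I. b' i \<bullet> (g *v b' j) = (if i = j then 1 else 0)"
    using b o sym c insert.hyps by (auto simp: b'_def matrix_vector_mult_scaleR inner_matrix_vector[symmetric])
  then show ?case by blast
qed simp

text \<open>The columns of \<open>Q\<close> are a \<open>g\<close>-orthonormal basis. Its
  orientation stays open, so only the square of \<open>det Q\<close> is determined.\<close>

lemma spd_frame:
  fixes g :: "real^'n^'n"
  assumes "spd g"
  obtains Q P where "transpose Q ** g ** Q = mat 1" "Q ** P = mat 1" "P ** Q = mat 1"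
    "matrix_inv g = Q ** transpose Q" "det g > 0" "det g * (det Q)\<^sup>2 = 1"
proof -
  obtain b :: "'n \<Rightarrow> real^'n" where b: "\<And>i j. b i \<bullet> (g *v b j) = (if i = j then 1 else 0)"
    using orthonormal_family[OF assms, of "UNIV :: 'n set"] by auto
  define Q where "Q = transpose (\<chi> i. b i)"
  have "(transpose Q ** g ** Q) $ i $ j = b i \<bullet> (g *v b j)" for i j
    by (simp add: Q_def matrix_mul_assoc[symmetric])
      (simp add: matrix_matrix_mult_def matrix_vector_mult_def transpose_def inner_vec_def)
  then have 1: "transpose Q ** g ** Q = mat 1"
    by (simp add: vec_eq_iff b mat_def)
  define P where "P = transpose Q ** g"
  have PQ: "P ** Q = mat 1" using 1 by (simp add: P_def)
  then have QP: "Q ** P = mat 1" by (simp add: matrix_left_right_inverse)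
  have "transpose (Q ** P) = mat 1" by (simp add: QP transpose_mat)
  moreover have "transpose (Q ** P) = g ** (Q ** transpose Q)"
    using assms by (simp add: P_def matrix_transpose_mul matrix_mul_assoc spd_def)
  ultimately have inv: "matrix_inv g = Q ** transpose Q" by (intro matrix_inv_unique) simp
  have d: "det g * (det Q)\<^sup>2 = 1"
    using arg_cong[OF 1, of det] by (simp add: det_mul power2_eq_square ac_simps)
  moreover have "det g > 0" using d by (smt (verit) mult_nonpos_nonneg zero_le_power2)
  ultimately show ?thesis using that 1 PQ QP inv by blast
qed

text \<open>For an orthonormal frame \<open>Q\<close> the scalar is 1 or -1 and records the
  orientation of the frame. Apart from it, the star is the standard one, carried to the frame and
  back.\<close>

lemma hodge2_frame:
  fixes g :: "real^4^4"
  assumes "Q ** P = mat 1" "matrix_inv g = Q ** transpose Q"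
  shows "hodge2 g w = (sqrt (det g) * det Q) *\<^sub>R (transpose P ** dual2 (transpose Q ** w ** Q) ** P)"
proof -
  have *: "transpose Q ** transpose P = mat 1"
    using assms(1) by (metis matrix_left_right_inverse matrix_transpose_mul transpose_mat)
  have "matrix_inv g ** w ** transpose (matrix_inv g)
      = transpose (transpose Q) ** (transpose Q ** w ** Q) ** transpose Q"
    by (simp add: assms(2) matrix_transpose_mul matrix_mul_assoc)
  then show ?thesis using dual2_congruence[OF *] by (simp add: hodge2_real)
qed

text \<open>In an orthonormal frame everything is explicit: \<open>wedge22 u (hodge2 g w)\<close> is
  \<open>sqrt (det g) / 2\<close> times the Euclidean inner product of the frame components, which
  is symmetric and positive. The orientation sign \<open>t\<close> of the frame cancels, by
  \<open>t * t = 1\<close> or against the sign of \<open>det P\<close>.\<close>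

lemma hodge2_self_adjoint_pos:
  fixes g :: "real^4^4"
  assumes "spd g" "transpose u = - u" "transpose w = - w"
  shows "transpose (hodge2 g w) = - hodge2 g w"
    and "hodge2 g (hodge2 g w) = w"
    and "wedge22 u (hodge2 g w) = wedge22 (hodge2 g u) w"
    and "wedge22 w (hodge2 g w) \<ge> 0"
proof -
  obtain Q P where QP: "transpose Q ** g ** Q = mat 1" "Q ** P = mat 1" "P ** Q = mat 1"
    "matrix_inv g = Q ** transpose Q" "det g > 0" "det g * (det Q)\<^sup>2 = 1"
    using spd_frame[OF assms(1)] .
  define t where "t = sqrt (det g) * det Q"
  have t: "t * t = 1" using QP(5,6) by (simp add: t_def power2_eq_square algebra_simps)
  have dP: "det P * det Q = 1" using arg_cong[OF QP(3), of det] by (simp add: det_mul)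
  have h: "hodge2 g w = t *\<^sub>R (transpose P ** dual2 (transpose Q ** w ** Q) ** P)" for w
    unfolding t_def by (rule hodge2_frame[OF QP(2,4)])
  have anti: "transpose (transpose A ** w ** A) = - (transpose A ** w ** A)" if "transpose w = - w"
    for A w :: "real^4^4"
    using that by (simp add: matrix_transpose_mul matrix_mul_assoc matrix_mul_linear)
  have Pu: "transpose P ** (transpose Q ** w ** Q) ** P = w" for w
  proof -
    have "transpose P ** (transpose Q ** w ** Q) ** P = transpose (Q ** P) ** w ** (Q ** P)"
      by (simp add: matrix_transpose_mul matrix_mul_assoc)
    then show ?thesis by (simp add: QP)
  qed
  have Qu: "transpose Q ** (transpose P ** w ** P) ** Q = w" for w
  proof -
    have "transpose Q ** (transpose P ** w ** P) ** Q = transpose (P ** Q) ** w ** (P ** Q)"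
      by (simp add: matrix_transpose_mul matrix_mul_assoc)
    then show ?thesis by (simp add: QP)
  qed
  have *: "transpose (hodge2 g w) = - hodge2 g w" for w :: "real^4^4"
    by (simp add: h transpose_linear anti[OF transpose_dual2])
  then show "transpose (hodge2 g w) = - hodge2 g w" .
  show "hodge2 g (hodge2 g w) = w"
  proof -
    have "dual2 (c *\<^sub>R X) = c *\<^sub>R dual2 X" for c X
      by (simp add: dual2_def vec_eq_iff sum_distrib_left ac_simps)
    then show ?thesis
      using t by (simp add: h matrix_mul_linear Qu dual2_dual2[OF anti[OF assms(3)]] Pu)
  qed
  have w: "wedge22 u (hodge2 g w) = (t * det P) / 2 * ((transpose Q ** u ** Q) \<bullet> (transpose Q ** w ** Q))"
    if "transpose u = - u" "transpose w = - w" for u w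
  proof -
    have sc: "wedge22 v (c *\<^sub>R w) = c * wedge22 v w" for v w c
      by (simp add: wedge22_dual2)
    have "wedge22 u (hodge2 g w) = t * wedge22 (transpose P ** (transpose Q ** u ** Q) ** P)
        (transpose P ** dual2 (transpose Q ** w ** Q) ** P)"
      by (simp only: h sc Pu)
    also have "\<dots> = t * det P * wedge22 (transpose Q ** u ** Q) (dual2 (transpose Q ** w ** Q))"
      by (simp only: wedge22_congruence mult.assoc)
    also have "wedge22 (transpose Q ** u ** Q) (dual2 (transpose Q ** w ** Q))
        = wedge22 (dual2 (transpose Q ** w ** Q)) (transpose Q ** u ** Q)"
      by (rule wedge22_sym[OF anti[OF that(1)] transpose_dual2])
    also have "\<dots> = 1/2 * ((transpose Q ** w ** Q) \<bullet> (transpose Q ** u ** Q))"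
      by (simp only: wedge22_dual2 dual2_dual2[OF anti[OF that(2)]])
    finally show ?thesis by (simp add: inner_commute)
  qed
  have "t * det P = sqrt (det g)"
    using dP by (simp add: t_def mult.commute[of "det Q"])
  then have tp: "t * det P \<ge> 0" using QP(5) by simp
  show "wedge22 w (hodge2 g w) \<ge> 0"
    using tp by (simp add: w assms)
  show "wedge22 u (hodge2 g w) = wedge22 (hodge2 g u) w"
    by (subst wedge22_sym[OF * assms(3)]) (simp add: w assms inner_commute)
qed

lemma wedge22_add: "wedge22 (u + v) w = wedge22 u w + wedge22 v w" "wedge22 w (u + v) = wedge22 w u + wedge22 w v"
  and wedge22_diff: "wedge22 (u - v) w = wedge22 u w - wedge22 v w" "wedge22 w (u - v) = wedge22 w u - wedge22 w v"
  and wedge22_minus: "wedge22 (- u) w = - wedge22 u w" "wedge22 w (- u) = - wedge22 w u"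
  by (simp_all add: wedge22_dual2 dual2_linear inner_simps add_divide_distrib diff_divide_distrib)

lemma wedge22_sum: "wedge22 (\<Sum>a\<in>I. f a) w = (\<Sum>a\<in>I. wedge22 (f a) w)"
  by (induction I rule: infinite_finite_induct) (simp_all add: wedge22_add, simp_all add: wedge22_def)

lemma hodge2_add: "hodge2 g (u + v) = hodge2 g u + hodge2 g v"
  by (simp add: hodge2_def vec_eq_iff scaleR_add_right sum.distrib)

lemma hodge2_scaleR: "hodge2 g (c *\<^sub>R u) = c *\<^sub>R hodge2 g u"
  by (simp add: hodge2_def vec_eq_iff scaleR_sum_right ac_simps)

lemma hodge2_diff: "hodge2 g (u - v) = hodge2 g u - hodge2 g v"
  by (simp add: hodge2_def vec_eq_iff scaleR_diff_right sum_subtractf)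

lemma sd_part_real:
  fixes g w :: "real^4^4"
  assumes "spd g" "transpose w = - w"
  shows "hodge2 g (sd_part g w) = sd_part g w"
    and "transpose (sd_part g w) = - sd_part g w"
  using hodge2_self_adjoint_pos(1,2)[OF assms(1) assms(2) assms(2)] assms(2)
  by (simp_all add: sd_part_def hodge2_add hodge2_scaleR add_ac transpose_linear scaleR_diff_right scaleR_add_right)

text \<open>The intersection pairing is negative semidefinite on anti-self-dual forms, which are orthogonal
  to the self-dual ones.\<close>

lemma wedge22_le_sd_part:
  fixes g w :: "real^4^4"
  assumes "spd g" "transpose w = - w"
  shows "wedge22 w w \<le> wedge22 (sd_part g w) (sd_part g w)"
proof -
  note H = hodge2_self_adjoint_pos[OF assms(1) assms(2) assms(2)]
  define p where "p = sd_part g w"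
  define m where "m = (1/2) *\<^sub>R (w - hodge2 g w)"
  have tm: "transpose m = - m"
    using H(1) assms(2) by (simp add: m_def transpose_linear scaleR_diff_right)
  have tp: "transpose p = - p" using sd_part_real(2)[OF assms] by (simp add: p_def)
  have hm: "hodge2 g m = - m"
    using H(2) by (simp add: m_def hodge2_scaleR hodge2_diff scaleR_diff_right)
  have hp: "hodge2 g p = p" using sd_part_real(1)[OF assms] by (simp add: p_def)
  have w: "w = p + m" by (simp add: p_def m_def sd_part_def vec_eq_iff field_simps)
  have mm: "wedge22 m m \<le> 0"
    using hodge2_self_adjoint_pos(4)[OF assms(1) tm tm] by (simp add: hm wedge22_minus)
  have pm: "wedge22 p m = 0"
    using hodge2_self_adjoint_pos(3)[OF assms(1) tp tm] by (simp add: hm hp wedge22_minus)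
  have "wedge22 w w = wedge22 p p + wedge22 m m"
    using wedge22_sym[OF tm tp] pm by (simp add: w wedge22_add)
  then show ?thesis using mm by (simp add: p_def)
qed

text \<open>The wedge square of a two-form is a signed sum of six products of two
  components.\<close>

lemma wedge22_bound:
  assumes "transpose w = - w" "\<And>k l. \<bar>w $ k $ l\<bar> \<le> d"
  shows "wedge22 w w \<le> 6 * d\<^sup>2"
proof -
  have "\<bar>w $ k $ l * w $ m $ n\<bar> \<le> d\<^sup>2" for k l m n
    using assms(2)[of k l] assms(2)[of m n]
    by (simp add: abs_mult power2_eq_square mult_mono')
  from this[of 1 2 3 4] this[of 1 3 2 4] this[of 1 4 2 3] show ?thesis
    unfolding wedge22_antisym[OF assms(1) assms(1)] abs_le_iff by (simp add: mult.commute)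
qed

text \<open>If \<open>Q\<close> is orthonormal for \<open>g\<close> and \<open>K\<close> inverts
  \<open>J\<close>, then \<open>K ** Q\<close> is orthonormal for the pulled back metric, and the
  pulled back form has the same components in it as \<open>w\<close> has in \<open>Q\<close>. By
  \<open>det J > 0\<close> the orientation signs of the two frames agree.\<close>

lemma hodge2_congruence:
  fixes g J :: "real^4^4"
  assumes "spd g" "det J > 0"
  shows "hodge2 (transpose J ** g ** J) (transpose J ** w ** J) = transpose J ** hodge2 g w ** J"
proof -
  obtain Q P where QP: "transpose Q ** g ** Q = mat 1" "Q ** P = mat 1" "P ** Q = mat 1"
    "matrix_inv g = Q ** transpose Q" "det g > 0" "det g * (det Q)\<^sup>2 = 1"
    using spd_frame[OF assms(1)] .
  have "invertible J" using assms(2) by (simp add: invertible_det_nz)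
  then obtain K where K: "J ** K = mat 1" "K ** J = mat 1" by (auto simp: invertible_def)
  have g: "g ** (Q ** transpose Q) = mat 1"
  proof -
    have "transpose Q ** g = P" using QP(1-3) by (metis matrix_mul_assoc matrix_mul_lid matrix_mul_rid)
    then have "Q ** transpose Q ** g = mat 1" using QP(2) by (metis matrix_mul_assoc)
    then show ?thesis by (simp add: matrix_left_right_inverse)
  qed
  have KJ: "transpose J ** transpose K = mat 1" by (metis K(2) matrix_transpose_mul transpose_mat)
  have "(transpose J ** g ** J) ** ((K ** Q) ** transpose (K ** Q))
      = transpose J ** (g ** ((J ** K) ** Q ** transpose Q)) ** transpose K"
    by (simp add: matrix_transpose_mul matrix_mul_assoc)
  also have "\<dots> = mat 1" using K g KJ by (simp add: matrix_mul_assoc)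
  finally have inv: "matrix_inv (transpose J ** g ** J) = (K ** Q) ** transpose (K ** Q)"
    by (rule matrix_inv_unique)
  have "(K ** Q) ** (P ** J) = K ** (Q ** P) ** J" by (simp add: matrix_mul_assoc)
  then have QP': "(K ** Q) ** (P ** J) = mat 1" using K QP by simp
  have cong: "transpose (K ** Q) ** (transpose J ** w ** J) ** (K ** Q) = transpose Q ** w ** Q"
  proof -
    have "transpose (K ** Q) ** (transpose J ** w ** J) ** (K ** Q)
        = transpose Q ** (transpose (J ** K)) ** w ** (J ** K) ** Q"
      by (simp add: matrix_transpose_mul matrix_mul_assoc)
    then show ?thesis by (simp add: K)
  qed
  have dJK: "det J * det K = 1" using arg_cong[OF K(1), of det] by (simp add: det_mul)
  have "sqrt (det (transpose J ** g ** J)) = det J * sqrt (det g)"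
    using assms(2) by (simp add: det_mul real_sqrt_mult ac_simps)
  then have sq: "sqrt (det (transpose J ** g ** J)) * det (K ** Q) = sqrt (det g) * det Q"
  proof -
    have "sqrt (det (transpose J ** g ** J)) * det (K ** Q) = (det J * det K) * (sqrt (det g) * det Q)"
      using \<open>sqrt (det (transpose J ** g ** J)) = _\<close> by (simp only: det_mul[of K] ac_simps)
    then show ?thesis by (simp only: dJK mult_1)
  qed
  show ?thesis
    unfolding hodge2_frame[OF QP' inv] hodge2_frame[OF QP(2,4)] cong sq
    by (simp add: matrix_mul_linear matrix_transpose_mul matrix_mul_assoc)
qed

section \<open>Tensor calculus in charts\<close>

lemma smooth_on_det:
  fixes A :: "real^'m \<Rightarrow> real^'n^'n"
  assumes "open S" "\<And>i j. smooth_on S (\<lambda>x. A x $ i $ j)"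
  shows "smooth_on S (\<lambda>x. det (A x))"
  unfolding det_def
  by (intro smooth_on_sum[OF assms(1)] smooth_on_mult[OF assms(1)] smooth_on_const
      smooth_on_prod[OF assms(1)] assms(2))

text \<open>Cramer's rule, in the form of a polynomial in the entries times an inverse determinant;
  this makes the inverse metric smooth.\<close>

lemma matrix_inv_nth:
  fixes g :: "real^'n^'n"
  assumes "det g \<noteq> 0"
  shows "matrix_inv g $ m $ r = det (\<chi> i j. if j = m then axis r 1 $ i else g $ i $ j) * inverse (det g)"
proof -
  obtain h where "g ** h = mat 1" using assms by (metis invertible_def invertible_det_nz)
  then have "g ** matrix_inv g = mat 1" using matrix_inv_unique by metis
  then have "g *v (matrix_inv g *v axis r 1) = axis r 1"
    by (simp add: matrix_vector_mul_assoc)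
  then have "matrix_inv g *v axis r 1
      = (\<chi> k. det (\<chi> i j. if j = k then axis r 1 $ i else g $ i $ j) / det g)"
    using cramer[OF assms] by blast
  then have "(matrix_inv g *v axis r 1) $ m = det (\<chi> i j. if j = m then axis r 1 $ i else g $ i $ j) / det g"
    by simp
  moreover have "(matrix_inv g *v axis r 1) $ m = matrix_inv g $ m $ r"
    by (simp add: matrix_vector_mult_basis column_def)
  ultimately show ?thesis by (simp add: divide_inverse)
qed

lemma smooth_on_matrix_inv:
  fixes g :: "real^'m \<Rightarrow> real^'n^'n"
  assumes "open S" "\<And>i j. smooth_on S (\<lambda>x. g x $ i $ j)" "\<And>x. x \<in> S \<Longrightarrow> det (g x) > 0"
  shows "smooth_on S (\<lambda>x. matrix_inv (g x) $ m $ r)"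
proof -
  have "smooth_on S (\<lambda>x. det (\<chi> i j. if j = m then axis r 1 $ i else g x $ i $ j) * inverse (det (g x)))"
  proof (intro smooth_on_mult[OF assms(1)] smooth_on_inverse[OF assms(1)] smooth_on_det[OF assms(1)] assms(2,3))
    show "smooth_on S (\<lambda>x. (\<chi> i j. if j = m then axis r 1 $ i else g x $ i $ j) $ i $ j)" for i j
      using assms(2) by (cases "j = m") (auto intro: smooth_on_const)
  qed
  moreover have "det (g x) \<noteq> 0" if "x \<in> S" for x using assms(3)[OF that] by simp
  ultimately show ?thesis
    by (subst smooth_on_cong[OF assms(1) matrix_inv_nth])
qed

text \<open>The star acts on the form indices only. The maps \<open>L\<close> that occur later are
  multiplication by \<open>\<i>\<close>, the imaginary part and the trace over
  \<open>E\<close>.\<close>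

lemma hodge2_linear:
  assumes "linear L"
  shows "hodge2 g (\<chi> k l. L (w $ k $ l)) = (\<chi> k l. L (hodge2 g w $ k $ l))"
  by (simp add: hodge2_def linear_sum[OF assms] linear_scale[OF assms])

lemma sd_part_linear:
  assumes "linear L"
  shows "sd_part g (\<chi> k l. L (w $ k $ l)) = (\<chi> k l. L (sd_part g w $ k $ l))"
  by (simp add: sd_part_def hodge2_linear[OF assms] vec_eq_iff linear_add[OF assms] linear_scale[OF assms])

definition imag_form :: "real^4^4 \<Rightarrow> complex^4^4" where
  "imag_form w = (\<chi> k l. \<i> * complex_of_real (w $ k $ l))"

text \<open>Values outside the chart domains are left free, since one-forms are never compared as
  families.\<close>

definition one_form :: "('a, 'i) riem4 \<Rightarrow> ('i \<Rightarrow> 'a \<Rightarrow> real^4) \<Rightarrow> bool" where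
  "one_form M b \<longleftrightarrow> (\<forall>i. smooth_in M i (mdom M i) (b i)) \<and>
    (\<forall>i j. \<forall>p \<in> mdom M i \<inter> mdom M j. \<forall>k. b i p $ k = (\<Sum>l\<in>UNIV. jac M i j p $ l $ k * b j p $ l))"

text \<open>Makes sense for any family of components: it is also applied to
  \<open>trace_conn\<close>, which need not transform as a one-form. The value 0 outside the chart
  domain is the one that \<open>two_forms\<close> prescribes.\<close>

definition ext_d :: "('a, 'i) riem4 \<Rightarrow> ('i \<Rightarrow> 'a \<Rightarrow> real^4) \<Rightarrow> 'i \<Rightarrow> 'a \<Rightarrow> real^4^4" where
  "ext_d M b i p = (if p \<in> mdom M i
     then \<chi> k l. partial M i k (\<lambda>q. b i q $ l) p - partial M i l (\<lambda>q. b i q $ k) p else 0)"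

section \<open>Charts, smooth functions and coordinate derivatives\<close>

locale manifold4 =
  fixes M :: "('a, 'i) riem4"
  assumes M: "closed_oriented_riemannian_4manifold M"
begin

abbreviation "D i \<equiv> mdom M i"
abbreviation "\<phi> i \<equiv> mchart M i"

lemma D_open: "openin (mtop M) (D i)"
  and img_open: "open (chart_img M i)"
  and chart_homeo: "homeomorphic_map (subtopology (mtop M) (D i)) (top_of_set (chart_img M i)) (\<phi> i)"
  and transition_smooth: "smooth_in M i (D i \<inter> D j) (\<phi> j)"
  and det_jac_pos: "p \<in> D i \<inter> D j \<Longrightarrow> det (jac M i j p) > 0"
  and metric_smooth: "smooth_in M i (D i) (mmetric M i)"
  and metric_spd: "p \<in> D i \<Longrightarrow> spd (mmetric M i p)"
  and metric_cov: "p \<in> D i \<inter> D j \<Longrightarrow>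
        mmetric M i p = transpose (jac M i j p) ** mmetric M j p ** jac M i j p"
  and Hausdorff: "Hausdorff_space (mtop M)" and compact: "compact_space (mtop M)"
  and D_cover: "(\<Union>i. D i) = topspace (mtop M)"
  using M unfolding closed_oriented_riemannian_4manifold_def spd_def by blast+

lemma D_sub: "D i \<subseteq> topspace (mtop M)"
  using D_open openin_subset by blast

lemma top_D: "topspace (subtopology (mtop M) (D i)) = D i"
  using D_sub by (simp add: inf.absorb2)

lemma inj: "inj_on (\<phi> i) (D i)"
  using homeomorphic_imp_injective_map[OF chart_homeo] top_D by simp

lemma open_image:
  assumes "openin (mtop M) W" "W \<subseteq> D i"
  shows "open (\<phi> i ` W)"
proof -
  have "openin (subtopology (mtop M) (D i)) W"
    using assms D_open by (simp add: openin_open_subtopology)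
  then have "openin (top_of_set (chart_img M i)) (\<phi> i ` W)"
    using homeomorphic_imp_open_map[OF chart_homeo] by (simp add: open_map_def)
  then show ?thesis using img_open openin_open_eq by blast
qed

lemma openin_preimage:
  assumes "open U"
  shows "openin (mtop M) {p \<in> D i. \<phi> i p \<in> U}"
proof -
  have "continuous_map (subtopology (mtop M) (D i)) (top_of_set (chart_img M i)) (\<phi> i)"
    by (rule homeomorphic_imp_continuous_map[OF chart_homeo])
  moreover have "openin (top_of_set (chart_img M i)) (chart_img M i \<inter> U)"
    using assms by (rule openin_open_Int)
  ultimately have "openin (subtopology (mtop M) (D i))
      {p \<in> topspace (subtopology (mtop M) (D i)). \<phi> i p \<in> chart_img M i \<inter> U}"
    by (rule openin_continuous_map_preimage)
  moreover have "{p \<in> topspace (subtopology (mtop M) (D i)). \<phi> i p \<in> chart_img M i \<inter> U} = {p \<in> D i. \<phi> i p \<in> U}"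
    unfolding top_D by auto
  ultimately show ?thesis using openin_trans_full D_open by metis
qed

lemma compactin_preimage:
  assumes "compact K" "K \<subseteq> chart_img M i"
  shows "compactin (mtop M) {p \<in> D i. \<phi> i p \<in> K}"
proof -
  obtain f where f: "homeomorphic_maps (subtopology (mtop M) (D i)) (top_of_set (chart_img M i)) (\<phi> i) f"
    using chart_homeo homeomorphic_map_maps by blast
  have "continuous_map (top_of_set (chart_img M i)) (subtopology (mtop M) (D i)) f"
    using f by (simp add: homeomorphic_maps_def)
  moreover have "compactin (top_of_set (chart_img M i)) K"
    using assms by (simp add: compactin_subtopology)
  ultimately have "compactin (subtopology (mtop M) (D i)) (f ` K)"
    by (rule image_compactin[rotated])
  then have "compactin (mtop M) (f ` K)" by (simp add: compactin_subtopology)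
  moreover have "f ` K = {p \<in> D i. \<phi> i p \<in> K}"
  proof -
    have fy: "f y \<in> D i \<and> \<phi> i (f y) = y" if "y \<in> chart_img M i" for y
      using f that D_sub by (auto simp: homeomorphic_maps_def continuous_map_def)
    have fp: "f (\<phi> i p) = p" if "p \<in> D i" for p
      using f that D_sub by (auto simp: homeomorphic_maps_def)
    show ?thesis using assms(2) fy fp by (fastforce simp: image_iff)
  qed
  ultimately show ?thesis by simp
qed

lemma compact_image:
  assumes "compactin (mtop M) K" "K \<subseteq> D i"
  shows "compact (\<phi> i ` K)"
proof -
  have "compactin (subtopology (mtop M) (D i)) K"
    using assms by (simp add: compactin_subtopology)
  from image_compactin[OF this homeomorphic_imp_continuous_map[OF chart_homeo]]
  show ?thesis by (simp add: compactin_subtopology)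
qed

lemma in_coords_chart: "p \<in> D i \<Longrightarrow> in_coords M i f (\<phi> i p) = f p"
  using inj by (simp add: in_coords_def)

lemma smooth_in_cong:
  assumes "openin (mtop M) W" "W \<subseteq> D i" "\<And>p. p \<in> W \<Longrightarrow> f p = g p"
  shows "smooth_in M i W f = smooth_in M i W g"
  unfolding smooth_in_def
  by (rule smooth_on_cong[OF open_image[OF assms(1,2)]])
    (auto simp: in_coords_chart subsetD[OF assms(2)] assms(3))

lemma smooth_in_mono:
  assumes "openin (mtop M) W" "W \<subseteq> V" "V \<subseteq> D i" "smooth_in M i V f"
  shows "smooth_in M i W f"
  using assms smooth_on_mono[of _ "in_coords M i f" "\<phi> i ` W"] open_image[of W i]
  by (auto simp: smooth_in_def image_mono)

lemma smooth_in_local: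
  assumes "openin (mtop M) W" "W \<subseteq> D i"
    "\<And>p. p \<in> W \<Longrightarrow> \<exists>V. openin (mtop M) V \<and> p \<in> V \<and> V \<subseteq> D i \<and> smooth_in M i V f"
  shows "smooth_in M i W f"
  unfolding smooth_in_def
proof (rule smooth_on_local[OF open_image[OF assms(1,2)]])
  fix x assume "x \<in> \<phi> i ` W"
  then obtain p where p: "p \<in> W" "x = \<phi> i p" by blast
  from assms(3)[OF p(1)] obtain V where V: "openin (mtop M) V" "p \<in> V" "V \<subseteq> D i" "smooth_in M i V f"
    by blast
  show "\<exists>U. open U \<and> x \<in> U \<and> smooth_on U (in_coords M i f)"
    by (rule exI[of _ "\<phi> i ` V"]) (use V p(2) open_image in \<open>simp add: smooth_in_def\<close>)
qed

lemma smooth_in_const: "smooth_in M i W (\<lambda>p. c)"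
  by (simp add: smooth_in_def in_coords_def smooth_on_const)

context
  fixes W :: "'a set" and i :: 'i
  assumes W: "openin (mtop M) W" "W \<subseteq> D i"
begin

lemma smooth_in_bounded_linear:
  "bounded_linear L \<Longrightarrow> smooth_in M i W f \<Longrightarrow> smooth_in M i W (\<lambda>p. L (f p))"
  using smooth_on_bounded_linear[OF open_image[OF W]] by (simp add: smooth_in_def in_coords_def)

lemma smooth_in_bilinear:
  "bounded_bilinear mul \<Longrightarrow> smooth_in M i W f \<Longrightarrow> smooth_in M i W g
    \<Longrightarrow> smooth_in M i W (\<lambda>p. mul (f p) (g p))"
  using smooth_on_bilinear[OF open_image[OF W]] by (simp add: smooth_in_def in_coords_def)

lemmas smooth_in_mult = smooth_in_bilinear[OF bounded_bilinear_mult]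
lemmas smooth_in_scaleR = smooth_in_bilinear[OF bounded_bilinear_scaleR]

lemma smooth_in_add: "smooth_in M i W f \<Longrightarrow> smooth_in M i W g \<Longrightarrow> smooth_in M i W (\<lambda>p. f p + g p)"
  using smooth_on_add[OF open_image[OF W]] by (simp add: smooth_in_def in_coords_def)

lemma smooth_in_diff: "smooth_in M i W f \<Longrightarrow> smooth_in M i W g \<Longrightarrow> smooth_in M i W (\<lambda>p. f p - g p)"
  using smooth_on_diff[OF open_image[OF W]] by (simp add: smooth_in_def in_coords_def)

lemma smooth_in_sum:
  "(\<And>a. a \<in> I \<Longrightarrow> smooth_in M i W (f a)) \<Longrightarrow> smooth_in M i W (\<lambda>p. \<Sum>a\<in>I. f a p)"
  using smooth_on_sum[OF open_image[OF W], of I "\<lambda>a. in_coords M i (f a)"]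
  by (simp add: smooth_in_def in_coords_def)

lemma smooth_in_vec_eq: "smooth_in M i W f \<longleftrightarrow> (\<forall>k. smooth_in M i W (\<lambda>p. f p $ k))"
  using smooth_on_vec_eq[OF open_image[OF W], of "in_coords M i f"]
  by (simp add: smooth_in_def in_coords_def)

lemma smooth_in_inverse:
  fixes f :: "'a \<Rightarrow> real"
  assumes "smooth_in M i W f" "\<And>p. p \<in> W \<Longrightarrow> f p > 0"
  shows "smooth_in M i W (\<lambda>p. inverse (f p))"
proof -
  have "in_coords M i f x > 0" if "x \<in> \<phi> i ` W" for x
  proof -
    obtain p where "p \<in> W" "x = \<phi> i p" using \<open>x \<in> \<phi> i ` W\<close> by blast
    moreover then have "p \<in> D i" using W(2) by blast
    ultimately show ?thesis using assms(2) by (simp add: in_coords_chart)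
  qed
  from smooth_on_inverse[OF open_image[OF W] _ this] show ?thesis
    using assms(1) by (simp add: smooth_in_def in_coords_def)
qed

lemma coords_differentiable:
  "smooth_in M i W f \<Longrightarrow> p \<in> W \<Longrightarrow> in_coords M i f differentiable (at (\<phi> i p))"
  using smooth_on_differentiable[OF _ open_image[OF W], of "in_coords M i f" "\<phi> i p"] by (simp add: smooth_in_def)

lemma partial_cong:
  assumes "p \<in> W" "\<And>q. q \<in> W \<Longrightarrow> f q = g q"
  shows "partial M i k f p = partial M i k g p"
  unfolding partial_def
  by (rule pd_cong[OF open_image[OF W]]) (auto simp: assms in_coords_chart subsetD[OF W(2)])

lemma partial_diff:
  "smooth_in M i W f \<Longrightarrow> smooth_in M i W g \<Longrightarrow> p \<in> W
    \<Longrightarrow> partial M i k (\<lambda>p. f p - g p) p = partial M i k f p - partial M i k g p"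
  using pd_diff[OF coords_differentiable coords_differentiable] by (simp add: partial_def in_coords_def)

lemma partial_sum:
  assumes "\<And>a. a \<in> I \<Longrightarrow> smooth_in M i W (f a)" "p \<in> W"
  shows "partial M i k (\<lambda>p. \<Sum>a\<in>I. f a p) p = (\<Sum>a\<in>I. partial M i k (f a) p)"
  using pd_sum[OF coords_differentiable[OF assms], of I] by (simp add: partial_def in_coords_def)

lemma partial_bilinear:
  assumes "bounded_bilinear mul" "smooth_in M i W f" "smooth_in M i W g" "p \<in> W"
  shows "partial M i k (\<lambda>p. mul (f p) (g p)) p = mul (f p) (partial M i k g p) + mul (partial M i k f p) (g p)"
  using pd_bilinear[OF assms(1) coords_differentiable[OF assms(2,4)] coords_differentiable[OF assms(3,4)]]
    inv_into_f_f[OF inj, of p i] subsetD[OF W(2) assms(4)]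
  by (simp add: partial_def in_coords_def)

lemmas partial_mult = partial_bilinear[OF bounded_bilinear_mult]

lemma partial_bounded_linear:
  "bounded_linear L \<Longrightarrow> smooth_in M i W f \<Longrightarrow> p \<in> W
    \<Longrightarrow> partial M i k (\<lambda>p. L (f p)) p = L (partial M i k f p)"
  using pd_bounded_linear[OF _ coords_differentiable] by (simp add: partial_def in_coords_def)

lemmas partial_vec_nth = partial_bounded_linear[OF bounded_linear_vec_nth]

lemma coords_partial:
  assumes "x \<in> \<phi> i ` W"
  shows "in_coords M i (partial M i k f) x = pd k (in_coords M i f) x"
  using assms W(2) by (auto simp: in_coords_chart partial_def)

lemma smooth_in_partial:
  assumes "smooth_in M i W f"
  shows "smooth_in M i W (partial M i k f)"
proof -
  have "smooth_on (\<phi> i ` W) (in_coords M i (partial M i k f)) = smooth_on (\<phi> i ` W) (pd k (in_coords M i f))"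
    by (rule smooth_on_cong[OF open_image[OF W] coords_partial])
  then show ?thesis using smooth_on_pd assms by (simp add: smooth_in_def)
qed

lemma partial_commute:
  fixes f :: "'a \<Rightarrow> real"
  assumes "smooth_in M i W f" "p \<in> W"
  shows "partial M i k (partial M i l f) p = partial M i l (partial M i k f) p"
proof -
  have "partial M i k (partial M i l f) p = pd k (pd l (in_coords M i f)) (\<phi> i p)" for k l
    unfolding partial_def[of M i k]
    by (rule pd_cong[OF open_image[OF W]]) (use assms(2) coords_partial in auto)
  then show ?thesis
    using pd_commute[OF open_image[OF W]] assms by (simp add: smooth_in_def)
qed

end

section \<open>Change of charts\<close>

lemma D2_open: "openin (mtop M) (D i \<inter> D j)"
  using D_open by blast

text \<open>Written in chart \<open>i\<close>, the function \<open>f\<close> is its expression in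
  chart \<open>j\<close> after the transition map; both claims are the chain rule for this
  composite.\<close>

lemma change_chart:
  fixes f :: "'a \<Rightarrow> 'b::real_normed_vector"
  assumes "openin (mtop M) W" "W \<subseteq> D i \<inter> D j" "smooth_in M j W f"
  shows "smooth_in M i W f"
    and "p \<in> W \<Longrightarrow> partial M i k f p = (\<Sum>l\<in>UNIV. jac M i j p $ l $ k *\<^sub>R partial M j l f p)"
proof -
  have W: "W \<subseteq> D i" "W \<subseteq> D j" using assms(2) by auto
  let ?g = "in_coords M i (\<phi> j)"
  have g: "?g ` (\<phi> i ` W) \<subseteq> \<phi> j ` W" by (auto simp: in_coords_chart subsetD[OF W(1)])
  have sg: "smooth_on (\<phi> i ` W) ?g"
    using smooth_in_mono[OF assms(1,2) _ transition_smooth] by (simp add: smooth_in_def)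
  have sf: "smooth_on (\<phi> j ` W) (in_coords M j f)" using assms(3) by (simp add: smooth_in_def)
  have eq: "in_coords M i f x = in_coords M j f (?g x)" if "x \<in> \<phi> i ` W" for x
    using that by (auto simp: in_coords_chart subsetD[OF W(1)] subsetD[OF W(2)])
  note oi = open_image[OF assms(1) W(1)] and oj = open_image[OF assms(1) W(2)]
  have "smooth_on (\<phi> i ` W) (in_coords M i f) = smooth_on (\<phi> i ` W) (\<lambda>x. in_coords M j f (?g x))"
    by (rule smooth_on_cong[OF oi eq])
  then show "smooth_in M i W f"
    using smooth_on_compose(1)[OF oi oj g sg sf] by (simp only: smooth_in_def)
  assume p: "p \<in> W"
  have "partial M i k f p = pd k (\<lambda>x. in_coords M j f (?g x)) (\<phi> i p)"
    unfolding partial_def using p eq by (intro pd_cong[OF oi]) auto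
  also have "\<dots> = (\<Sum>l\<in>UNIV. pd k ?g (\<phi> i p) $ l *\<^sub>R pd l (in_coords M j f) (?g (\<phi> i p)))"
    using p by (intro smooth_on_compose(2)[OF oi oj g sg sf]) auto
  also have "?g (\<phi> i p) = \<phi> j p" using p W by (auto simp: in_coords_chart)
  finally show "partial M i k f p = (\<Sum>l\<in>UNIV. jac M i j p $ l $ k *\<^sub>R partial M j l f p)"
    by (simp add: jac_def partial_def)
qed

lemma jac_nth:
  "p \<in> D i \<inter> D j \<Longrightarrow> jac M i j p $ r $ l = partial M i l (\<lambda>q. \<phi> j q $ r) p"
  using partial_vec_nth[OF D2_open _ transition_smooth] by (simp add: jac_def)

lemma transition_nth_smooth: "smooth_in M i (D i \<inter> D j) (\<lambda>q. \<phi> j q $ r)"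
  using smooth_in_vec_eq[OF D2_open] transition_smooth by blast

lemma jac_smooth: "smooth_in M i (D i \<inter> D j) (\<lambda>p. jac M i j p $ r $ l)"
  using smooth_in_partial[OF D2_open _ transition_nth_smooth]
    smooth_in_cong[OF D2_open _ jac_nth] by auto

text \<open>Both entries are first derivatives of one coordinate function of chart \<open>j\<close>,
  so this is the symmetry of its second derivatives. It makes the exterior derivative independent of
  the chart.\<close>

lemma partial_jac_commute:
  assumes "p \<in> D i \<inter> D j"
  shows "partial M i k (\<lambda>q. jac M i j q $ r $ l) p = partial M i l (\<lambda>q. jac M i j q $ r $ k) p"
proof -
  have "partial M i k (\<lambda>q. jac M i j q $ r $ l) p = partial M i k (partial M i l (\<lambda>q. \<phi> j q $ r)) p" for k l
    by (rule partial_cong[OF D2_open _ assms]) (simp_all add: jac_nth)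
  then show ?thesis using partial_commute[OF D2_open _ transition_nth_smooth assms] by simp
qed

section \<open>Two-forms and the metric in coordinates\<close>

lemma two_formsD:
  assumes "w \<in> two_forms M"
  shows "smooth_in M i (D i) (w i)" "p \<notin> D i \<Longrightarrow> w i p = 0"
    "p \<in> D i \<Longrightarrow> w i p $ k $ l = - (w i p $ l $ k)"
    "p \<in> D i \<inter> D j \<Longrightarrow> w i p $ k $ l =
        (\<Sum>r\<in>UNIV. \<Sum>s\<in>UNIV. (jac M i j p $ r $ k * jac M i j p $ s $ l) *\<^sub>R w j p $ r $ s)"
  using assms unfolding two_forms_def by blast+

lemma two_form_transpose:
  fixes w :: "'i \<Rightarrow> 'a \<Rightarrow> real^4^4"
  assumes "w \<in> two_forms M"
  shows "transpose (w i p) = - w i p"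
proof (cases "p \<in> D i")
  case True
  show ?thesis
    unfolding vec_eq_iff transpose_def by (simp, intro allI, rule two_formsD(3)[OF assms True])
next
  case False
  then show ?thesis using two_formsD(2)[OF assms] by (simp add: transpose_def vec_eq_iff)
qed

lemma two_form_congruence:
  fixes w :: "'i \<Rightarrow> 'a \<Rightarrow> real^4^4"
  assumes "w \<in> two_forms M" "p \<in> D i \<inter> D j"
  shows "w i p = transpose (jac M i j p) ** w j p ** jac M i j p"
  unfolding vec_eq_iff congruence_nth using two_formsD(4)[OF assms] by simp

lemma two_form_nth_smooth:
  assumes "w \<in> two_forms M"
  shows "smooth_in M i (D i) (\<lambda>p. w i p $ k $ l)"
  using two_formsD(1)[OF assms, of i]
  by (simp add: smooth_in_vec_eq[OF D_open order_refl])

lemma metric_nth_smooth: "smooth_in M i (D i) (\<lambda>p. mmetric M i p $ k $ l)"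
  using metric_smooth[of i] by (simp add: smooth_in_vec_eq[OF D_open order_refl])

lemma det_metric_pos: "p \<in> D i \<Longrightarrow> det (mmetric M i p) > 0"
  using spd_frame[OF metric_spd] by metis

lemma sd_part_smooth:
  assumes "w \<in> two_forms M"
  shows "smooth_in M i (D i) (\<lambda>p. sd_part (mmetric M i p) (w i p) $ k $ l :: real)"
proof -
  let ?g = "in_coords M i (mmetric M i)"
  have pos: "det (?g x) > 0" if "x \<in> chart_img M i" for x
    using that by (auto simp: in_coords_chart det_metric_pos)
  have gs: "smooth_on (chart_img M i) (\<lambda>x. ?g x $ k $ l)" for k l
    using metric_nth_smooth[of i] by (simp add: smooth_in_def in_coords_def)
  have "smooth_on (chart_img M i) (\<lambda>x. sqrt (det (?g x)))"
    by (intro smooth_on_sqrt smooth_on_det img_open pos gs)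
  then have s: "smooth_in M i (D i) (\<lambda>p. sqrt (det (mmetric M i p)))"
    by (simp add: smooth_in_def in_coords_def)
  have "smooth_on (chart_img M i) (\<lambda>x. matrix_inv (?g x) $ m $ r)" for m r
    by (intro smooth_on_matrix_inv img_open pos gs)
  then have h: "smooth_in M i (D i) (\<lambda>p. matrix_inv (mmetric M i p) $ m $ r)" for m r
    by (simp add: smooth_in_def in_coords_def)
  note DD = D_open order_refl
  have "smooth_in M i (D i) (\<lambda>p. 1/2 * (w i p $ k $ l + hodge2 (mmetric M i p) (w i p) $ k $ l))"
    unfolding hodge2_def
    by (simp only: vec_lambda_beta real_scaleR_def, intro smooth_in_mult[OF DD] smooth_in_add[OF DD] smooth_in_sum[OF DD] smooth_in_const s h
        two_form_nth_smooth assms)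
  then show ?thesis by (simp add: sd_part_def)
qed

text \<open>Supplies the direction in which perturbations are moved away from those admitting
  solutions. The transformation law is \<open>hodge2_congruence\<close>, so it rests on the
  transition maps preserving orientation.\<close>

lemma imag_sd_part_form:
  fixes w :: "'i \<Rightarrow> 'a \<Rightarrow> real^4^4"
  assumes "w \<in> two_forms M"
  shows "(\<lambda>i p. imag_form (sd_part (mmetric M i p) (w i p))) \<in> imaginary_sd_forms M"
proof -
  note DD = D_open order_refl
  have lin: "linear (\<lambda>x. \<i> * complex_of_real x)"
    by (intro linearI) (simp_all add: algebra_simps scaleR_conv_of_real)
  have bl: "bounded_linear (\<lambda>x. \<i> * complex_of_real x)"
    by (rule bounded_linear_compose[OF bounded_linear_mult_right bounded_linear_of_real])
  let ?s = "\<lambda>i p. sd_part (mmetric M i p) (w i p)"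
  have out: "?s i p = 0" if "p \<notin> D i" for i p
    using two_formsD(2)[OF assms that] by (simp add: sd_part_def hodge2_def vec_eq_iff)
  have anti: "?s i p $ k $ l = - (?s i p $ l $ k)" if "p \<in> D i" for i p k l
    using arg_cong[OF sd_part_real(2)[OF metric_spd[OF that] two_form_transpose[OF assms, of i p]], of "\<lambda>m. m $ l $ k"]
    by (simp add: transpose_def)
  have cov: "?s i p = transpose (jac M i j p) ** ?s j p ** jac M i j p" if "p \<in> D i \<inter> D j" for i j p
  proof -
    let ?J = "jac M i j p"
    have h: "hodge2 (mmetric M i p) (w i p) = transpose ?J ** hodge2 (mmetric M j p) (w j p) ** ?J"
      unfolding metric_cov[OF that] two_form_congruence[OF assms that]
      using that by (intro hodge2_congruence metric_spd det_jac_pos) auto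
    have "?s i p = (1/2) *\<^sub>R (transpose ?J ** w j p ** ?J + transpose ?J ** hodge2 (mmetric M j p) (w j p) ** ?J)"
      unfolding sd_part_def by (subst h) (simp only: two_form_congruence[OF assms that])
    then show ?thesis by (simp only: sd_part_def matrix_mul_linear)
  qed
  have "(\<lambda>i p. imag_form (?s i p)) \<in> two_forms M"
    unfolding two_forms_def
  proof (intro CollectI conjI allI impI ballI)
    show "smooth_in M i (D i) (\<lambda>p. imag_form (?s i p))" for i
      unfolding smooth_in_vec_eq[OF DD] imag_form_def
      by (simp only: vec_lambda_beta) (intro allI smooth_in_bounded_linear[OF DD bl] sd_part_smooth assms)
    show "imag_form (?s i p) = 0" if "p \<notin> D i" for i p
      using out[OF that] by (simp add: imag_form_def vec_eq_iff)
    show "imag_form (?s i p) $ k $ l = - (imag_form (?s i p) $ l $ k)" if "p \<in> D i" for i p k l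
      using anti[OF that, of k l] by (simp add: imag_form_def)
    show "imag_form (?s i p) $ k $ l = (\<Sum>r\<in>UNIV. \<Sum>s\<in>UNIV.
        (jac M i j p $ r $ k * jac M i j p $ s $ l) *\<^sub>R imag_form (?s j p) $ r $ s)"
      if "p \<in> D i \<inter> D j" for i j p k l
      using arg_cong[OF cov[OF that], of "\<lambda>m. m $ k $ l"]
      by (simp add: congruence_nth imag_form_def sum_distrib_left scaleR_conv_of_real ac_simps)
  qed
  moreover have "hodge2 (mmetric M i p) (imag_form (?s i p)) = imag_form (?s i p)" if "p \<in> D i" for i p
    using sd_part_real(1)[OF metric_spd[OF that] two_form_transpose[OF assms, of i p]]
    by (simp add: imag_form_def hodge2_linear[OF lin])
  ultimately show ?thesis by (auto simp: imaginary_sd_forms_def imag_form_def)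
qed

section \<open>The exterior derivative of one-forms\<close>

lemma one_form_nth_smooth: "one_form M b \<Longrightarrow> smooth_in M i (D i) (\<lambda>p. b i p $ k)"
  using smooth_in_vec_eq[OF D_open order_refl] by (auto simp: one_form_def)

text \<open>Differentiating the transformation law of \<open>b\<close> gives the expected term and a
  term with a derivative of the Jacobian. The latter is symmetric in \<open>k\<close> and
  \<open>l\<close> and drops out of the antisymmetrisation.\<close>

lemma ext_d_transform:
  assumes b: "one_form M b" and p: "p \<in> D i \<inter> D j"
  shows "ext_d M b i p $ k $ l = (\<Sum>r\<in>UNIV. \<Sum>s\<in>UNIV.
    (jac M i j p $ r $ k * jac M i j p $ s $ l) * ext_d M b j p $ r $ s)"
proof -
  let ?J = "jac M i j p"
  have sb: "smooth_in M i (D i \<inter> D j) (\<lambda>q. b j q $ r)" for r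
    by (rule change_chart(1)[OF D2_open order_refl])
      (rule smooth_in_mono[OF D2_open _ order_refl one_form_nth_smooth[OF b]], auto)
  have pj: "partial M i k (\<lambda>q. b j q $ r) p = (\<Sum>s\<in>UNIV. ?J $ s $ k * partial M j s (\<lambda>q. b j q $ r) p)" for k r
    using change_chart(2)[OF D2_open order_refl _ p, of "\<lambda>q. b j q $ r"]
      smooth_in_mono[OF D2_open Int_lower2 order_refl one_form_nth_smooth[OF b]] by simp
  have e: "partial M i k (\<lambda>q. b i q $ l) p = (\<Sum>r\<in>UNIV. partial M i k (\<lambda>q. jac M i j q $ r $ l) p * b j p $ r)
      + (\<Sum>r\<in>UNIV. \<Sum>s\<in>UNIV. ?J $ r $ k * ?J $ s $ l * partial M j r (\<lambda>q. b j q $ s) p)" for k l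
  proof -
    have "partial M i k (\<lambda>q. b i q $ l) p = partial M i k (\<lambda>q. \<Sum>r\<in>UNIV. jac M i j q $ r $ l * b j q $ r) p"
      using b by (intro partial_cong[OF D2_open _ p]) (auto simp: one_form_def)
    also have "\<dots> = (\<Sum>r\<in>UNIV. partial M i k (\<lambda>q. jac M i j q $ r $ l * b j q $ r) p)"
      by (rule partial_sum[OF D2_open _ _ p]) (auto intro: smooth_in_mult[OF D2_open] jac_smooth sb)
    also have "\<dots> = (\<Sum>r\<in>UNIV. ?J $ r $ l * partial M i k (\<lambda>q. b j q $ r) p
        + partial M i k (\<lambda>q. jac M i j q $ r $ l) p * b j p $ r)"
      by (intro sum.cong refl partial_mult[OF D2_open _ jac_smooth sb p]) auto
    also have "\<dots> = (\<Sum>r\<in>UNIV. ?J $ r $ l * (\<Sum>s\<in>UNIV. ?J $ s $ k * partial M j s (\<lambda>q. b j q $ r) p)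
        + partial M i k (\<lambda>q. jac M i j q $ r $ l) p * b j p $ r)"
      by (simp only: pj)
    finally have "partial M i k (\<lambda>q. b i q $ l) p = (\<Sum>r\<in>UNIV. partial M i k (\<lambda>q. jac M i j q $ r $ l) p * b j p $ r)
      + (\<Sum>s\<in>UNIV. \<Sum>r\<in>UNIV. ?J $ r $ k * ?J $ s $ l * partial M j r (\<lambda>q. b j q $ s) p)"
      by (simp add: sum.distrib sum_distrib_left ac_simps)
    also have "(\<Sum>s\<in>UNIV. \<Sum>r\<in>UNIV. ?J $ r $ k * ?J $ s $ l * partial M j r (\<lambda>q. b j q $ s) p)
        = (\<Sum>r\<in>UNIV. \<Sum>s\<in>UNIV. ?J $ r $ k * ?J $ s $ l * partial M j r (\<lambda>q. b j q $ s) p)"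
      by (rule sum.swap)
    finally show ?thesis .
  qed
  have "ext_d M b i p $ k $ l = partial M i k (\<lambda>q. b i q $ l) p - partial M i l (\<lambda>q. b i q $ k) p"
    using p by (simp add: ext_d_def)
  also have "\<dots> = (\<Sum>r\<in>UNIV. \<Sum>s\<in>UNIV. ?J $ r $ k * ?J $ s $ l * partial M j r (\<lambda>q. b j q $ s) p)
      - (\<Sum>r\<in>UNIV. \<Sum>s\<in>UNIV. ?J $ r $ l * ?J $ s $ k * partial M j r (\<lambda>q. b j q $ s) p)"
    unfolding e[of k l] e[of l k] partial_jac_commute[OF p, of k _ l] by simp
  also have "(\<Sum>r\<in>UNIV. \<Sum>s\<in>UNIV. ?J $ r $ l * ?J $ s $ k * partial M j r (\<lambda>q. b j q $ s) p)
      = (\<Sum>r\<in>UNIV. \<Sum>s\<in>UNIV. ?J $ r $ k * ?J $ s $ l * partial M j s (\<lambda>q. b j q $ r) p)"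
    by (subst sum.swap) (simp add: ac_simps)
  finally show ?thesis
    using p by (simp add: ext_d_def sum_subtractf right_diff_distrib)
qed

lemma ext_d_closed:
  assumes b: "one_form M b"
  shows "ext_d M b \<in> closed_two_forms M"
proof -
  note DD = D_open order_refl
  have ed: "ext_d M b i p $ k $ l = partial M i k (\<lambda>q. b i q $ l) p - partial M i l (\<lambda>q. b i q $ k) p"
    if "p \<in> D i" for i p k l
    using that by (simp add: ext_d_def)
  have sp: "smooth_in M i (D i) (partial M i k (\<lambda>q. b i q $ l))" for i k l
    by (rule smooth_in_partial[OF DD one_form_nth_smooth[OF b]])
  have "smooth_in M i (D i) (\<lambda>p. ext_d M b i p $ k $ l)" for i k l
    using smooth_in_diff[OF DD sp sp] smooth_in_cong[OF DD ed] by auto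
  then have sm: "smooth_in M i (D i) (ext_d M b i)" for i
    by (simp add: smooth_in_vec_eq[OF DD])
  have "ext_d M b \<in> two_forms M"
    unfolding two_forms_def
  proof (intro CollectI conjI allI impI ballI)
    show "smooth_in M i (D i) (ext_d M b i)" for i by (rule sm)
    show "ext_d M b i p = 0" if "p \<notin> D i" for i p using that by (simp add: ext_d_def)
    show "ext_d M b i p $ k $ l = - (ext_d M b i p $ l $ k)" if "p \<in> D i" for i p k l
      by (simp add: ed[OF that])
    show "ext_d M b i p $ k $ l = (\<Sum>r\<in>UNIV. \<Sum>s\<in>UNIV.
        (jac M i j p $ r $ k * jac M i j p $ s $ l) *\<^sub>R ext_d M b j p $ r $ s)"
      if "p \<in> D i \<inter> D j" for i j p k l
      using ext_d_transform[OF b that] by simp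
  qed
  moreover have "partial M i k (\<lambda>q. ext_d M b i q $ l $ m) p + partial M i l (\<lambda>q. ext_d M b i q $ m $ k) p
       + partial M i m (\<lambda>q. ext_d M b i q $ k $ l) p = 0" if p: "p \<in> D i" for i p k l m
  proof -
    have "partial M i k (\<lambda>q. ext_d M b i q $ l $ m) p
        = partial M i k (partial M i l (\<lambda>q. b i q $ m)) p - partial M i k (partial M i m (\<lambda>q. b i q $ l)) p" for k l m
      using partial_cong[OF DD p ed] partial_diff[OF DD sp sp p] by simp
    then show ?thesis
      using partial_commute[OF DD one_form_nth_smooth[OF b] p, of k l m]
        partial_commute[OF DD one_form_nth_smooth[OF b] p, of l m k]
        partial_commute[OF DD one_form_nth_smooth[OF b] p, of m k l] by simp
  qed
  ultimately show ?thesis by (simp add: closed_two_forms_def)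
qed

end

section \<open>Partitions of unity\<close>

text \<open>Splitting off the constant coefficient of \<open>p\<close> raises the power of
  \<open>s\<close> by one, which is why \<open>k\<close> is arbitrary.\<close>

lemma poly_exp_tendsto_0: "((\<lambda>s::real. s ^ k * poly p s * exp (- s)) \<longlongrightarrow> 0) at_top"
proof (induction p arbitrary: k)
  case (pCons a p)
  have "((\<lambda>s::real. a * (s ^ k / exp s)) \<longlongrightarrow> a * 0) at_top"
    by (intro tendsto_mult tendsto_const tendsto_power_div_exp_0)
  from tendsto_add[OF this pCons.IH[of "Suc k"]] show ?case
    by (simp add: algebra_simps exp_minus divide_inverse)
qed simp

text \<open>\<open>flat_deriv n\<close> is the \<open>n\<close>-th derivative of the function equal to \<open>exp (- 1 / t)\<close> for \<open>t > 0\<close>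
  and to \<open>0\<close> elsewhere.\<close>

primrec flat_poly :: "nat \<Rightarrow> real poly" where
  "flat_poly 0 = 1"
| "flat_poly (Suc n) = [:0, 0, 1:] * (flat_poly n - pderiv (flat_poly n))"

definition flat_deriv :: "nat \<Rightarrow> real \<Rightarrow> real" where
  "flat_deriv n t = (if t \<le> 0 then 0 else poly (flat_poly n) (inverse t) * exp (- inverse t))"

text \<open>For \<open>t > 0\<close>, differentiating p(1/t) exp(-1/t) gives (1/t)^2 (p - p')(1/t)
  exp(-1/t), which is the recursion of \<open>flat_poly\<close>. At 0 the exponential outweighs
  every polynomial in 1/t.\<close>

lemma flat_deriv_derivative: "(flat_deriv n has_real_derivative flat_deriv (Suc n) t) (at t)"
proof -
  consider "t < 0" | "t > 0" | "t = 0" by linarith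
  then show ?thesis
  proof cases
    case 1
    have "((\<lambda>t. 0) has_real_derivative flat_deriv (Suc n) t) (at t)"
      using 1 by (simp add: flat_deriv_def)
    then show ?thesis
      by (rule has_field_derivative_transform_within_open[of _ _ _ "{..<0}"])
        (use 1 in \<open>auto simp: flat_deriv_def\<close>)
  next
    case 2
    have "((\<lambda>t. poly (flat_poly n) (inverse t) * exp (- inverse t)) has_real_derivative flat_deriv (Suc n) t) (at t)"
      using 2 by (auto intro!: derivative_eq_intros DERIV_chain2[OF poly_DERIV]
          simp: flat_deriv_def algebra_simps power2_eq_square)
    then show ?thesis
      by (rule has_field_derivative_transform_within_open[of _ _ _ "{0<..}"])
        (use 2 in \<open>auto simp: flat_deriv_def\<close>)
  next
    case 3
    \<comment> \<open>The factor \<open>s ^ 1\<close> is the 1/t of the difference quotient at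
      0.\<close>
    have "((\<lambda>s. s ^ 1 * poly (flat_poly n) s * exp (- s)) \<longlongrightarrow> 0) at_top"
      by (rule poly_exp_tendsto_0)
    from filterlim_compose[OF this filterlim_inverse_at_top_right]
    have "((\<lambda>t. inverse t ^ 1 * poly (flat_poly n) (inverse t) * exp (- inverse t)) \<longlongrightarrow> 0) (at_right 0)" .
    then have r: "((\<lambda>t. flat_deriv n t / t) \<longlongrightarrow> 0) (at_right 0)"
      by (rule Lim_transform_eventually)
        (auto simp: eventually_at_right_field flat_deriv_def divide_inverse intro!: exI[of _ 1])
    have "((\<lambda>t. 0) \<longlongrightarrow> (0::real)) (at_left 0)" by simp
    then have l: "((\<lambda>t. flat_deriv n t / t) \<longlongrightarrow> 0) (at_left 0)"
      by (rule Lim_transform_eventually)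
        (auto simp: eventually_at_left_field flat_deriv_def intro!: exI[of _ "-1"])
    have "((\<lambda>t. flat_deriv n t / t) \<longlongrightarrow> 0) (at 0)"
      using filterlim_split_at[OF l r] .
    then show ?thesis
      using 3 by (simp add: has_field_derivative_iff flat_deriv_def)
  qed
qed

text \<open>The flat function is applied to the squared radius minus the squared distance from
  \<open>x0\<close>, which is positive exactly inside the ball. Squares avoid the norm, which is not
  smooth at the centre.\<close>

lemma smooth_bump:
  fixes x0 :: "real^'m"
  assumes "r > 0"
  shows "\<exists>u :: real^'m \<Rightarrow> real. smooth_on UNIV u \<and> (\<forall>x. u x \<ge> 0) \<and> (\<forall>x. u x \<noteq> 0 \<longleftrightarrow> x \<in> ball x0 r)"
proof -
  define u :: "real^'m \<Rightarrow> real" where "u x = flat_deriv 0 (r\<^sup>2 - (x - x0) \<bullet> (x - x0))" for x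
  have g: "smooth_on UNIV (\<lambda>x. r\<^sup>2 - (x - x0) \<bullet> (x - x0))"
    by (intro smooth_on_diff smooth_on_const smooth_on_bilinear[OF _ bounded_bilinear_inner] smooth_on_id open_UNIV)
  have 1: "smooth_on UNIV u"
    unfolding u_def
    by (rule smooth_on_real_family[where h = flat_deriv and T = UNIV, OF open_UNIV _ g flat_deriv_derivative]) simp
  have 2: "u x \<ge> 0" for x by (simp add: u_def flat_deriv_def)
  have 3: "u x \<noteq> 0 \<longleftrightarrow> x \<in> ball x0 r" for x
  proof -
    have "u x \<noteq> 0 \<longleftrightarrow> (norm (x - x0))\<^sup>2 < r\<^sup>2"
      by (simp add: u_def flat_deriv_def power2_norm_eq_inner not_le)
    also have "\<dots> \<longleftrightarrow> norm (x - x0) < r"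
      using assms power_mono_iff[of r "norm (x - x0)" 2] by (simp add: not_le[symmetric])
    finally show ?thesis by (simp add: dist_norm norm_minus_commute)
  qed
  show ?thesis using 1 2 3 by (intro exI[of _ u]) simp
qed

context manifold4
begin

lemma compact_closed: "compactin (mtop M) K \<Longrightarrow> closedin (mtop M) K"
  by (rule compactin_imp_closedin[OF Hausdorff])

text \<open>A Euclidean bump on a ball whose closed ball lies in the chart image is extended by
  zero. The extension is smooth because the compact set \<open>K\<close> is closed in the Hausdorff
  space, so that \<open>D i\<close> and the complement of \<open>K\<close> are an open
  cover.\<close>

lemma manifold_bump:
  assumes "p \<in> D i"
  shows "\<exists>\<beta> V K. openin (mtop M) V \<and> p \<in> V \<and> compactin (mtop M) K \<and> K \<subseteq> D i
    \<and> (\<forall>j. smooth_in M j (D j) \<beta>) \<and> (\<forall>q. \<beta> q \<ge> (0::real)) \<and> (\<forall>q\<in>V. \<beta> q > 0) \<and> (\<forall>q. q \<notin> K \<longrightarrow> \<beta> q = 0)"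
proof -
  obtain r where r: "r > 0" "cball (\<phi> i p) r \<subseteq> chart_img M i"
    using img_open[of i] assms unfolding open_contains_cball by blast
  obtain u :: "real^4 \<Rightarrow> real" where u: "smooth_on UNIV u" "\<forall>x. u x \<ge> 0" "\<forall>x. u x \<noteq> 0 \<longleftrightarrow> x \<in> ball (\<phi> i p) r"
    using smooth_bump[OF r(1), of "\<phi> i p"] by blast
  define \<beta> where "\<beta> q = (if q \<in> D i then u (\<phi> i q) else 0)" for q
  define V where "V = {q \<in> D i. \<phi> i q \<in> ball (\<phi> i p) r}"
  define K where "K = {q \<in> D i. \<phi> i q \<in> cball (\<phi> i p) r}"
  have V: "openin (mtop M) V" unfolding V_def by (rule openin_preimage) simp
  have K: "compactin (mtop M) K" unfolding K_def by (rule compactin_preimage) (simp_all add: r)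
  have out: "\<beta> q = 0" if "q \<notin> K" for q
    using that u(3)[rule_format, of "\<phi> i q"] by (auto simp: \<beta>_def K_def)
  have "smooth_on (chart_img M i) u" using smooth_on_mono[OF u(1) img_open] by simp
  moreover have "smooth_on (chart_img M i) (in_coords M i \<beta>) = smooth_on (chart_img M i) u"
    by (rule smooth_on_cong[OF img_open]) (auto simp: in_coords_chart \<beta>_def)
  ultimately have si: "smooth_in M i (D i) \<beta>" by (simp add: smooth_in_def)
  have "smooth_in M j (D j) \<beta>" for j
  proof (rule smooth_in_local[OF D_open order_refl])
    fix q assume q: "q \<in> D j"
    show "\<exists>V. openin (mtop M) V \<and> q \<in> V \<and> V \<subseteq> D j \<and> smooth_in M j V \<beta>"
    proof (cases "q \<in> D i")
      case True
      have "smooth_in M j (D j \<inter> D i) \<beta>"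
        by (rule change_chart(1)[OF D2_open order_refl])
          (rule smooth_in_mono[OF D2_open Int_lower2 order_refl si])
      then show ?thesis using D2_open[of j i] q True by (intro exI[of _ "D j \<inter> D i"]) auto
    next
      case False
      have o: "openin (mtop M) (D j - K)" using D_open compact_closed[OF K] by (rule openin_diff)
      have "smooth_in M j (D j - K) \<beta> = smooth_in M j (D j - K) (\<lambda>q. 0::real)"
        by (rule smooth_in_cong[OF o]) (auto simp: out)
      then have "smooth_in M j (D j - K) \<beta>" by (simp add: smooth_in_const)
      then show ?thesis using o q False by (intro exI[of _ "D j - K"]) (auto simp: K_def)
    qed
  qed
  moreover have "\<beta> q > 0" if "q \<in> V" for q
    using that u(2)[rule_format, of "\<phi> i q"] u(3)[rule_format, of "\<phi> i q"] by (auto simp: V_def \<beta>_def less_le)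
  moreover have "\<beta> q \<ge> 0" for q using u(2) by (simp add: \<beta>_def)
  moreover have "p \<in> V" using assms r by (simp add: V_def)
  moreover have "K \<subseteq> D i" by (auto simp: K_def)
  ultimately show ?thesis using V K out by (intro exI[of _ \<beta>] exI[of _ V] exI[of _ K]) simp
qed

text \<open>\<open>integral4\<close> selects a partition of unity with \<open>SOME\<close>, so its
  properties are available only once one exists. By compactness finitely many bumps suffice; they
  are divided by their sum, which is positive everywhere.\<close>

lemma partition_of_unity_exists: "\<exists>rho. partition_of_unity M rho"
proof -
  let ?X = "topspace (mtop M)"
  have "\<forall>p\<in>?X. \<exists>i \<beta> V K. openin (mtop M) V \<and> p \<in> V \<and> compactin (mtop M) K \<and> K \<subseteq> D i
    \<and> (\<forall>j. smooth_in M j (D j) \<beta>) \<and> (\<forall>q. \<beta> q \<ge> (0::real)) \<and> (\<forall>q\<in>V. \<beta> q > 0) \<and> (\<forall>q. q \<notin> K \<longrightarrow> \<beta> q = 0)"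
  proof
    fix p assume "p \<in> ?X"
    then obtain i where "p \<in> D i" using D_cover by blast
    then show "\<exists>i \<beta> V K. openin (mtop M) V \<and> p \<in> V \<and> compactin (mtop M) K \<and> K \<subseteq> D i
    \<and> (\<forall>j. smooth_in M j (D j) \<beta>) \<and> (\<forall>q. \<beta> q \<ge> (0::real)) \<and> (\<forall>q\<in>V. \<beta> q > 0) \<and> (\<forall>q. q \<notin> K \<longrightarrow> \<beta> q = 0)"
      by (intro exI[of _ i] manifold_bump)
  qed
  then obtain c \<beta> V K where B: "\<forall>p\<in>?X. openin (mtop M) (V p) \<and> p \<in> V p \<and> compactin (mtop M) (K p) \<and> K p \<subseteq> D (c p)
    \<and> (\<forall>j. smooth_in M j (D j) (\<beta> p)) \<and> (\<forall>q. \<beta> p q \<ge> (0::real)) \<and> (\<forall>q\<in>V p. \<beta> p q > 0) \<and> (\<forall>q. q \<notin> K p \<longrightarrow> \<beta> p q = 0)"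
    by metis
  have "compactin (mtop M) ?X" using compact by (simp add: compact_space_def)
  moreover have "\<forall>U\<in>V ` ?X. openin (mtop M) U" "?X \<subseteq> \<Union> (V ` ?X)" using B by auto
  ultimately obtain \<F> where "finite \<F>" "\<F> \<subseteq> V ` ?X" "?X \<subseteq> \<Union>\<F>"
    unfolding compactin_def by (metis (no_types, lifting))
  then obtain F where F: "finite F" "F \<subseteq> ?X" "?X \<subseteq> \<Union> (V ` F)"
    by (metis finite_subset_image)
  define S where "S q = (\<Sum>p\<in>F. \<beta> p q)" for q
  have Spos: "S q > 0" if "q \<in> ?X" for q
  proof -
    obtain p where "p \<in> F" "q \<in> V p" using F(3) \<open>q \<in> ?X\<close> by blast
    then show ?thesis unfolding S_def using F(1,2) B by (intro sum_pos2[of _ p]) auto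
  qed
  \<comment> \<open>The partition is indexed by charts, so bumps living in the same chart are added
    up.\<close>
  define rho where "rho i q = (if q \<in> ?X then (\<Sum>p\<in>{p\<in>F. c p = i}. \<beta> p q) * inverse (S q) else 0)" for i q
  have "smooth_in M j (D j) (rho i)" for i j
  proof -
    note DD = D_open order_refl
    have b: "smooth_in M j (D j) (\<beta> p)" if "p \<in> F" for p using that F(2) B by blast
    have "smooth_in M j (D j) (\<lambda>q. (\<Sum>p\<in>{p\<in>F. c p = i}. \<beta> p q) * inverse (S q))"
      using D_sub Spos unfolding S_def
      by (intro smooth_in_mult[OF DD] smooth_in_inverse[OF DD] smooth_in_sum[OF DD] b) auto
    moreover have "smooth_in M j (D j) (rho i)
        = smooth_in M j (D j) (\<lambda>q. (\<Sum>p\<in>{p\<in>F. c p = i}. \<beta> p q) * inverse (S q))"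
      by (rule smooth_in_cong[OF DD]) (simp add: rho_def subsetD[OF D_sub])
    ultimately show ?thesis by simp
  qed
  moreover have "rho i q \<ge> 0" if "q \<in> ?X" for i q
    unfolding rho_def using Spos[OF that] that B F(2)
    by (auto intro!: mult_nonneg_nonneg sum_nonneg)
  moreover have "mtop M closure_of {q \<in> ?X. rho i q \<noteq> 0} \<subseteq> D i" for i
  proof -
    define C where "C = (\<Union>p\<in>{p\<in>F. c p = i}. K p)"
    have "closedin (mtop M) C"
      unfolding C_def using F B by (intro closedin_Union) (auto intro: compact_closed)
    moreover have "{q \<in> ?X. rho i q \<noteq> 0} \<subseteq> C"
    proof
      fix q assume q: "q \<in> {q \<in> ?X. rho i q \<noteq> 0}"
      then have "(\<Sum>p\<in>{p\<in>F. c p = i}. \<beta> p q) \<noteq> 0" by (auto simp: rho_def)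
      then obtain p where "p \<in> {p\<in>F. c p = i}" "\<beta> p q \<noteq> 0" by (meson sum.not_neutral_contains_not_neutral)
      then show "q \<in> C" unfolding C_def using B F(2) by blast
    qed
    ultimately have "mtop M closure_of {q \<in> ?X. rho i q \<noteq> 0} \<subseteq> C" by (metis closure_of_minimal)
    also have "C \<subseteq> D i" unfolding C_def using B F(2) by blast
    finally show ?thesis .
  qed
  moreover have sub: "{i. \<exists>q\<in>?X. rho i q \<noteq> 0} \<subseteq> c ` F"
  proof
    fix i assume "i \<in> {i. \<exists>q\<in>?X. rho i q \<noteq> 0}"
    then obtain q where "(\<Sum>p\<in>{p\<in>F. c p = i}. \<beta> p q) \<noteq> 0" by (auto simp: rho_def)
    then obtain p where "p \<in> {p\<in>F. c p = i}" by (meson sum.not_neutral_contains_not_neutral)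
    then show "i \<in> c ` F" by blast
  qed
  moreover have "finite {i. \<exists>q\<in>?X. rho i q \<noteq> 0}"
    using sub F(1) finite_subset by blast
  moreover have "(\<Sum>i | rho i q \<noteq> 0. rho i q) = 1" if "q \<in> ?X" for q
  proof -
    have "(\<Sum>i | rho i q \<noteq> 0. rho i q) = (\<Sum>i\<in>c ` F. rho i q)"
      using sub that F(1) by (intro sum.mono_neutral_left) auto
    also have "\<dots> = (\<Sum>i\<in>c ` F. \<Sum>p\<in>{p\<in>F. c p = i}. \<beta> p q) * inverse (S q)"
      using that by (simp add: rho_def sum_distrib_right)
    also have "(\<Sum>i\<in>c ` F. \<Sum>p\<in>{p\<in>F. c p = i}. \<beta> p q) = S q"
      unfolding S_def using sum.image_gen[OF F(1), of "\<lambda>p. \<beta> p q" c] by simp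
    finally show ?thesis using Spos[OF that] by simp
  qed
  ultimately have "partition_of_unity M rho" by (simp add: partition_of_unity_def)
  then show ?thesis by blast
qed

end

section \<open>Integration and Stokes' theorem\<close>

text \<open>By translation invariance, the integral of \<open>u (x + t *\<^sub>R e\<^sub>k)\<close> over \<open>x\<close> does not depend on \<open>t\<close>.\<close>

lemma integral_pd_compact_support:
  fixes u :: "real^'m \<Rightarrow> real"
  assumes u: "smooth_on UNIV u" and K: "compact K" "\<And>x. x \<notin> K \<Longrightarrow> u x = 0"
  shows "integral UNIV (pd k u) = 0"
proof -
  define e :: "real^'m" where "e = axis k 1"
  have ne: "norm e = 1" by (simp add: e_def)
  obtain R where R: "\<And>x. x \<in> K \<Longrightarrow> norm x \<le> R"
    using compact_imp_bounded[OF K(1)] by (auto simp: bounded_iff)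
  \<comment> \<open>The radius \<open>R + 1\<close> leaves room for all translates of the support by
    at most 1, so the integral over the box misses nothing of them.\<close>
  obtain d :: "real^'m" where d: "cball 0 (R + 1) \<subseteq> cbox (- d) d"
    using bounded_subset_cbox_symmetric[OF bounded_cball] by blast
  define I where "I = integral (cbox (- d) d) u"
  have cu: "continuous_on S u" for S
    using smooth_on_continuous[OF u] continuous_on_subset by blast
  have cp: "continuous_on S (pd k u)" for S
    using smooth_on_continuous[OF smooth_on_pd[OF u]] continuous_on_subset by blast
  have Kd: "x \<in> cbox (- d) d" if "norm x \<le> R + 1" for x
    using d that by (auto simp: subset_iff)
  have const: "integral (cbox (- d) d) (\<lambda>x. u (x + t *\<^sub>R e)) = I" if t: "\<bar>t\<bar> \<le> 1" for t
  proof -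
    have "(u has_integral I) (cbox (- d) d)"
      unfolding I_def by (intro integrable_integral integrable_continuous cu)
    from has_integral_affinity'[OF this, of 1 "t *\<^sub>R e"]
    have "((\<lambda>x. u (x + t *\<^sub>R e)) has_integral I) (cbox (- d - t *\<^sub>R e) (d - t *\<^sub>R e))" by simp
    then have int: "((\<lambda>x. u (x + t *\<^sub>R e)) has_integral I) UNIV"
    proof (rule has_integral_on_superset)
      fix x assume x: "x \<notin> cbox (- d - t *\<^sub>R e) (d - t *\<^sub>R e)"
      have "x + t *\<^sub>R e \<notin> cbox (- d) d"
        using x by (simp add: mem_box inner_add_left inner_diff_left algebra_simps)
      then show "u (x + t *\<^sub>R e) = 0"
        using Kd R K(2) by (metis add_increasing2 zero_le_one)
    qed simp
    have eq: "(\<lambda>x. u (x + t *\<^sub>R e)) = (\<lambda>x. if x \<in> cbox (- d) d then u (x + t *\<^sub>R e) else 0)"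
    proof
      fix x
      have "u (x + t *\<^sub>R e) = 0" if "x \<notin> cbox (- d) d"
      proof (rule K(2), rule notI)
        assume "x + t *\<^sub>R e \<in> K"
        then have "norm (x + t *\<^sub>R e) \<le> R" by (rule R)
        moreover have "norm (t *\<^sub>R e) \<le> 1" using t ne by simp
        ultimately have "norm x \<le> R + 1"
          using norm_triangle_ineq4[of "x + t *\<^sub>R e" "t *\<^sub>R e"] by simp
        then show False using Kd that by blast
      qed
      then show "u (x + t *\<^sub>R e) = (if x \<in> cbox (- d) d then u (x + t *\<^sub>R e) else 0)" by simp
    qed
    have "((\<lambda>x. if x \<in> cbox (- d) d then u (x + t *\<^sub>R e) else 0) has_integral I) UNIV"
      unfolding eq[symmetric] by (rule int)
    then show ?thesis by (intro integral_unique) (simp only: has_integral_restrict_UNIV)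
  qed
  have "((\<lambda>t. integral (cbox (- d) d) (\<lambda>x. u (x + t *\<^sub>R e))) has_field_derivative
      integral (cbox (- d) d) (\<lambda>x. pd k u (x + 0 *\<^sub>R e))) (at 0 within {-1<..<1})"
  proof (rule leibniz_rule_field_derivative)
    show "((\<lambda>t. u (x + t *\<^sub>R e)) has_field_derivative pd k u (x + t *\<^sub>R e)) (at t within {-1<..<1})" for t x
      unfolding e_def
      by (rule has_field_derivative_at_within, rule line_derivative)
        (rule smooth_on_differentiable[OF u open_UNIV UNIV_I])
    show "(\<lambda>x. u (x + t *\<^sub>R e)) integrable_on cbox (- d) d" for t
      by (intro integrable_continuous continuous_on_compose2[OF cu] continuous_intros) auto
    show "continuous_on ({-1<..<1} \<times> cbox (- d) d) (\<lambda>(t, x). pd k u (x + t *\<^sub>R e))"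
      unfolding case_prod_beta by (intro continuous_on_compose2[OF cp] continuous_intros) auto
  qed auto
  then have 1: "((\<lambda>t. integral (cbox (- d) d) (\<lambda>x. u (x + t *\<^sub>R e))) has_field_derivative
      integral (cbox (- d) d) (pd k u)) (at 0)"
    by (simp add: at_within_open[of 0 "{-1<..<1}"])
  have 2: "((\<lambda>t. integral (cbox (- d) d) (\<lambda>x. u (x + t *\<^sub>R e))) has_field_derivative 0) (at 0)"
    by (rule has_field_derivative_transform_within_open[of "\<lambda>t. I" _ _ "{-1<..<1}"]) (auto simp: const)
  have "integral (cbox (- d) d) (pd k u) = 0" using DERIV_unique[OF 1 2] .
  then have "(pd k u has_integral 0) (cbox (- d) d)"
    using integrable_integral[OF integrable_continuous[OF cp]] by metis
  then have "(pd k u has_integral 0) UNIV"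
  proof (rule has_integral_on_superset)
    fix x assume "x \<notin> cbox (- d) d"
    then have "x \<in> - K" using Kd R by (metis ComplI add_increasing2 zero_le_one)
    then have "pd k u x = pd k (\<lambda>x. 0) x"
      by (intro pd_cong[of "- K"]) (auto simp: K open_Compl compact_imp_closed)
    then show "pd k u x = 0" by (simp add: pd_const)
  qed simp
  then show ?thesis by (rule integral_unique)
qed

lemma compact_support_integrable:
  fixes u :: "'m::euclidean_space \<Rightarrow> real"
  assumes "continuous_on UNIV u" "compact K" "\<And>x. x \<notin> K \<Longrightarrow> u x = 0"
  shows "u absolutely_integrable_on UNIV"
proof -
  obtain d where d: "K \<subseteq> cbox (- d) d"
    using bounded_subset_cbox_symmetric[OF compact_imp_bounded[OF assms(2)]] by blast
  have "u absolutely_integrable_on cbox (- d) d"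
    using assms(1) by (intro absolutely_integrable_continuous) (rule continuous_on_subset, auto)
  moreover have "(\<lambda>x. if x \<in> cbox (- d) d then u x else 0) = u"
    using d assms(3) by fastforce
  ultimately show ?thesis using absolutely_integrable_restrict_UNIV[of "cbox (- d) d" u] by simp
qed

text \<open>Real values are carried into \<open>real^1\<close>, where the change of variables
  theorem for vector-valued functions applies, and read off again as the single component.\<close>

lemma integral_substitution:
  fixes F :: "real^'m::{finite,wellorder} \<Rightarrow> real" and g :: "real^'m::_ \<Rightarrow> real^'m::_"
  assumes S: "S \<in> sets lebesgue"
    and der_g: "\<And>x. x \<in> S \<Longrightarrow> (g has_derivative g' x) (at x within S)"
    and inj: "inj_on g S"
    and int: "(\<lambda>x. \<bar>det (matrix (g' x))\<bar> * F (g x)) absolutely_integrable_on S"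
  shows "integral (g ` S) F = integral S (\<lambda>x. \<bar>det (matrix (g' x))\<bar> * F (g x))"
proof -
  let ?V = "\<lambda>c. c *\<^sub>R (axis 1 1 :: real^1)"
  have bl: "bounded_linear ?V" by (rule bounded_linear_scaleR_left)
  let ?h = "\<lambda>x. \<bar>det (matrix (g' x))\<bar> * F (g x)"
  have "(?V \<circ> ?h) absolutely_integrable_on S" by (rule absolutely_integrable_linear[OF int bl])
  then have 1: "(\<lambda>x. \<bar>det (matrix (g' x))\<bar> *\<^sub>R ?V (F (g x))) absolutely_integrable_on S"
    by (simp add: o_def)
  have "(\<lambda>x. ?V (F x)) absolutely_integrable_on (g ` S)
      \<longleftrightarrow> (\<lambda>x. \<bar>det (matrix (g' x))\<bar> *\<^sub>R ?V (F (g x))) absolutely_integrable_on S"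
    by (rule absolutely_integrable_change_of_variables[OF S der_g inj])
  with 1 have "(\<lambda>x. ?V (F x)) absolutely_integrable_on (g ` S)" by blast
  from absolutely_integrable_linear[OF this bounded_linear_vec_nth[of 1]]
  have F: "F absolutely_integrable_on (g ` S)" by (simp add: o_def axis_def)
  have "?V (integral (g ` S) F) = integral (g ` S) (?V \<circ> F)"
    by (intro integral_linear[symmetric] bl set_lebesgue_integral_eq_integral(1) F)
  also have "\<dots> = integral S (\<lambda>x. \<bar>det (matrix (g' x))\<bar> *\<^sub>R ?V (F (g x)))"
    using integral_change_of_variables[OF S der_g inj, of "\<lambda>x. ?V (F x)"] 1 by (simp add: o_def)
  also have "\<dots> = integral S (?V \<circ> ?h)" by (simp add: o_def)
  also have "\<dots> = ?V (integral S ?h)"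
    by (intro integral_linear bl set_lebesgue_integral_eq_integral(1) int)
  finally have "?V (integral (g ` S) F) $ 1 = ?V (integral S ?h) $ 1" by (rule arg_cong)
  then show ?thesis by (simp add: axis_def)
qed

section \<open>Integration of functions supported in one chart\<close>

context manifold4
begin

definition cint :: "'i \<Rightarrow> ('a \<Rightarrow> real) \<Rightarrow> real" where
  "cint i f = integral (chart_img M i) (in_coords M i f)"

text \<open>\<open>K\<close> may be larger than the support; as a parameter it lets one compact set
  serve two charts. Values outside the chart domain do not enter integrals over the chart
  image.\<close>

definition supported :: "'i \<Rightarrow> 'a set \<Rightarrow> ('a \<Rightarrow> 'b::zero) \<Rightarrow> bool" where
  "supported i K f \<longleftrightarrow> compactin (mtop M) K \<and> K \<subseteq> D i \<and> (\<forall>p\<in>D i. p \<notin> K \<longrightarrow> f p = 0)"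

text \<open>Reduces integrals over a chart image to integrals over the whole space. The chart image
  and the complement of the compact image of \<open>K\<close> are an open cover, and on each of the
  two the extension is visibly smooth.\<close>

lemma zero_extension:
  fixes f :: "'a \<Rightarrow> real"
  assumes K: "supported i K f" and f: "smooth_in M i (D i) f"
  defines "E \<equiv> \<lambda>x. if x \<in> chart_img M i then in_coords M i f x else 0"
  shows "compact (\<phi> i ` K)" "x \<notin> \<phi> i ` K \<Longrightarrow> E x = 0" "smooth_on UNIV E"
proof -
  show c: "compact (\<phi> i ` K)" using compact_image K by (simp add: supported_def)
  show z: "E x = 0" if "x \<notin> \<phi> i ` K" for x
    using that K by (auto simp: E_def in_coords_chart supported_def)
  have o: "open (- \<phi> i ` K)" using c by (simp add: open_Compl compact_imp_closed)
  show "smooth_on UNIV E"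
  proof (rule smooth_on_local[OF open_UNIV])
    fix x
    show "\<exists>U. open U \<and> x \<in> U \<and> smooth_on U E"
    proof (cases "x \<in> chart_img M i")
      case True
      have "smooth_on (chart_img M i) E = smooth_on (chart_img M i) (in_coords M i f)"
        by (rule smooth_on_cong[OF img_open]) (simp add: E_def)
      then have "smooth_on (chart_img M i) E" using f by (simp add: smooth_in_def)
      then show ?thesis using True img_open by blast
    next
      case False
      have "smooth_on (- \<phi> i ` K) E = smooth_on (- \<phi> i ` K) (\<lambda>x. 0::real)"
        by (rule smooth_on_cong[OF o]) (simp add: z)
      then have "smooth_on (- \<phi> i ` K) E" by (simp add: smooth_on_const)
      moreover have "x \<in> - \<phi> i ` K" using False K by (auto simp: supported_def)
      ultimately show ?thesis using o by blast
    qed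
  qed
qed

lemma cint_absolutely_integrable:
  fixes f :: "'a \<Rightarrow> real"
  assumes "supported i K f" "smooth_in M i (D i) f"
  shows "in_coords M i f absolutely_integrable_on chart_img M i"
  using compact_support_integrable[OF smooth_on_continuous[OF zero_extension(3)[OF assms]]
      zero_extension(1,2)[OF assms]]
  by (simp add: absolutely_integrable_restrict_UNIV)

lemma cint_integrable:
  fixes f :: "'a \<Rightarrow> real"
  assumes "supported i K f" "smooth_in M i (D i) f"
  shows "in_coords M i f integrable_on chart_img M i"
  using cint_absolutely_integrable[OF assms] set_lebesgue_integral_eq_integral(1) by blast

lemma cint_sum:
  assumes "finite I" "\<And>a. a \<in> I \<Longrightarrow> supported i (K a) (f a)" "\<And>a. a \<in> I \<Longrightarrow> smooth_in M i (D i) (f a)"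
  shows "cint i (\<lambda>p. \<Sum>a\<in>I. f a p) = (\<Sum>a\<in>I. cint i (f a))"
  using Henstock_Kurzweil_Integration.integral_sum[OF assms(1) cint_integrable[OF assms(2,3)]]
  by (simp add: cint_def in_coords_def)

lemma cint_cong: "(\<And>p. p \<in> D i \<Longrightarrow> f p = g p) \<Longrightarrow> cint i f = cint i g"
  unfolding cint_def by (rule integral_cong) (auto simp: in_coords_chart)

lemma cint_mult: "cint i (\<lambda>p. c * f p) = c * cint i f"
  by (simp add: cint_def in_coords_def)

lemma cint_diff:
  assumes "supported i K f" "smooth_in M i (D i) f" "supported i L g" "smooth_in M i (D i) g"
  shows "cint i (\<lambda>p. f p - g p) = cint i f - cint i g"
  using integral_diff[OF cint_integrable[OF assms(1,2)] cint_integrable[OF assms(3,4)]]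
  by (simp add: cint_def in_coords_def)

lemma cint_mono:
  assumes "supported i K f" "smooth_in M i (D i) f" "supported i L g" "smooth_in M i (D i) g"
    "\<And>p. p \<in> D i \<Longrightarrow> f p \<le> g p"
  shows "cint i f \<le> cint i g"
  unfolding cint_def
  by (rule integral_le[OF cint_integrable[OF assms(1,2)] cint_integrable[OF assms(3,4)]])
    (auto simp: in_coords_chart assms(5))

lemma partial_outside_support:
  fixes f :: "'a \<Rightarrow> 'b::real_normed_vector"
  assumes "supported i K f" "p \<in> D i" "p \<notin> K"
  shows "partial M i k f p = 0"
proof -
  have o: "openin (mtop M) (D i - K)"
    using assms(1) D_open compact_closed by (auto simp: supported_def)
  have "partial M i k f p = partial M i k (\<lambda>q. 0) p"
    by (rule partial_cong[OF o Diff_subset]) (use assms in \<open>auto simp: supported_def\<close>)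
  then show ?thesis by (simp add: partial_def in_coords_def pd_const)
qed

lemma supported_partial:
  fixes f :: "'a \<Rightarrow> 'b::real_normed_vector"
  shows "supported i K f \<Longrightarrow> supported i K (partial M i k f)"
  using partial_outside_support[of i K f _ k] unfolding supported_def by blast

lemma cint_partial:
  assumes "supported i K f" "smooth_in M i (D i) f"
  shows "cint i (partial M i k f) = 0"
proof -
  define E where "E = (\<lambda>x. if x \<in> chart_img M i then in_coords M i f x else 0)"
  note Z = zero_extension[OF assms, folded E_def]
  have out: "E x = 0" if "x \<notin> \<phi> i ` K" for x
    using zero_extension(2)[OF assms that] by (simp add: E_def)
  have o: "open (- \<phi> i ` K)" using Z(1) by (simp add: open_Compl compact_imp_closed)
  have "pd k E x = (if x \<in> chart_img M i then in_coords M i (partial M i k f) x else 0)" for x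
  proof (cases "x \<in> chart_img M i")
    case True
    have "pd k E x = pd k (in_coords M i f) x"
      by (rule pd_cong[OF img_open True]) (simp add: E_def)
    then show ?thesis using True by (simp add: coords_partial[OF D_open order_refl])
  next
    case False
    then have "x \<in> - \<phi> i ` K" using assms(1) by (auto simp: supported_def)
    then have "pd k E x = pd k (\<lambda>x. 0) x" by (intro pd_cong[OF o]) (auto simp: out)
    then show ?thesis using False by (simp add: pd_const)
  qed
  then have "pd k E = (\<lambda>x. if x \<in> chart_img M i then in_coords M i (partial M i k f) x else 0)" by blast
  then have "integral UNIV (pd k E) = cint i (partial M i k f)"
    by (simp add: cint_def integral_restrict_UNIV)
  then show ?thesis using integral_pd_compact_support[OF Z(3,1) out] by simp
qed

text \<open>\<open>f\<close> and \<open>f'\<close> are coefficients of one four-form in two charts.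
  Since \<open>K\<close> lies in both domains, both integrals live on the overlap, where the
  Jacobian determinant is positive and equals the absolute value in the substitution rule.\<close>

lemma cint_change_chart:
  assumes Ki: "supported i K f" and Kj: "supported j K f'"
    and f': "smooth_in M j (D j) f'"
    and tr: "\<And>p. p \<in> D i \<inter> D j \<Longrightarrow> f' p = det (jac M j i p) * f p"
  shows "cint i f = cint j f'"
proof -
  let ?W = "D j \<inter> D i"
  let ?S = "\<phi> j ` ?W" and ?g = "in_coords M j (\<phi> i)"
  have W: "?W \<subseteq> D j" "?W \<subseteq> D i" by auto
  have oS: "open ?S" by (rule open_image[OF D2_open W(1)])
  have gS: "?g ` ?S = \<phi> i ` ?W" by (force simp: in_coords_chart image_iff)
  have inj_g: "inj_on ?g ?S"
    using inj[of i] by (auto simp: inj_on_def in_coords_chart)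
  have sg: "smooth_on ?S ?g" using transition_smooth by (simp add: smooth_in_def)
  define g' where "g' x = frechet_derivative ?g (at x)" for x
  have der: "(?g has_derivative g' x) (at x within ?S)" if "x \<in> ?S" for x
    using smooth_on_differentiable[OF sg oS that] has_derivative_at_withinI
    unfolding g'_def frechet_derivative_works by blast
  have mat: "matrix (g' (\<phi> j p)) = jac M j i p" for p
    by (simp add: matrix_def g'_def jac_def partial_def pd_def)
  have eq: "\<bar>det (matrix (g' x))\<bar> * in_coords M i f (?g x) = in_coords M j f' x" if x: "x \<in> ?S" for x
  proof -
    obtain p where p: "p \<in> ?W" "x = \<phi> j p" using x by blast
    then have "det (jac M j i p) > 0" using det_jac_pos by blast
    then show ?thesis using p tr[of p] by (simp add: in_coords_chart mat)
  qed
  have inside: "q \<in> D i" if "q \<in> D j" "f' q \<noteq> 0" for q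
    using that Ki Kj unfolding supported_def by blast
  have inside': "q \<in> D j" if "q \<in> D i" "f q \<noteq> 0" for q
    using that Ki Kj unfolding supported_def by blast
  have rj: "integral (chart_img M j) (in_coords M j f') = integral ?S (in_coords M j f')"
    by (rule integral_spike_set; rule negligible_subset[OF negligible_empty])
      (use inside in \<open>auto simp: in_coords_chart\<close>)
  have ri: "integral (chart_img M i) (in_coords M i f) = integral (\<phi> i ` ?W) (in_coords M i f)"
    by (rule integral_spike_set; rule negligible_subset[OF negligible_empty])
      (use inside' in \<open>auto simp: in_coords_chart\<close>)
  have "in_coords M j f' absolutely_integrable_on chart_img M j"
    by (rule cint_absolutely_integrable[OF Kj f'])
  then have "in_coords M j f' absolutely_integrable_on ?S"
    by (rule set_integrable_subset) (use oS in auto)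
  then have int: "(\<lambda>x. \<bar>det (matrix (g' x))\<bar> * in_coords M i f (?g x)) absolutely_integrable_on ?S"
    by (subst set_integrable_cong[OF refl refl eq])
  have "integral (?g ` ?S) (in_coords M i f)
      = integral ?S (\<lambda>x. \<bar>det (matrix (g' x))\<bar> * in_coords M i f (?g x))"
    by (rule integral_substitution[OF _ der inj_g int]) (use oS in auto)
  also have "\<dots> = integral ?S (in_coords M j f')"
    by (rule integral_cong) (rule eq)
  finally show ?thesis unfolding cint_def gS ri rj .
qed

section \<open>The partition of unity that \<open>integral4\<close> selects\<close>

definition rho :: "'i \<Rightarrow> 'a \<Rightarrow> real" where
  "rho = (SOME rho. partition_of_unity M rho)"

definition rho_index :: "'i set" where
  "rho_index = {i. \<exists>p\<in>topspace (mtop M). rho i p \<noteq> 0}"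

definition rho_supp :: "'i \<Rightarrow> 'a set" where
  "rho_supp i = mtop M closure_of {p \<in> topspace (mtop M). rho i p \<noteq> 0}"

lemma rho_partition: "partition_of_unity M rho"
  unfolding rho_def using partition_of_unity_exists by (rule someI_ex)

lemma rho_smooth: "smooth_in M j (D j) (rho i)"
  and rho_nonneg: "p \<in> topspace (mtop M) \<Longrightarrow> rho i p \<ge> 0"
  and rho_supp_sub: "rho_supp i \<subseteq> D i"
  and finite_rho_index: "finite rho_index"
  using rho_partition unfolding partition_of_unity_def rho_supp_def rho_index_def by blast+

lemma rho_supp_compact: "compactin (mtop M) (rho_supp i)"
  unfolding rho_supp_def using compact by (simp add: closedin_compact_space)

lemma rho_outside: "p \<in> topspace (mtop M) \<Longrightarrow> p \<notin> rho_supp i \<Longrightarrow> rho i p = 0"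
  unfolding rho_supp_def using closure_of_subset[of "{p \<in> topspace (mtop M). rho i p \<noteq> 0}" "mtop M"] by blast

lemma rho_sum: "p \<in> topspace (mtop M) \<Longrightarrow> (\<Sum>i\<in>rho_index. rho i p) = 1"
proof -
  assume p: "p \<in> topspace (mtop M)"
  then have "(\<Sum>i | rho i p \<noteq> 0. rho i p) = 1"
    using rho_partition unfolding partition_of_unity_def by blast
  moreover have "(\<Sum>i | rho i p \<noteq> 0. rho i p) = (\<Sum>i\<in>rho_index. rho i p)"
    using p finite_rho_index by (intro sum.mono_neutral_left) (auto simp: rho_index_def)
  ultimately show ?thesis by simp
qed

lemma integral4_rho: "integral4 M f = (\<Sum>i\<in>rho_index. cint i (\<lambda>p. rho i p * f i p))"
  by (simp add: integral4_def Let_def rho_def[symmetric] rho_index_def cint_def)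

lemma supported_rho: "supported i (rho_supp i) (\<lambda>p. rho i p * f p)"
  using rho_supp_compact rho_supp_sub rho_outside D_sub by (auto simp: supported_def subset_iff)

text \<open>Coefficients of a smooth four-form. In an oriented atlas four-forms and densities obey
  the same law, hence the name.\<close>

definition density :: "('i \<Rightarrow> 'a \<Rightarrow> real) \<Rightarrow> bool" where
  "density f \<longleftrightarrow> (\<forall>i. smooth_in M i (D i) (f i)) \<and>
    (\<forall>i j. \<forall>p\<in>D i \<inter> D j. f i p = det (jac M i j p) * f j p)"

lemma rho_density_smooth: "density f \<Longrightarrow> smooth_in M i (D i) (\<lambda>p. rho a p * f i p)"
  by (intro smooth_in_mult[OF D_open order_refl] rho_smooth) (simp add: density_def)

text \<open>The piece weighted by \<open>rho i\<close> is supported in both charts \<open>i\<close>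
  and \<open>j\<close>, so it may be integrated in chart \<open>j\<close>, where the weights add up
  to 1.\<close>

lemma integral4_localized:
  assumes f: "density f" and K: "compactin (mtop M) K" "K \<subseteq> D j"
    and out: "\<And>i p. p \<in> D i \<Longrightarrow> p \<notin> K \<Longrightarrow> f i p = 0"
  shows "integral4 M f = cint j (f j)"
proof -
  have c: "compactin (mtop M) (rho_supp i \<inter> K)" for i
    using rho_supp_compact compact_closed[OF K(1)] by (rule compact_Int_closedin)
  have sj: "supported j (rho_supp i \<inter> K) (\<lambda>p. rho i p * f j p)" for i
    using c[of i] K(2) out rho_outside D_sub by (auto simp: supported_def subset_iff)
  have si: "supported i (rho_supp i \<inter> K) (\<lambda>p. rho i p * f i p)" for i
    using c[of i] rho_supp_sub out rho_outside D_sub by (auto simp: supported_def subset_iff)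
  have "cint i (\<lambda>p. rho i p * f i p) = cint j (\<lambda>p. rho i p * f j p)" for i
    by (rule cint_change_chart[OF si sj rho_density_smooth[OF f]])
      (use f in \<open>simp add: density_def\<close>)
  then have "integral4 M f = (\<Sum>i\<in>rho_index. cint j (\<lambda>p. rho i p * f j p))"
    by (simp add: integral4_rho)
  also have "\<dots> = cint j (\<lambda>p. \<Sum>i\<in>rho_index. rho i p * f j p)"
    by (rule cint_sum[symmetric, OF finite_rho_index sj rho_density_smooth[OF f]])
  also have "\<dots> = cint j (f j)"
    by (rule cint_cong) (use D_sub rho_sum in \<open>auto simp: sum_distrib_right[symmetric]\<close>)
  finally show ?thesis .
qed

lemma integral4_sum:
  assumes "finite I" "\<And>a. a \<in> I \<Longrightarrow> density (f a)"
  shows "integral4 M (\<lambda>i p. \<Sum>a\<in>I. f a i p) = (\<Sum>a\<in>I. integral4 M (f a))"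
proof -
  have "cint i (\<lambda>p. rho i p * (\<Sum>a\<in>I. f a i p)) = (\<Sum>a\<in>I. cint i (\<lambda>p. rho i p * f a i p))" for i
    using cint_sum[OF assms(1) supported_rho rho_density_smooth[OF assms(2)]]
    by (simp add: sum_distrib_left)
  then show ?thesis by (simp add: integral4_rho) (rule sum.swap)
qed

lemma integral4_diff:
  assumes "density f" "density g"
  shows "integral4 M (\<lambda>i p. f i p - g i p) = integral4 M f - integral4 M g"
proof -
  have "cint i (\<lambda>p. rho i p * (f i p - g i p)) = cint i (\<lambda>p. rho i p * f i p) - cint i (\<lambda>p. rho i p * g i p)" for i
    using cint_diff[OF supported_rho rho_density_smooth[OF assms(1)] supported_rho rho_density_smooth[OF assms(2)]]
    by (simp add: right_diff_distrib)
  then show ?thesis by (simp add: integral4_rho sum_subtractf)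
qed

lemma integral4_cong: "(\<And>i p. p \<in> D i \<Longrightarrow> f i p = g i p) \<Longrightarrow> integral4 M f = integral4 M g"
  unfolding integral4_rho by (intro sum.cong refl cint_cong) simp

lemma wedge22_density:
  assumes "v \<in> two_forms M" "w \<in> two_forms M"
  shows "density (\<lambda>i p. wedge22 (v i p) (w i p))"
  unfolding density_def
proof (intro conjI allI ballI)
  note DD = D_open order_refl
  show "smooth_in M i (D i) (\<lambda>p. wedge22 (v i p) (w i p))" for i
    unfolding wedge22_def
    by (intro smooth_in_sum[OF DD] smooth_in_mult[OF DD] smooth_in_const two_form_nth_smooth assms)
  show "wedge22 (v i p) (w i p) = det (jac M i j p) * wedge22 (v j p) (w j p)"
    if "p \<in> D i \<inter> D j" for i j p
    by (simp only: two_form_congruence[OF assms(1) that] two_form_congruence[OF assms(2) that]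
        wedge22_congruence)
qed

section \<open>Stokes' theorem\<close>

lemma closed_two_forms_two_forms: "w \<in> closed_two_forms M \<Longrightarrow> w \<in> two_forms M"
  by (simp add: closed_two_forms_def)

text \<open>Leibniz' rule \<open>d\<beta> \<and> C = d (\<beta> \<and> C)\<close> for a closed form \<open>C\<close>, with \<open>P k l\<close> and \<open>T k m n\<close>
  standing for the derivatives of the coefficients of \<open>\<beta>\<close> and \<open>C\<close>.\<close>

lemma wedge22_leibniz:
  fixes P :: "4 \<Rightarrow> 4 \<Rightarrow> real" and T :: "4 \<Rightarrow> 4 \<Rightarrow> 4 \<Rightarrow> real"
  assumes C: "transpose C = - C" and T: "\<And>k m n. T k m n = - T k n m"
    "\<And>k m n. T k m n + T m n k + T n k m = 0"
  shows "wedge22 (\<chi> k l. P k l - P l k) C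
    = (\<Sum>k\<in>UNIV. \<Sum>l\<in>UNIV. \<Sum>m\<in>UNIV. \<Sum>n\<in>UNIV. 1/2 * eps4 k l m n * (b l * T k m n + P k l * C $ m $ n))"
proof -
  have a: "transpose (\<chi> k l. P k l - P l k) = - (\<chi> k l. P k l - P l k)"
    by (simp add: transpose_def vec_eq_iff)
  have t: "T k 2 1 = - T k 1 2" "T k 3 1 = - T k 1 3" "T k 4 1 = - T k 1 4"
    "T k 3 2 = - T k 2 3" "T k 4 2 = - T k 2 4" "T k 4 3 = - T k 3 4" for k
    by (rule T(1))+
  \<comment> \<open>Closedness for the four triples of distinct indices, each solved for one
    derivative.\<close>
  have z: "T 2 3 4 = T 3 2 4 - T 4 2 3" "T 1 3 4 = T 3 1 4 - T 4 1 3"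
    "T 1 2 4 = T 2 1 4 - T 4 1 2" "T 1 2 3 = T 2 1 3 - T 3 1 2"
    using T(2)[of 2 3 4] T(2)[of 1 3 4] T(2)[of 1 2 4] T(2)[of 1 2 3] by (simp_all add: t)
  show ?thesis
    unfolding wedge22_antisym[OF a C]
    by (simp add: sum_4 eps4_simps antisym_nth[OF C] t z field_simps)
qed

lemma stokes_local:
  assumes b: "one_form M b" and K: "supported j K (b j)" and c: "c \<in> closed_two_forms M"
  shows "cint j (\<lambda>p. wedge22 (ext_d M b j p) (c j p)) = 0"
proof -
  note DD = D_open order_refl
  note ct = closed_two_forms_two_forms[OF c]
  \<comment> \<open>The three-form \<open>b \<and> c\<close> read as a vector field; its divergence
    is the coefficient of \<open>d (b \<and> c)\<close>.\<close>
  define h where "h k p = (\<Sum>l\<in>UNIV. \<Sum>m\<in>UNIV. \<Sum>n\<in>UNIV. 1/2 * eps4 k l m n * (b j p $ l * c j p $ m $ n))" for k p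
  note bs = one_form_nth_smooth[OF b] and cs = two_form_nth_smooth[OF ct]
  have bc: "smooth_in M j (D j) (\<lambda>p. b j p $ l * c j p $ m $ n)" for l m n
    by (intro smooth_in_mult[OF DD] bs cs)
  have bce: "smooth_in M j (D j) (\<lambda>p. e * (b j p $ l * c j p $ m $ n))" for e l m n
    by (intro smooth_in_mult[OF DD] smooth_in_const bc)
  have hs: "smooth_in M j (D j) (h k)" for k
    unfolding h_def by (intro smooth_in_sum[OF DD] bce)
  have hK: "supported j K (h k)" for k
    using K by (auto simp: supported_def h_def)
  have ph: "partial M j k (h k) p = (\<Sum>l\<in>UNIV. \<Sum>m\<in>UNIV. \<Sum>n\<in>UNIV. 1/2 * eps4 k l m n *
      (b j p $ l * partial M j k (\<lambda>q. c j q $ m $ n) p + partial M j k (\<lambda>q. b j q $ l) p * c j p $ m $ n))"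
    if p: "p \<in> D j" for k p
  proof -
    have pe: "partial M j k (\<lambda>p. e * (b j p $ l * c j p $ m $ n)) p
        = e * (b j p $ l * partial M j k (\<lambda>q. c j q $ m $ n) p + partial M j k (\<lambda>q. b j q $ l) p * c j p $ m $ n)"
      for e l m n
      using partial_bounded_linear[OF DD bounded_linear_mult_right bc p] partial_mult[OF DD bs cs p] by simp
    show ?thesis
      unfolding h_def
      by (subst partial_sum[OF DD _ p], (intro smooth_in_sum[OF DD] bce)?)+ (simp only: pe)
  qed
  have "wedge22 (ext_d M b j p) (c j p) = (\<Sum>k\<in>UNIV. partial M j k (h k) p)" if p: "p \<in> D j" for p
  proof -
    let ?P = "\<lambda>k l. partial M j k (\<lambda>q. b j q $ l) p"
    let ?T = "\<lambda>k m n. partial M j k (\<lambda>q. c j q $ m $ n) p"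
    have "?T k m n = - ?T k n m" for k m n
    proof -
      have "?T k m n = partial M j k (\<lambda>q. - (c j q $ n $ m)) p"
        by (rule partial_cong[OF DD p]) (rule two_formsD(3)[OF ct])
      also have "\<dots> = - ?T k n m"
        by (rule partial_bounded_linear[OF DD bounded_linear_minus[OF bounded_linear_ident] cs p])
      finally show ?thesis .
    qed
    moreover have "?T k m n + ?T m n k + ?T n k m = 0" for k m n
      using c p by (simp add: closed_two_forms_def)
    ultimately have "wedge22 (\<chi> k l. ?P k l - ?P l k) (c j p)
      = (\<Sum>k\<in>UNIV. \<Sum>l\<in>UNIV. \<Sum>m\<in>UNIV. \<Sum>n\<in>UNIV. 1/2 * eps4 k l m n * (b j p $ l * ?T k m n + ?P k l * c j p $ m $ n))"
      by (rule wedge22_leibniz[OF two_form_transpose[OF ct]])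
    then show ?thesis using p by (simp only: ph[OF p] ext_d_def if_True)
  qed
  then have "cint j (\<lambda>p. wedge22 (ext_d M b j p) (c j p)) = cint j (\<lambda>p. \<Sum>k\<in>UNIV. partial M j k (h k) p)"
    by (rule cint_cong)
  also have "\<dots> = (\<Sum>k\<in>UNIV. cint j (partial M j k (h k)))"
    by (rule cint_sum[OF finite supported_partial[OF hK] smooth_in_partial[OF DD hs]])
  also have "\<dots> = 0" by (simp add: cint_partial[OF hK hs])
  finally show ?thesis .
qed

lemma one_form_rho:
  assumes "one_form M b"
  shows "one_form M (\<lambda>i p. rho a p *\<^sub>R b i p)"
  unfolding one_form_def
proof (intro conjI allI ballI)
  show "smooth_in M i (D i) (\<lambda>p. rho a p *\<^sub>R b i p)" for i
    using assms by (intro smooth_in_scaleR[OF D_open order_refl] rho_smooth) (simp add: one_form_def)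
  show "(rho a p *\<^sub>R b i p) $ k = (\<Sum>l\<in>UNIV. jac M i j p $ l $ k * (rho a p *\<^sub>R b j p) $ l)"
    if "p \<in> D i \<inter> D j" for i j p k
  proof -
    have "b i p $ k = (\<Sum>l\<in>UNIV. jac M i j p $ l $ k * b j p $ l)"
      using assms that unfolding one_form_def by blast
    then show ?thesis
      by (simp only: vector_scaleR_component real_scaleR_def sum_distrib_left) (simp add: ac_simps)
  qed
qed

text \<open>Cutting \<open>b\<close> itself into the pieces \<open>rho a *\<^sub>R b\<close> leaves
  exact forms whose primitives are supported in one chart. As \<open>ext_d\<close> is additive and
  the weights add up to 1, no derivative of \<open>rho a\<close> has to be computed.\<close>

theorem stokes:
  assumes b: "one_form M b" and c: "c \<in> closed_two_forms M"
  shows "integral4 M (\<lambda>i p. wedge22 (ext_d M b i p) (c i p)) = 0"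
proof -
  note DD = D_open order_refl
  define b' where "b' a i p = rho a p *\<^sub>R b i p" for a i p
  have b': "one_form M (b' a)" for a unfolding b'_def by (rule one_form_rho[OF b])
  have out: "ext_d M (b' a) i p = 0" if "p \<in> D i" "p \<notin> rho_supp a" for a i p
  proof -
    have o: "openin (mtop M) (D i - rho_supp a)"
      using D_open compact_closed[OF rho_supp_compact] by (rule openin_diff)
    have "partial M i k (\<lambda>q. b' a i q $ l) p = partial M i k (\<lambda>q. 0) p" for k l
      by (rule partial_cong[OF o Diff_subset])
        (use that rho_outside D_sub in \<open>auto simp: b'_def subset_iff\<close>)
    then show ?thesis
      by (simp add: ext_d_def vec_eq_iff partial_def in_coords_def pd_const)
  qed
  have "ext_d M b i p = (\<Sum>a\<in>rho_index. ext_d M (b' a) i p)" if p: "p \<in> D i" for i p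
  proof -
    have "partial M i k (\<lambda>q. b i q $ l) p = (\<Sum>a\<in>rho_index. partial M i k (\<lambda>q. b' a i q $ l) p)" for k l
    proof -
      have "b i q $ l = (\<Sum>a\<in>rho_index. b' a i q $ l)" if "q \<in> D i" for q
        using rho_sum[of q] that D_sub by (auto simp: b'_def sum_distrib_right[symmetric])
      then have "partial M i k (\<lambda>q. b i q $ l) p = partial M i k (\<lambda>q. \<Sum>a\<in>rho_index. b' a i q $ l) p"
        by (rule partial_cong[OF DD p])
      also have "\<dots> = (\<Sum>a\<in>rho_index. partial M i k (\<lambda>q. b' a i q $ l) p)"
        by (rule partial_sum[OF DD one_form_nth_smooth[OF b'] p])
      finally show ?thesis .
    qed
    then show ?thesis using p by (simp add: ext_d_def vec_eq_iff sum_subtractf)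
  qed
  then have "integral4 M (\<lambda>i p. wedge22 (ext_d M b i p) (c i p))
      = integral4 M (\<lambda>i p. \<Sum>a\<in>rho_index. wedge22 (ext_d M (b' a) i p) (c i p))"
    by (intro integral4_cong) (simp add: wedge22_sum)
  also have "\<dots> = (\<Sum>a\<in>rho_index. integral4 M (\<lambda>i p. wedge22 (ext_d M (b' a) i p) (c i p)))"
    by (intro integral4_sum finite_rho_index wedge22_density closed_two_forms_two_forms ext_d_closed b' c)
  also have "\<dots> = 0"
  proof (rule sum.neutral, rule ballI)
    fix a
    have "integral4 M (\<lambda>i p. wedge22 (ext_d M (b' a) i p) (c i p))
        = cint a (\<lambda>p. wedge22 (ext_d M (b' a) a p) (c a p))"
      by (rule integral4_localized[OF wedge22_density[OF closed_two_forms_two_forms[OF ext_d_closed[OF b']]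
            closed_two_forms_two_forms[OF c]] rho_supp_compact rho_supp_sub])
        (simp add: out wedge22_def)
    also have "\<dots> = 0"
      by (rule stokes_local[where K = "rho_supp a", OF b' _ c])
        (use rho_supp_compact rho_supp_sub rho_outside D_sub in \<open>auto simp: supported_def b'_def subset_iff\<close>)
    finally show "integral4 M (\<lambda>i p. wedge22 (ext_d M (b' a) i p) (c i p)) = 0" .
  qed
  finally show ?thesis .
qed

section \<open>Bounding a self-intersection by the self-dual part\<close>

lemma closed_two_forms_diff:
  assumes "v \<in> closed_two_forms M" "w \<in> closed_two_forms M"
  shows "(\<lambda>i p. v i p - w i p) \<in> closed_two_forms M"
proof -
  note DD = D_open order_refl
  note vt = closed_two_forms_two_forms[OF assms(1)] and wt = closed_two_forms_two_forms[OF assms(2)]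
  have two: "(\<lambda>i p. v i p - w i p) \<in> two_forms M"
    unfolding two_forms_def
  proof (intro CollectI conjI allI impI ballI)
    show "smooth_in M i (D i) (\<lambda>p. v i p - w i p)" for i
      by (intro smooth_in_diff[OF DD] two_formsD(1) vt wt)
    show "v i p - w i p = 0" if "p \<notin> D i" for i p
      using that by (simp add: two_formsD(2)[OF vt] two_formsD(2)[OF wt])
    show "(v i p - w i p) $ k $ l = - ((v i p - w i p) $ l $ k)" if "p \<in> D i" for i p k l
      using two_formsD(3)[OF vt that, of k l] two_formsD(3)[OF wt that, of k l] by simp
    show "(v i p - w i p) $ k $ l = (\<Sum>r\<in>UNIV. \<Sum>s\<in>UNIV.
        (jac M i j p $ r $ k * jac M i j p $ s $ l) *\<^sub>R (v j p - w j p) $ r $ s)"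
      if "p \<in> D i \<inter> D j" for i j p k l
      using two_formsD(4)[OF vt that, of k l] two_formsD(4)[OF wt that, of k l]
      by (simp add: right_diff_distrib sum_subtractf)
  qed
  have pdiff: "partial M i k (\<lambda>q. (v i q - w i q) $ l $ m) p
      = partial M i k (\<lambda>q. v i q $ l $ m) p - partial M i k (\<lambda>q. w i q $ l $ m) p"
    if "p \<in> D i" for i p k l m
    using partial_diff[OF DD two_form_nth_smooth[OF vt] two_form_nth_smooth[OF wt] that] by simp
  have cl: "partial M i k (\<lambda>q. u i q $ l $ m) p + partial M i l (\<lambda>q. u i q $ m $ k) p
       + partial M i m (\<lambda>q. u i q $ k $ l) p = 0" if "u \<in> closed_two_forms M" "p \<in> D i" for u i p k l m
    using that unfolding closed_two_forms_def by blast
  have "partial M i k (\<lambda>q. (v i q - w i q) $ l $ m) p + partial M i l (\<lambda>q. (v i q - w i q) $ m $ k) p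
       + partial M i m (\<lambda>q. (v i q - w i q) $ k $ l) p = 0" if "p \<in> D i" for i p k l m
    using cl[OF assms(1) that, of k l m] cl[OF assms(2) that, of k l m]
    by (simp only: pdiff[OF that])
  with two show ?thesis unfolding closed_two_forms_def by blast
qed

lemma closed_two_forms_add:
  assumes "v \<in> closed_two_forms M" "w \<in> closed_two_forms M"
  shows "(\<lambda>i p. v i p + w i p) \<in> closed_two_forms M"
proof -
  have "(\<lambda>i p. (v i p - v i p) - w i p) \<in> closed_two_forms M"
    by (intro closed_two_forms_diff assms)
  from closed_two_forms_diff[OF assms(1) this] show ?thesis by simp
qed

text \<open>With \<open>e = w - d b\<close>, the identity
  \<open>e \<and> e = w \<and> w - d b \<and> (w + e)\<close> gathers all correction terms in one
  product of an exact form with a closed one, so that a single use of Stokes' theorem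
  suffices.\<close>

lemma integral4_exact_perturbation:
  assumes w: "w \<in> closed_two_forms M" and b: "one_form M b"
  shows "integral4 M (\<lambda>i p. wedge22 (w i p - ext_d M b i p) (w i p - ext_d M b i p))
    = integral4 M (\<lambda>i p. wedge22 (w i p) (w i p))"
proof -
  let ?d = "ext_d M b"
  let ?e = "\<lambda>i p. w i p - ?d i p"
  note d = ext_d_closed[OF b]
  have e: "?e \<in> closed_two_forms M" by (intro closed_two_forms_diff w d)
  have we: "(\<lambda>i p. w i p + ?e i p) \<in> closed_two_forms M" by (intro closed_two_forms_add w e)
  note T = closed_two_forms_two_forms
  have "wedge22 (?e i p) (?e i p) = wedge22 (w i p) (w i p) - wedge22 (?d i p) (w i p + ?e i p)" for i p
    using wedge22_sym[OF two_form_transpose[OF T[OF w]] two_form_transpose[OF T[OF d]], of i p i p]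
    by (simp only: wedge22_add wedge22_diff)
  then have "integral4 M (\<lambda>i p. wedge22 (?e i p) (?e i p))
      = integral4 M (\<lambda>i p. wedge22 (w i p) (w i p) - wedge22 (?d i p) (w i p + ?e i p))" by simp
  also have "\<dots> = integral4 M (\<lambda>i p. wedge22 (w i p) (w i p)) - integral4 M (\<lambda>i p. wedge22 (?d i p) (w i p + ?e i p))"
    by (intro integral4_diff wedge22_density T w d we)
  finally show ?thesis unfolding stokes[OF b we] by simp
qed

text \<open>Passing from \<open>w\<close> to \<open>w - d b\<close> keeps the integral, and
  pointwise the wedge square is at most that of the self-dual part. Components depend on the chart,
  but the integral looks at chart \<open>i\<close> only on \<open>rho_supp i\<close>; the last sum
  is the coordinate volume weighted by the partition.\<close>

lemma intersection_bound:
  assumes w: "w \<in> closed_two_forms M" and b: "one_form M b"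
    and d: "\<And>i p k l. i \<in> rho_index \<Longrightarrow> p \<in> rho_supp i
      \<Longrightarrow> \<bar>sd_part (mmetric M i p) (w i p - ext_d M b i p) $ k $ l\<bar> \<le> d"
  shows "integral4 M (\<lambda>i p. wedge22 (w i p) (w i p)) \<le> 6 * d\<^sup>2 * (\<Sum>i\<in>rho_index. cint i (rho i))"
proof -
  let ?e = "\<lambda>i p. w i p - ext_d M b i p"
  have e: "?e \<in> closed_two_forms M" by (intro closed_two_forms_diff w ext_d_closed b)
  note et = closed_two_forms_two_forms[OF e]
  have "cint i (\<lambda>p. rho i p * wedge22 (?e i p) (?e i p)) \<le> 6 * d\<^sup>2 * cint i (rho i)" if i: "i \<in> rho_index" for i
  proof -
    have "cint i (\<lambda>p. rho i p * wedge22 (?e i p) (?e i p)) \<le> cint i (\<lambda>p. rho i p * (6 * d\<^sup>2))"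
    proof (rule cint_mono[OF supported_rho rho_density_smooth[OF wedge22_density[OF et et]] supported_rho])
      show "smooth_in M i (D i) (\<lambda>p. rho i p * (6 * d\<^sup>2))"
        by (intro smooth_in_mult[OF D_open order_refl] rho_smooth smooth_in_const)
      fix p assume p: "p \<in> D i"
      show "rho i p * wedge22 (?e i p) (?e i p) \<le> rho i p * (6 * d\<^sup>2)"
      proof (cases "p \<in> rho_supp i")
        case True
        note s = metric_spd[OF p] and t = two_form_transpose[OF et, of i p]
        have "wedge22 (?e i p) (?e i p) \<le> 6 * d\<^sup>2"
          using wedge22_le_sd_part[OF s t] wedge22_bound[OF sd_part_real(2)[OF s t] d[OF i True]] by simp
        then show ?thesis using p D_sub rho_nonneg by (intro mult_left_mono) auto
      next
        case False
        then have "rho i p = 0" using p D_sub rho_outside by blast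
        then show ?thesis by simp
      qed
    qed
    also have "\<dots> = 6 * d\<^sup>2 * cint i (rho i)"
      using cint_mult[of i "6 * d\<^sup>2" "rho i"] by (simp add: mult.commute)
    finally show ?thesis .
  qed
  then have "integral4 M (\<lambda>i p. wedge22 (?e i p) (?e i p)) \<le> (\<Sum>i\<in>rho_index. 6 * d\<^sup>2 * cint i (rho i))"
    unfolding integral4_rho by (rule sum_mono)
  then show ?thesis
    by (simp only: integral4_exact_perturbation[OF w b] sum_distrib_left)
qed

end

section \<open>The trace part of the curvature equation\<close>

text \<open>\<open>orth_proj\<close> is a definite description, so even membership needs existence
  and uniqueness of the orthogonal projection.\<close>

lemma orth_proj_span_mem:
  fixes x :: "'v::euclidean_space"
  shows "orth_proj (span S) x \<in> span S"
proof -
  obtain y z where y: "y \<in> span S" "\<And>w. w \<in> span S \<Longrightarrow> orthogonal z w" "x = y + z"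
    using orthogonal_subspace_decomp_exists[of S x] by metis
  let ?Q = "\<lambda>y. y \<in> span S \<and> (\<forall>z\<in>span S. (x - y) \<bullet> z = 0)"
  have "?Q y" using y by (auto simp: orthogonal_def)
  moreover have "y' = y''" if "?Q y'" "?Q y''" for y' y''
  proof -
    have "y' - y'' \<in> span S" using that by (simp add: span_diff)
    then have "(x - y'') \<bullet> (y' - y'') - (x - y') \<bullet> (y' - y'') = 0" using that by simp
    then have "(y' - y'') \<bullet> (y' - y'') = 0" by (simp add: inner_diff_left)
    then show ?thesis by simp
  qed
  ultimately have "\<exists>!y. ?Q y" by blast
  from theI'[OF this] show ?thesis by (simp add: orth_proj_def)
qed

text \<open>The partial trace over the second tensor factor, that is, over the fibre of
  \<open>E\<close>.\<close>

definition ptrace :: "complex^(2 \<times> 'n::finite)^(2 \<times> 'n) \<Rightarrow> complex^2^2" where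
  "ptrace T = (\<chi> a b. \<Sum>j\<in>UNIV. T $ (a, j) $ (b, j))"

lemma linear_ptrace: "linear ptrace"
  by (rule linearI) (simp_all add: ptrace_def vec_eq_iff sum.distrib scaleR_sum_right)

lemma ptrace_kron: "ptrace (kron A B) = (\<chi> a b. A $ a $ b * trace B)"
  by (simp add: ptrace_def kron_def trace_def sum_distrib_left)

text \<open>This is where \<tau> = 0 enters: what remains of the quadratic term lies in the span of
  the \<open>kron A B\<close> with \<open>trace B = 0\<close>, on which the partial trace
  vanishes.\<close>

lemma ptrace_mu_0:
  fixes Psi :: "complex^'n::finite^2"
  shows "ptrace (mu 0 Psi) = 0"
proof -
  have z: "ptrace T = 0" if "T \<in> sl_sl" for T :: "complex^(2 \<times> 'n)^(2 \<times> 'n)"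
    using that unfolding sl_sl_def
  proof (induction rule: span_induct_alt)
    case base show ?case by (rule linear_0[OF linear_ptrace])
  next
    case (step c T T')
    then obtain A :: "complex^2^2" and B :: "complex^'n^'n" where "T = kron A B" "trace B = 0" by auto
    then have "ptrace T = 0" by (simp add: ptrace_kron zero_vec_def)
    then show ?case using step by (simp add: linear_add[OF linear_ptrace] linear_scale[OF linear_ptrace])
  qed
  have "orth_proj sl_sl (psi_psi_star Psi) \<in> sl_sl"
    unfolding sl_sl_def by (rule orth_proj_span_mem)
  then show ?thesis by (simp add: mu_def z)
qed

lemma linear_trace: "linear (trace :: complex^'n^'n \<Rightarrow> complex)"
  by (rule linearI) (simp_all add: trace_def sum.distrib scaleR_sum_right)

lemma bounded_linear_trace: "bounded_linear (trace :: complex^'n^'n \<Rightarrow> complex)"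
  using linear_trace linear_conv_bounded_linear by blast

lemma linear_imag: "linear (\<lambda>x. \<i> * complex_of_real x)"
  by (rule linearI) (simp_all add: algebra_simps scaleR_conv_of_real)

lemma mat_mult_nth: "(mat c ** A) $ a $ b = c * (A :: complex^'n^'n) $ a $ b"
  by (simp add: matrix_matrix_mult_def mat_def if_distrib[of "\<lambda>x. x * _"] cong: if_cong)

lemma cliff2_nth: "cliff2 G w $ a $ b = (\<Sum>k\<in>UNIV. \<Sum>l\<in>UNIV. 1/2 * (w $ k $ l * cliff_wedge G k l $ a $ b))"
  by (simp add: cliff2_def mat_mult_nth scaleR_conv_of_real[where 'a = complex])

lemma ptrace_cliff2_End:
  fixes F :: "(complex^'n::finite^'n)^4^4"
  shows "ptrace (cliff2_End G F) = cliff2 G (\<chi> k l. trace (F $ k $ l))"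
proof -
  have "ptrace (cliff2_End G F) = (\<Sum>k\<in>UNIV. \<Sum>l\<in>UNIV. (1/2) *\<^sub>R (\<chi> a b. cliff_wedge G k l $ a $ b * trace (F $ k $ l)))"
    unfolding cliff2_End_def linear_sum[OF linear_ptrace] linear_scale[OF linear_ptrace] ptrace_kron ..
  then show ?thesis
    by (simp add: vec_eq_iff cliff2_nth scaleR_conv_of_real[where 'a = complex] mult.commute)
qed

text \<open>The partial trace turns the equation on \<open>E\<close> into an abelian one without
  spinor; the factor \<open>CARD('n)\<close> is the trace of the identity on the right-hand
  side.\<close>

lemma trace_curvature_equation:
  fixes F :: "(complex^'n::finite^'n)^4^4" and Psi :: "complex^'n^2"
  assumes "cliff2_End G (sd_part g F) - mu 0 Psi = kron (cliff2 G \<eta>) (mat 1)"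
  shows "cliff2 G (sd_part g (\<chi> k l. trace (F $ k $ l))) = cliff2 G (of_nat CARD('n) *\<^sub>R \<eta>)"
proof -
  have "cliff2 G (sd_part g (\<chi> k l. trace (F $ k $ l))) = ptrace (cliff2_End G (sd_part g F))"
    by (simp add: ptrace_cliff2_End sd_part_linear[OF linear_trace])
  also have "\<dots> = ptrace (cliff2_End G (sd_part g F) - mu 0 Psi)"
    by (simp add: linear_diff[OF linear_ptrace] ptrace_mu_0)
  also have "\<dots> = (\<chi> a b. cliff2 G \<eta> $ a $ b * of_nat CARD('n))"
    unfolding assms ptrace_kron by (simp add: trace_I)
  also have "\<dots> = cliff2 G (of_nat CARD('n) *\<^sub>R \<eta>)"
    by (simp add: vec_eq_iff cliff2_nth sum_distrib_left scaleR_conv_of_real[where 'a = complex] ac_simps)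
  finally show ?thesis .
qed

lemma cliff2_imag:
  "cliff2 G (imag_form w) $ a $ b = \<i> * cliff2 G (\<chi> k l. complex_of_real (w $ k $ l)) $ a $ b"
  by (simp add: cliff2_nth imag_form_def sum_distrib_left ac_simps)

text \<open>The trace of a unitary connection is \<open>\<i>\<close> times this family of real one-forms.\<close>

definition trace_conn :: "('i \<Rightarrow> 'a \<Rightarrow> (complex^'n^'n)^4) \<Rightarrow> 'i \<Rightarrow> 'a \<Rightarrow> real^4" where
  "trace_conn A i p = (\<chi> k. Im (trace (A i p $ k)))"

lemma trace_skew: "cadj B = - B \<Longrightarrow> Re (trace B) = 0"
proof -
  assume "cadj B = - B"
  then have "cnj (B $ j $ j) = - B $ j $ j" for j by (auto simp: cadj_def vec_eq_iff)
  then have "Re (B $ j $ j) = 0" for j by (simp add: complex_eq_iff)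
  then show ?thesis by (simp add: trace_def)
qed

lemma trace_commutator: "trace (A ** B - B ** A) = 0" for A B :: "complex^'n^'n"
  using trace_mul_sym[of A B] by (simp add: trace_sub)

section \<open>Traces of connections and of the monopole equations\<close>

context manifold4
begin

lemma unitary_connectionD:
  assumes "unitary_connection M h A"
  shows "smooth_in M i (D i) (\<lambda>q. A i q $ l)" "p \<in> D i \<Longrightarrow> cadj (A i p $ k) = - (A i p $ k)"
    "p \<in> D i \<inter> D j \<Longrightarrow> A i p $ k =
        (\<Sum>l\<in>UNIV. jac M i j p $ l $ k *\<^sub>R (h i j p ** A j p $ l ** cadj (h i j p)))
        - partial M i k (h i j) p ** cadj (h i j p)"
  using assms smooth_in_vec_eq[OF D_open order_refl, of i "A i"] unfolding unitary_connection_def by blast+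

lemma trace_conn_nth_smooth:
  assumes "unitary_connection M h A"
  shows "smooth_in M i (D i) (\<lambda>q. Im (trace (A i q $ l)))"
  by (intro smooth_in_bounded_linear[OF D_open order_refl bounded_linear_compose[OF bounded_linear_Im bounded_linear_trace]]
      unitary_connectionD(1)[OF assms])

text \<open>The quadratic part of the curvature is a commutator and has trace zero; the rest is
  linear in the connection, and the trace of a skew-adjoint matrix is imaginary.\<close>

lemma trace_curvature:
  assumes A: "unitary_connection M h A" and p: "p \<in> D i"
  shows "(\<chi> k l. trace (curvature M A i p $ k $ l)) = imag_form (ext_d M (trace_conn A) i p)"
proof -
  note DD = D_open order_refl
  have tr: "trace (partial M i k (\<lambda>q. A i q $ l) p) = \<i> * complex_of_real (partial M i k (\<lambda>q. trace_conn A i q $ l) p)" for k l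
  proof -
    have bl: "bounded_linear (\<lambda>x. \<i> * complex_of_real x)"
      by (rule bounded_linear_compose[OF bounded_linear_mult_right bounded_linear_of_real])
    have "trace (partial M i k (\<lambda>q. A i q $ l) p) = partial M i k (\<lambda>q. trace (A i q $ l)) p"
      by (rule partial_bounded_linear[OF DD bounded_linear_trace unitary_connectionD(1)[OF A] p, symmetric])
    also have "\<dots> = partial M i k (\<lambda>q. \<i> * complex_of_real (Im (trace (A i q $ l)))) p"
    proof (rule partial_cong[OF DD p])
      fix q assume "q \<in> D i"
      then have "Re (trace (A i q $ l)) = 0" by (intro trace_skew unitary_connectionD(2)[OF A])
      then show "trace (A i q $ l) = \<i> * complex_of_real (Im (trace (A i q $ l)))"
        by (simp add: complex_eq_iff)
    qed
    also have "\<dots> = \<i> * complex_of_real (partial M i k (\<lambda>q. Im (trace (A i q $ l))) p)"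
      by (rule partial_bounded_linear[OF DD bl trace_conn_nth_smooth[OF A] p])
    finally show ?thesis by (simp add: trace_conn_def)
  qed
  have "trace (curvature M A i p $ k $ l)
      = trace (partial M i k (\<lambda>q. A i q $ l) p) - trace (partial M i l (\<lambda>q. A i q $ k) p)" for k l
  proof -
    have "curvature M A i p $ k $ l = (partial M i k (\<lambda>q. A i q $ l) p - partial M i l (\<lambda>q. A i q $ k) p)
        + (A i p $ k ** A i p $ l - A i p $ l ** A i p $ k)"
      by (simp add: curvature_def)
    then show ?thesis by (simp only: trace_add trace_sub[of "partial M i k (\<lambda>q. A i q $ l) p"] trace_commutator add_0_right)
  qed
  then show ?thesis
    using p by (simp add: tr imag_form_def ext_d_def vec_eq_iff right_diff_distrib)
qed

lemma imaginary_sd_formsD: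
  assumes "\<eta> \<in> imaginary_sd_forms M" "p \<in> D i"
  shows "\<eta> i p = imag_form (\<chi> k l. Im (\<eta> i p $ k $ l))"
    "transpose (\<chi> k l. Im (\<eta> i p $ k $ l)) = - (\<chi> k l. Im (\<eta> i p $ k $ l))"
    "hodge2 (mmetric M i p) (\<chi> k l. Im (\<eta> i p $ k $ l)) = (\<chi> k l. Im (\<eta> i p $ k $ l))"
proof -
  have w: "\<eta> \<in> two_forms M" "hodge2 (mmetric M i p) (\<eta> i p) = \<eta> i p" "\<And>k l. Re (\<eta> i p $ k $ l) = 0"
    using assms by (auto simp: imaginary_sd_forms_def)
  show "\<eta> i p = imag_form (\<chi> k l. Im (\<eta> i p $ k $ l))"
    by (simp add: imag_form_def vec_eq_iff complex_eq_iff w(3))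
  have im: "Im (\<eta> i p $ l $ k) = - Im (\<eta> i p $ k $ l)" for k l
    by (subst two_formsD(3)[OF w(1) assms(2)]) simp
  show "transpose (\<chi> k l. Im (\<eta> i p $ k $ l)) = - (\<chi> k l. Im (\<eta> i p $ k $ l))"
    unfolding vec_eq_iff transpose_def by (simp, intro allI, rule im)
  show "hodge2 (mmetric M i p) (\<chi> k l. Im (\<eta> i p $ k $ l)) = (\<chi> k l. Im (\<eta> i p $ k $ l))"
    using hodge2_linear[OF bounded_linear.linear[OF bounded_linear_Im], of "mmetric M i p" "\<eta> i p"] w(2) by simp
qed

text \<open>After tracing, Clifford multiplication can be stripped off because it is injective on
  self-dual forms. That injectivity is stated for real forms, so the common factor
  \<open>\<i>\<close> is removed first.\<close>

lemma monopole_trace: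
  fixes E :: "'i \<Rightarrow> 'i \<Rightarrow> 'a \<Rightarrow> complex^'n^'n"
  assumes s: "spinc_structure M s" and \<eta>: "\<eta> \<in> imaginary_sd_forms M"
    and mon: "(Psi, A) \<in> monopoles M s B E 0 \<eta>" and p: "p \<in> D i"
  shows "sd_part (mmetric M i p) (ext_d M (trace_conn A) i p)
    = real CARD('n) *\<^sub>R (\<chi> k l. Im (\<eta> i p $ k $ l))"
proof -
  let ?g = "mmetric M i p" and ?G = "clifford s i p" and ?d = "ext_d M (trace_conn A) i p"
  let ?e = "\<chi> k l. Im (\<eta> i p $ k $ l)"
  have A: "unitary_connection M E A"
    and eq: "cliff2_End ?G (sd_part ?g (curvature M A i p)) - mu 0 (Psi i p) = kron (cliff2 ?G (\<eta> i p)) (mat 1)"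
    using mon p by (auto simp: monopoles_def)
  note \<eta>' = imaginary_sd_formsD[OF \<eta> p]
  have "sd_part ?g (\<chi> k l. trace (curvature M A i p $ k $ l)) = imag_form (sd_part ?g ?d)"
    unfolding trace_curvature[OF A p] imag_form_def by (rule sd_part_linear[OF linear_imag])
  moreover have "of_nat CARD('n) *\<^sub>R \<eta> i p = imag_form (real CARD('n) *\<^sub>R ?e)"
    by (subst \<eta>'(1)) (simp add: imag_form_def vec_eq_iff scaleR_conv_of_real[where 'a = complex])
  ultimately have "cliff2 ?G (imag_form (sd_part ?g ?d)) = cliff2 ?G (imag_form (real CARD('n) *\<^sub>R ?e))"
    using trace_curvature_equation[OF eq] by simp
  then have "\<i> * cliff2 ?G (\<chi> k l. complex_of_real (sd_part ?g ?d $ k $ l)) $ a $ b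
      = \<i> * cliff2 ?G (\<chi> k l. complex_of_real ((real CARD('n) *\<^sub>R ?e) $ k $ l)) $ a $ b" for a b
    unfolding cliff2_imag[symmetric] by simp
  then have same: "cliff2 ?G (\<chi> k l. complex_of_real (sd_part ?g ?d $ k $ l))
      = cliff2 ?G (\<chi> k l. complex_of_real ((real CARD('n) *\<^sub>R ?e) $ k $ l))"
    by (simp add: vec_eq_iff)
  let ?sd = "{w :: real^4^4. transpose w = - w \<and> hodge2 ?g w = w}"
  have inj: "inj_on (\<lambda>w :: real^4^4. cliff2 ?G (\<chi> k l. complex_of_real (w $ k $ l))) ?sd"
    using s p unfolding spinc_structure_def bij_betw_def by blast
  have "transpose ?d = - ?d" by (simp add: ext_d_def transpose_def vec_eq_iff)
  then have "sd_part ?g ?d \<in> ?sd" using sd_part_real[OF metric_spd[OF p]] by simp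
  moreover have "real CARD('n) *\<^sub>R ?e \<in> ?sd"
    using \<eta>'(2,3) by (simp only: mem_Collect_eq transpose_linear hodge2_scaleR scaleR_minus_right simp_thms)
  ultimately show ?thesis using inj_onD[OF inj same] by blast
qed

text \<open>The inhomogeneous term in the change of frame depends on the transition functions only
  and is the same for both connections; conjugation by a unitary matrix does not affect the
  trace.\<close>

lemma trace_conn_difference:
  assumes E: "hermitian_bundle M E" and A: "unitary_connection M E A" "unitary_connection M E A'"
  shows "one_form M (\<lambda>i p. c *\<^sub>R (trace_conn A i p - trace_conn A' i p))"
  unfolding one_form_def
proof (intro conjI allI ballI)
  note DD = D_open order_refl
  have "smooth_in M i (D i) (\<lambda>p. c * (Im (trace (A i p $ k)) - Im (trace (A' i p $ k))))" for i k
    by (intro smooth_in_mult[OF DD] smooth_in_const smooth_in_diff[OF DD] trace_conn_nth_smooth[OF A(1)]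
        trace_conn_nth_smooth[OF A(2)])
  then show "smooth_in M i (D i) (\<lambda>p. c *\<^sub>R (trace_conn A i p - trace_conn A' i p))" for i
    by (simp add: smooth_in_vec_eq[OF DD] trace_conn_def)
  fix i j p k assume p: "p \<in> D i \<inter> D j"
  let ?h = "E i j p"
  have h: "cadj ?h ** ?h = mat 1" using E p by (simp add: hermitian_bundle_def)
  have conj: "trace (?h ** X ** cadj ?h) = trace X" for X
  proof -
    have "trace (?h ** X ** cadj ?h) = trace (cadj ?h ** (?h ** X))" by (rule trace_mul_sym)
    then show ?thesis by (simp add: matrix_mul_assoc h)
  qed
  have "trace_conn A i p $ k = (\<Sum>l\<in>UNIV. jac M i j p $ l $ k * trace_conn A j p $ l)
      - Im (trace (partial M i k (E i j) p ** cadj ?h))" if A: "unitary_connection M E A" for A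
    unfolding trace_conn_def
    by (simp add: unitary_connectionD(3)[OF A p, of k] linear_diff[OF linear_trace] linear_sum[OF linear_trace]
        linear_scale[OF linear_trace] conj)
  then show "(c *\<^sub>R (trace_conn A i p - trace_conn A' i p)) $ k
      = (\<Sum>l\<in>UNIV. jac M i j p $ l $ k * (c *\<^sub>R (trace_conn A j p - trace_conn A' j p)) $ l)"
    using A by (simp add: sum_subtractf right_diff_distrib sum_distrib_left ac_simps)
qed

lemma ext_d_trace_conn_difference:
  assumes A: "unitary_connection M E A" "unitary_connection M E A'" and p: "p \<in> D i"
  shows "ext_d M (\<lambda>i p. c *\<^sub>R (trace_conn A i p - trace_conn A' i p)) i p
    = c *\<^sub>R (ext_d M (trace_conn A) i p - ext_d M (trace_conn A') i p)"
proof -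
  note DD = D_open order_refl
  note sA = trace_conn_nth_smooth[OF A(1)] and sA' = trace_conn_nth_smooth[OF A(2)]
  have "partial M i k (\<lambda>q. c * (Im (trace (A i q $ l)) - Im (trace (A' i q $ l)))) p
      = c * (partial M i k (\<lambda>q. Im (trace (A i q $ l))) p - partial M i k (\<lambda>q. Im (trace (A' i q $ l))) p)" for k l
    using partial_bounded_linear[OF DD bounded_linear_mult_right smooth_in_diff[OF DD sA sA'] p]
      partial_diff[OF DD sA sA' p] by simp
  then show ?thesis
    using p by (simp add: ext_d_def trace_conn_def vec_eq_iff algebra_simps)
qed

lemma monopole_difference_exact:
  fixes E :: "'i \<Rightarrow> 'i \<Rightarrow> 'a \<Rightarrow> complex^'n^'n"
  assumes s: "spinc_structure M s" and E: "hermitian_bundle M E"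
    and \<eta>: "\<eta> \<in> imaginary_sd_forms M" "monopoles M s B E 0 \<eta> \<noteq> {}"
    and \<eta>': "\<eta>' \<in> imaginary_sd_forms M" "monopoles M s B E 0 \<eta>' \<noteq> {}"
  shows "\<exists>b. one_form M b \<and> (\<forall>i. \<forall>p\<in>D i. \<forall>k l.
    c * Im ((\<eta> i p - \<eta>' i p) $ k $ l) = sd_part (mmetric M i p) (ext_d M b i p) $ k $ l)"
proof -
  obtain Psi A where A: "(Psi, A) \<in> monopoles M s B E 0 \<eta>" using \<eta>(2) by auto
  obtain Psi' A' where A': "(Psi', A') \<in> monopoles M s B E 0 \<eta>'" using \<eta>'(2) by auto
  have u: "unitary_connection M E A" "unitary_connection M E A'"
    using A A' by (auto simp: monopoles_def)
  \<comment> \<open>Dividing by the rank undoes the factor in \<open>monopole_trace\<close>. The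
    free scalar \<open>c\<close> will be \<open>1 / t\<close>.\<close>
  let ?c = "c / real CARD('n)"
  let ?b = "\<lambda>i p. ?c *\<^sub>R (trace_conn A i p - trace_conn A' i p)"
  have "c * Im ((\<eta> i p - \<eta>' i p) $ k $ l) = sd_part (mmetric M i p) (ext_d M ?b i p) $ k $ l"
    if p: "p \<in> D i" for i p k l
  proof -
    have eq: "sd_part (mmetric M i p) (ext_d M ?b i p)
        = ?c *\<^sub>R (sd_part (mmetric M i p) (ext_d M (trace_conn A) i p) - sd_part (mmetric M i p) (ext_d M (trace_conn A') i p))"
      unfolding ext_d_trace_conn_difference[OF u p]
      by (simp add: sd_part_def hodge2_scaleR hodge2_diff algebra_simps)
    show ?thesis
      unfolding eq monopole_trace[OF s \<eta>(1) A p] monopole_trace[OF s \<eta>'(1) A' p]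
      by (simp add: field_simps)
  qed
  then show ?thesis using trace_conn_difference[OF E u] by blast
qed

end

section \<open>Genericity\<close>

lemma foldr_pd_add_scaleR:
  fixes f g :: "real^'m \<Rightarrow> 'b::real_normed_vector"
  assumes S: "open S" and f: "smooth_on S f" and g: "smooth_on S g" and x: "x \<in> S"
  shows "foldr pd ks (\<lambda>y. f y + t *\<^sub>R g y) x = foldr pd ks f x + t *\<^sub>R foldr pd ks g x"
  using x
proof (induction ks arbitrary: x)
  case (Cons k ks)
  note df = smooth_on_differentiable[OF smooth_on_foldr_pd[OF f, of ks] S Cons.prems]
  note dg = smooth_on_differentiable[OF smooth_on_foldr_pd[OF g, of ks] S Cons.prems]
  have "pd k (foldr pd ks (\<lambda>y. f y + t *\<^sub>R g y)) x = pd k (\<lambda>y. foldr pd ks f y + t *\<^sub>R foldr pd ks g y) x"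
    by (rule pd_cong[OF S Cons.prems]) (rule Cons.IH)
  also have "\<dots> = pd k (foldr pd ks f) x + pd k (\<lambda>y. t *\<^sub>R foldr pd ks g y) x"
    by (rule pd_add[OF df]) (use dg in simp)
  also have "pd k (\<lambda>y. t *\<^sub>R foldr pd ks g y) x = t *\<^sub>R pd k (foldr pd ks g) x"
    by (rule pd_bounded_linear[OF bounded_linear_scaleR_right dg])
  finally show ?case by simp
qed simp

section \<open>The smooth topology on families of components\<close>

definition Cinf_basic :: "('a, 'i) riem4 \<Rightarrow> ('i \<Rightarrow> 'a \<Rightarrow> 'b::real_normed_vector) set \<Rightarrow> ('i \<Rightarrow> 'a \<Rightarrow> 'b)
    \<Rightarrow> 'i \<Rightarrow> (real^4) set \<Rightarrow> 4 list \<Rightarrow> real \<Rightarrow> ('i \<Rightarrow> 'a \<Rightarrow> 'b) set" where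
  "Cinf_basic M \<Omega> w0 i K ks e =
     {w \<in> \<Omega>. \<forall>x \<in> K. norm (foldr pd ks (\<lambda>y. in_coords M i (w i) y - in_coords M i (w0 i) y) x) < e}"

lemma Cinf_topology_basic:
  "Cinf_topology M \<Omega> = topology_generated_by {Cinf_basic M \<Omega> w0 i K ks e | w0 i K ks e.
     w0 \<in> \<Omega> \<and> compact K \<and> K \<subseteq> chart_img M i \<and> e > 0}"
  unfolding Cinf_topology_def Cinf_basic_def ..

lemma openin_Cinf_basic:
  "w0 \<in> \<Omega> \<Longrightarrow> compact K \<Longrightarrow> K \<subseteq> chart_img M i \<Longrightarrow> e > 0
    \<Longrightarrow> openin (Cinf_topology M \<Omega>) (Cinf_basic M \<Omega> w0 i K ks e)"
  unfolding Cinf_topology_basic by (rule topology_generated_by_Basis) blast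

lemma topspace_Cinf: "topspace (Cinf_topology M \<Omega>) = \<Omega>"
proof
  show "topspace (Cinf_topology M \<Omega>) \<subseteq> \<Omega>"
    unfolding Cinf_topology_basic topology_generated_by_topspace by (auto simp: Cinf_basic_def)
  show "\<Omega> \<subseteq> topspace (Cinf_topology M \<Omega>)"
  proof
    fix w assume w: "w \<in> \<Omega>"
    \<comment> \<open>The empty compact set imposes no condition, so this subbasic set is all of
      \<open>\<Omega>\<close>.\<close>
    have "openin (Cinf_topology M \<Omega>) (Cinf_basic M \<Omega> w i {} [] 1)" for i
      by (rule openin_Cinf_basic[OF w]) auto
    then show "w \<in> topspace (Cinf_topology M \<Omega>)"
      using openin_subset w by (fastforce simp: Cinf_basic_def)
  qed
qed

text \<open>One-sided continuity at 0 of the line through \<eta> in direction \<open>v\<close>, by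
  induction on the generation of the open set. In a subbasic set the strict inequality leaves a
  margin, uniform on the compact \<open>K\<close>, and iterated derivatives are affine in
  \<open>t\<close>.\<close>

lemma Cinf_line_open:
  assumes U: "openin (Cinf_topology M \<Omega>) U" and \<eta>: "\<eta> \<in> U"
    and \<Omega>: "\<And>t. (\<lambda>i p. \<eta> i p + t *\<^sub>R v i p) \<in> \<Omega>"
    and img: "\<And>i. open (chart_img M i)"
    and sm: "\<And>i w. w \<in> \<Omega> \<Longrightarrow> smooth_in M i (mdom M i) (w i)" and v: "\<And>i. smooth_in M i (mdom M i) (v i)"
  shows "\<exists>d>0. \<forall>t. 0 \<le> t \<and> t < d \<longrightarrow> (\<lambda>i p. \<eta> i p + t *\<^sub>R v i p) \<in> U"
proof -
  have "generate_topology_on {Cinf_basic M \<Omega> w0 i K ks e | w0 i K ks e.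
     w0 \<in> \<Omega> \<and> compact K \<and> K \<subseteq> chart_img M i \<and> e > 0} U"
    using U unfolding Cinf_topology_basic openin_topology_generated_by_iff .
  then show ?thesis using \<eta>
  proof (induction rule: generate_topology_on.induct)
    case Empty then show ?case by simp
  next
    case (Int a b)
    then obtain d d' where "d > 0" "\<forall>t. 0 \<le> t \<and> t < d \<longrightarrow> (\<lambda>i p. \<eta> i p + t *\<^sub>R v i p) \<in> a"
      "d' > 0" "\<forall>t. 0 \<le> t \<and> t < d' \<longrightarrow> (\<lambda>i p. \<eta> i p + t *\<^sub>R v i p) \<in> b" by auto
    then show ?case by (intro exI[of _ "min d d'"]) simp
  next
    case (UN \<K>)
    then obtain k where "k \<in> \<K>" "\<eta> \<in> k" by blast
    with UN.IH[of k] show ?case by blast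
  next
    case (Basis s)
    then obtain w0 i K ks e where s: "s = Cinf_basic M \<Omega> w0 i K ks e"
      and w0: "w0 \<in> \<Omega>" and K: "compact K" "K \<subseteq> chart_img M i" and e: "e > 0" by blast
    have \<eta>\<Omega>: "\<eta> \<in> \<Omega>" using Basis.prems by (simp add: s Cinf_basic_def)
    define f where "f y = in_coords M i (\<eta> i) y - in_coords M i (w0 i) y" for y
    define g where "g = in_coords M i (v i)"
    have sf: "smooth_on (chart_img M i) f"
      unfolding f_def using sm[OF \<eta>\<Omega>, of i] sm[OF w0, of i]
      by (intro smooth_on_diff[OF img]) (simp_all add: smooth_in_def)
    have sg: "smooth_on (chart_img M i) g" using v[of i] by (simp add: g_def smooth_in_def)
    have cont: "continuous_on K (\<lambda>x. norm (foldr pd ks h x))" if "smooth_on (chart_img M i) h" for h :: "real^4 \<Rightarrow> 'c"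
      using continuous_on_subset[OF smooth_on_continuous[OF smooth_on_foldr_pd[OF that]] K(2)]
      by (rule continuous_on_norm)
    have fe: "norm (foldr pd ks f x) < e" if "x \<in> K" for x
      using Basis.prems that unfolding s Cinf_basic_def f_def by simp
    show ?case
    proof (cases "K = {}")
      case True
      then show ?thesis using \<Omega> by (intro exI[of _ 1]) (simp add: s Cinf_basic_def)
    next
      case False
      obtain y where y: "y \<in> K" "\<And>x. x \<in> K \<Longrightarrow> norm (foldr pd ks f x) \<le> norm (foldr pd ks f y)"
        using continuous_attains_sup[OF K(1) False cont[OF sf]] by blast
      obtain z where z: "z \<in> K" "\<And>x. x \<in> K \<Longrightarrow> norm (foldr pd ks g x) \<le> norm (foldr pd ks g z)"
        using continuous_attains_sup[OF K(1) False cont[OF sg]] by blast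
      \<comment> \<open>Adding 1 keeps \<open>C\<close> positive when the derivative of
        \<open>g\<close> vanishes on \<open>K\<close>; the margin divided by \<open>C\<close> is
        then an admissible \<open>d\<close>.\<close>
      define C where "C = norm (foldr pd ks g z) + 1"
      have C: "C > 0" by (simp add: C_def add_nonneg_pos)
      define d where "d = (e - norm (foldr pd ks f y)) / C"
      have d: "d > 0" using fe[OF y(1)] C by (simp add: d_def)
      have "(\<lambda>i p. \<eta> i p + t *\<^sub>R v i p) \<in> s" if t: "0 \<le> t" "t < d" for t
      proof -
        have "norm (foldr pd ks (\<lambda>y. in_coords M i (\<lambda>p. \<eta> i p + t *\<^sub>R v i p) y - in_coords M i (w0 i) y) x) < e"
          if x: "x \<in> K" for x
        proof -
          have "(\<lambda>y. in_coords M i (\<lambda>p. \<eta> i p + t *\<^sub>R v i p) y - in_coords M i (w0 i) y) = (\<lambda>y. f y + t *\<^sub>R g y)"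
            by (simp add: fun_eq_iff f_def g_def in_coords_def)
          then have "norm (foldr pd ks (\<lambda>y. in_coords M i (\<lambda>p. \<eta> i p + t *\<^sub>R v i p) y - in_coords M i (w0 i) y) x)
              = norm (foldr pd ks f x + t *\<^sub>R foldr pd ks g x)"
            using foldr_pd_add_scaleR[OF img sf sg, of x ks t] x K(2) by auto
          also have "\<dots> \<le> norm (foldr pd ks f x) + t * norm (foldr pd ks g x)"
            using norm_triangle_ineq[of "foldr pd ks f x" "t *\<^sub>R foldr pd ks g x"] t(1) by simp
          also have "\<dots> \<le> norm (foldr pd ks f y) + t * C"
            using y(2)[OF x] z(2)[OF x] t(1) by (intro add_mono mult_left_mono) (simp_all add: C_def)
          also have "\<dots> < norm (foldr pd ks f y) + d * C"
            using t(2) C by simp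
          also have "\<dots> = e" using C by (simp add: d_def)
          finally show ?thesis .
        qed
        then show ?thesis using \<Omega> by (simp add: s Cinf_basic_def)
      qed
      then show ?thesis using d by blast
    qed
  qed
qed

context manifold4
begin

lemma imaginary_sd_forms_line:
  assumes "\<eta> \<in> imaginary_sd_forms M" "v \<in> imaginary_sd_forms M"
  shows "(\<lambda>i p. \<eta> i p + t *\<^sub>R v i p) \<in> imaginary_sd_forms M"
proof -
  note DD = D_open order_refl
  have e: "\<eta> \<in> two_forms M" and v: "v \<in> two_forms M" using assms by (auto simp: imaginary_sd_forms_def)
  have "(\<lambda>i p. \<eta> i p + t *\<^sub>R v i p) \<in> two_forms M"
    unfolding two_forms_def
  proof (intro CollectI conjI allI impI ballI)
    show "smooth_in M i (D i) (\<lambda>p. \<eta> i p + t *\<^sub>R v i p)" for i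
      by (intro smooth_in_add[OF DD] smooth_in_scaleR[OF DD] smooth_in_const two_formsD(1) e v)
    show "\<eta> i p + t *\<^sub>R v i p = 0" if "p \<notin> D i" for i p
      using that by (simp add: two_formsD(2)[OF e] two_formsD(2)[OF v])
    show "(\<eta> i p + t *\<^sub>R v i p) $ k $ l = - ((\<eta> i p + t *\<^sub>R v i p) $ l $ k)" if "p \<in> D i" for i p k l
      using two_formsD(3)[OF e that, of k l] two_formsD(3)[OF v that, of k l] by simp
    show "(\<eta> i p + t *\<^sub>R v i p) $ k $ l = (\<Sum>r\<in>UNIV. \<Sum>s\<in>UNIV.
        (jac M i j p $ r $ k * jac M i j p $ s $ l) *\<^sub>R (\<eta> j p + t *\<^sub>R v j p) $ r $ s)"
      if "p \<in> D i \<inter> D j" for i j p k l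
      using two_formsD(4)[OF e that, of k l] two_formsD(4)[OF v that, of k l]
      by (simp add: scaleR_add_right sum.distrib scaleR_sum_right mult.left_commute mult.commute)
  qed
  then show ?thesis
    using assms by (auto simp: imaginary_sd_forms_def hodge2_add hodge2_scaleR)
qed

text \<open>Extracts from the closure just what \<open>intersection_bound\<close> consumes:
  closeness of components on the finitely many compact sets \<open>rho_supp i\<close>.\<close>

lemma uniform_approximation:
  assumes Z: "\<eta> \<in> Cinf_topology M \<Omega> closure_of Z" and e: "e > 0" and \<Omega>: "\<Omega> = imaginary_sd_forms M"
  shows "\<exists>z\<in>Z. \<forall>i\<in>rho_index. \<forall>p\<in>rho_supp i. \<forall>k l. \<bar>Im ((z i p - \<eta> i p) $ k $ l)\<bar> < e"
proof -
  let ?T = "Cinf_topology M \<Omega>"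
  have \<eta>: "\<eta> \<in> \<Omega>" using Z topspace_Cinf by (fastforce simp: in_closure_of)
  \<comment> \<open>The empty list of derivatives asks for closeness of values only.\<close>
  define U where "U = (\<Inter>i\<in>rho_index. Cinf_basic M \<Omega> \<eta> i (\<phi> i ` rho_supp i) [] e) \<inter> topspace ?T"
  have "openin ?T U"
    unfolding U_def
    by (intro openin_INT finite_rho_index ballI openin_Cinf_basic \<eta> e compact_image rho_supp_compact rho_supp_sub image_mono)
  moreover have "\<eta> \<in> U" using \<eta> e by (simp add: U_def topspace_Cinf Cinf_basic_def)
  ultimately obtain z where z: "z \<in> Z" "z \<in> U" using Z by (auto simp: in_closure_of)
  have "\<bar>Im ((z i p - \<eta> i p) $ k $ l)\<bar> < e" if i: "i \<in> rho_index" and p: "p \<in> rho_supp i" for i p k l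
  proof -
    have pD: "p \<in> D i" using p rho_supp_sub by blast
    have "norm (in_coords M i (z i) (\<phi> i p) - in_coords M i (\<eta> i) (\<phi> i p)) < e"
      using z(2) i p by (auto simp: U_def Cinf_basic_def)
    then have "norm (z i p - \<eta> i p) < e" by (simp add: in_coords_chart[OF pD])
    moreover have "\<bar>Im ((z i p - \<eta> i p) $ k $ l)\<bar> \<le> norm (z i p - \<eta> i p)"
      by (rule order_trans[OF abs_Im_le_cmod order_trans[OF Finite_Cartesian_Product.norm_nth_le Finite_Cartesian_Product.norm_nth_le]])
    ultimately show ?thesis by simp
  qed
  then show ?thesis using z(1) by blast
qed

lemma b2plus_positive:
  assumes "b2plus M \<noteq> 0"
  obtains w where "w \<in> closed_two_forms M" "integral4 M (\<lambda>i p. wedge22 (w i p) (w i p)) > 0"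
proof -
  define P where "P k \<longleftrightarrow> (\<exists>a :: nat \<Rightarrow> 'i \<Rightarrow> 'a \<Rightarrow> real^4^4. (\<forall>r<k. a r \<in> closed_two_forms M) \<and>
     (\<forall>c :: nat \<Rightarrow> real. (\<exists>r<k. c r \<noteq> 0) \<longrightarrow>
        integral4 M (\<lambda>i p. wedge22 (\<Sum>r<k. c r *\<^sub>R a r i p) (\<Sum>r<k. c r *\<^sub>R a r i p)) > 0))" for k
  have "\<exists>k. P k \<and> k \<noteq> 0"
  proof (rule ccontr)
    assume "\<not> (\<exists>k. P k \<and> k \<noteq> 0)"
    then have "(SUP k\<in>{k. P k}. enat k) \<le> 0" by (intro SUP_least) (auto simp: zero_enat_def)
    then show False using assms by (simp add: b2plus_def P_def)
  qed
  then obtain k and a :: "nat \<Rightarrow> 'i \<Rightarrow> 'a \<Rightarrow> real^4^4" where k: "k \<noteq> 0" and a: "\<forall>r<k. a r \<in> closed_two_forms M"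
    and pos: "\<forall>c :: nat \<Rightarrow> real. (\<exists>r<k. c r \<noteq> 0) \<longrightarrow>
        integral4 M (\<lambda>i p. wedge22 (\<Sum>r<k. c r *\<^sub>R a r i p) (\<Sum>r<k. c r *\<^sub>R a r i p)) > 0"
    unfolding P_def by blast
  \<comment> \<open>These coefficients single out the first form of a positive definite
    family.\<close>
  define c :: "nat \<Rightarrow> real" where "c r = (if r = 0 then 1 else 0)" for r
  have "(\<Sum>r<k. c r *\<^sub>R a r i p) = a 0 i p" for i p
    using k by (simp add: c_def if_distrib[of "\<lambda>x. x *\<^sub>R _"] cong: if_cong)
  moreover have "\<exists>r<k. c r \<noteq> 0" using k by (intro exI[of _ 0]) (simp add: c_def)
  ultimately have "integral4 M (\<lambda>i p. wedge22 (a 0 i p) (a 0 i p)) > 0"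
    using pos[rule_format, of c] by simp
  moreover have "a 0 \<in> closed_two_forms M" using a k by blast
  ultimately show ?thesis by (intro that)
qed

end

theorem proposition2p1:
  fixes M :: "('a, 'i) riem4"
    and s :: "('a, 'i) spinc"
    and B :: "('a, 'i) spinc_conn"
    and E :: "'i \<Rightarrow> 'i \<Rightarrow> 'a \<Rightarrow> complex^'n^'n"
  assumes "closed_oriented_riemannian_4manifold M"
    and "b2plus M \<noteq> 0"
    and "spinc_structure M s"
    and "spinc_connection M s B"
    and "hermitian_bundle M E"
    and "CARD('n) > 1"
  shows "residual_in (Cinf_topology M (imaginary_sd_forms M))
           {\<eta> \<in> imaginary_sd_forms M. moduli_space M s B E 0 \<eta> = {}}"
proof -
  interpret manifold4 M by unfold_locales (rule assms(1))
  let ?\<Omega> = "imaginary_sd_forms M"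
  let ?T = "Cinf_topology M ?\<Omega>"
  obtain w where w: "w \<in> closed_two_forms M" and q: "integral4 M (\<lambda>i p. wedge22 (w i p) (w i p)) > 0"
    using b2plus_positive[OF assms(2)] .
  define v where "v = (\<lambda>i p. imag_form (sd_part (mmetric M i p) (w i p)))"
  have v: "v \<in> ?\<Omega>" unfolding v_def by (rule imag_sd_part_form[OF closed_two_forms_two_forms[OF w]])
  define Z where "Z = {\<eta> \<in> ?\<Omega>. monopoles M s B E 0 \<eta> \<noteq> {}}"
  \<comment> \<open>If both points were limits of \<open>Z\<close>, quotients
    \<open>(y - x) / t\<close> of differences in \<open>Z\<close> would approximate
    \<open>v\<close>. These are \<open>\<i>\<close> times self-dual parts of exact forms, which
    \<open>intersection_bound\<close> keeps away from \<open>v\<close>.\<close>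
  have separated: False if \<eta>: "\<eta> \<in> ?T closure_of Z" "(\<lambda>i p. \<eta> i p + t *\<^sub>R v i p) \<in> ?T closure_of Z" and t: "t > 0" for \<eta> t
  proof -
    let ?q = "integral4 M (\<lambda>i p. wedge22 (w i p) (w i p))" and ?V = "\<Sum>i\<in>rho_index. cint i (rho i)"
    \<comment> \<open>The summand 1 makes \<open>W\<close> positive without a look at the sign of
      the sum.\<close>
    define W where "W = \<bar>?V\<bar> + 1"
    have W: "W > 0" by (simp add: W_def)
    \<comment> \<open>Chosen so that the bound \<open>6 * d\<^sup>2 * W\<close> is half of the
      positive integral it would have to dominate.\<close>
    define d where "d = sqrt (?q / (12 * W))"
    have d: "d > 0" "12 * d\<^sup>2 * W = ?q" using q W by (simp_all add: d_def)
    \<comment> \<open>Two approximation errors of this size, divided by \<open>t\<close>, add up to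
      at most \<open>d\<close>.\<close>
    have e: "t * d / 2 > 0" using t d by simp
    obtain x where x: "x \<in> Z" "\<forall>i\<in>rho_index. \<forall>p\<in>rho_supp i. \<forall>k l. \<bar>Im ((x i p - \<eta> i p) $ k $ l)\<bar> < t * d / 2"
      using uniform_approximation[OF \<eta>(1) e refl] by blast
    obtain y where y: "y \<in> Z" "\<forall>i\<in>rho_index. \<forall>p\<in>rho_supp i. \<forall>k l.
        \<bar>Im ((y i p - (\<eta> i p + t *\<^sub>R v i p)) $ k $ l)\<bar> < t * d / 2"
      using uniform_approximation[OF \<eta>(2) e refl] by blast
    obtain b where b: "one_form M b" "\<forall>i. \<forall>p\<in>D i. \<forall>k l.
        1 / t * Im ((y i p - x i p) $ k $ l) = sd_part (mmetric M i p) (ext_d M b i p) $ k $ l"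
      using monopole_difference_exact[OF assms(3,5), of y B x "1 / t"] x(1) y(1) unfolding Z_def by blast
    have "\<bar>sd_part (mmetric M i p) (w i p - ext_d M b i p) $ k $ l\<bar> \<le> d"
      if i: "i \<in> rho_index" and p: "p \<in> rho_supp i" for i p k l
    proof -
      have pD: "p \<in> D i" using p rho_supp_sub by blast
      have "sd_part (mmetric M i p) (w i p - ext_d M b i p) $ k $ l
          = sd_part (mmetric M i p) (w i p) $ k $ l - sd_part (mmetric M i p) (ext_d M b i p) $ k $ l"
        by (simp add: sd_part_def hodge2_diff algebra_simps)
      also have "\<dots> = Im (v i p $ k $ l) - 1 / t * Im ((y i p - x i p) $ k $ l)"
        using b(2) pD by (simp add: v_def imag_form_def)
      also have "\<dots> = (Im ((x i p - \<eta> i p) $ k $ l) - Im ((y i p - (\<eta> i p + t *\<^sub>R v i p)) $ k $ l)) / t"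
        using t by (simp add: field_simps)
      finally have "\<bar>sd_part (mmetric M i p) (w i p - ext_d M b i p) $ k $ l\<bar>
          = \<bar>Im ((x i p - \<eta> i p) $ k $ l) - Im ((y i p - (\<eta> i p + t *\<^sub>R v i p)) $ k $ l)\<bar> / t"
        using t by simp
      also have "\<dots> \<le> (t * d) / t"
        using x(2)[rule_format, OF i p, of k l] y(2)[rule_format, OF i p, of k l] t
        by (intro divide_right_mono) linarith+
      finally show ?thesis using t by simp
    qed
    from intersection_bound[OF w b(1) this] have "?q \<le> 6 * d\<^sup>2 * ?V" by simp
    also have "\<dots> \<le> 6 * d\<^sup>2 * W" by (intro mult_left_mono) (auto simp: W_def)
    also have "\<dots> < ?q" using d q by simp
    finally show False by simp
  qed
  \<comment> \<open>Taking away the closure makes \<open>U\<close> open by construction, so the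
    single set \<open>U\<close> serves as the countable family; only its density remains.\<close>
  define U where "U = ?\<Omega> - ?T closure_of Z"
  have "openin ?T U"
    unfolding U_def using openin_diff[OF openin_topspace closedin_closure_of] topspace_Cinf by metis
  moreover have "?T closure_of U = topspace ?T"
  proof
    show "?T closure_of U \<subseteq> topspace ?T" by (rule closure_of_subset_topspace)
    show "topspace ?T \<subseteq> ?T closure_of U"
    proof
      fix \<eta> assume "\<eta> \<in> topspace ?T"
      then have \<eta>: "\<eta> \<in> ?\<Omega>" by (simp add: topspace_Cinf)
      show "\<eta> \<in> ?T closure_of U"
      proof (cases "\<eta> \<in> ?T closure_of Z")
        case False
        then show ?thesis using \<eta> closure_of_subset[of U ?T] by (auto simp: U_def topspace_Cinf)
      next
        case True
        have "\<exists>y\<in>U. y \<in> N" if N: "openin ?T N" "\<eta> \<in> N" for N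
        proof -
          have line: "(\<lambda>i p. \<eta> i p + t *\<^sub>R v i p) \<in> ?\<Omega>" for t
            by (rule imaginary_sd_forms_line[OF \<eta> v])
          have sm: "smooth_in M i (D i) (w i)" if "w \<in> ?\<Omega>" for i w
            using that by (intro two_formsD(1)) (simp add: imaginary_sd_forms_def)
          have "\<exists>d>0. \<forall>t. 0 \<le> t \<and> t < d \<longrightarrow> (\<lambda>i p. \<eta> i p + t *\<^sub>R v i p) \<in> N"
            by (rule Cinf_line_open[OF N line img_open]) (rule sm, assumption, rule sm[OF v])
          then obtain d where d: "d > 0" "\<forall>t. 0 \<le> t \<and> t < d \<longrightarrow> (\<lambda>i p. \<eta> i p + t *\<^sub>R v i p) \<in> N"
            by blast
          \<comment> \<open>The parameter \<open>d / 2\<close> is small enough to stay in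
            \<open>N\<close> and positive, as \<open>separated\<close> demands.\<close>
          have "(\<lambda>i p. \<eta> i p + (d / 2) *\<^sub>R v i p) \<in> U"
            unfolding U_def using line[of "d / 2"] separated[OF True, of "d / 2"] d(1) by auto
          then show ?thesis using d by (intro bexI[of _ "\<lambda>i p. \<eta> i p + (d / 2) *\<^sub>R v i p"]) auto
        qed
        then show ?thesis using \<eta> by (auto simp: in_closure_of topspace_Cinf)
      qed
    qed
  qed
  moreover have "topspace ?T \<inter> \<Inter> {U} \<subseteq> {\<eta> \<in> ?\<Omega>. moduli_space M s B E 0 \<eta> = {}}"
  proof -
    \<comment> \<open>Off \<open>Z\<close> the set of solutions is empty, and so is its quotient by
      the gauge relation.\<close>
    have "Z \<subseteq> ?T closure_of Z" by (rule closure_of_subset) (auto simp: Z_def topspace_Cinf)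
    then show ?thesis by (auto simp: U_def Z_def moduli_space_def)
  qed
  ultimately show ?thesis
    unfolding residual_in_def by (intro conjI exI[of _ "{U}"]) (auto simp: topspace_Cinf)
qed

end
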